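(* Let $e_n=[z^n]F_0(z)$ with $F_0(z)=D(z)E(z)$ be the total weight of excursions with catastrophes of length $n$. Then: (i) if $\rho_0<\rho$, $e_n=\frac{E(\rho_0)}{\rho_0Q'(\rho_0)}\rho_0^{-n}+o(K^n)$ for some $K<1/\rho_0$; (ii) if $\rho_0=\rho$, $e_n=\frac{E(\rho)}{\eta}\frac{\rho^{-n}}{\sqrt{\pi n}}\big(1+O(1/n)\big)$; (iii) if $\rho_0$ does not exist, $e_n=\frac{F_0(\rho)}{2}\Big(\sqrt{2\frac{P(\tau)}{P''(\tau)}}\,\frac1\tau+\eta D(\rho)\Big)\frac{\rho^{-n}}{\sqrt{\pi n^3}}\big(1+O(1/n)\big)$.
   Context: Fix integers $c,d\ge1$ and non-negative real weights $p_{-c},\dots,p_d$ with $p_{-c}\neq0\neq p_d$; jump set $\mathcal J=\{i: p_i\neq0\}$, jump polynomial $P(u)=\sum_{i=-c}^dp_iu^i$. Standing assumption: $P$ is aperiodic (there are no integer $b$, integer $p\ge2$ and Laurent polynomial $H$ with $P(u)=u^bH(u^p)$). A catastrophe is a step from an altitude $h>0$ with $-h\notin\mathcal J$ directly to altitude $0$, of weight $q>0$. Paths start at altitude $0$; each step is a jump $i\in\mathcal J$ (weight $p_i$) or a catastrophe; the weight of a path is the product of its step weights, and "number" means total weight. Meanders never go below $0$; excursions are meanders ending at $0$. Let $M(z,u)=\sum m_{n,k}z^nu^k$, with $m_{n,k}$ the total weight of catastrophe-free meanders of length $n$ ending at altitude $k$; $M_k(z)=[u^k]M(z,u)$, $M(z)=M(z,1)$,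 $E(z)=M_0(z)$. Let $Q(z)=zq\big(M(z)-E(z)-\sum_{j>0,-j\in\mathcal J}M_j(z)\big)$ and $D(z)=1/(1-Q(z))$. Let $\tau>0$ be the minimal positive real solution of $P'(\tau)=0$, $\rho=1/P(\tau)$. Let $\rho_0$ be the smallest positive real zero of $1-Q(z)$ satisfying $\rho_0\le\rho$, if it exists ("$\rho_0$ does not exist" otherwise). In the cases $\rho_0=\rho$ or $\rho_0$ nonexistent, $\eta$ is defined by the Puiseux expansion $Q(z)=Q(\rho)-\eta\sqrt{1-z/\rho}+O(1-z/\rho)$ as $z\to\rho$. *)

theory Defs
  imports "HOL-Analysis.Analysis" "HOL-Library.Landau_Symbols"
          "HOL-Computational_Algebra.Formal_Power_Series"
begin

definition jumps :: "(int \<Rightarrow> real) \<Rightarrow> int set" where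
  "jumps p = {i. p i \<noteq> 0}"

definition Ppoly :: "int \<Rightarrow> int \<Rightarrow> (int \<Rightarrow> real) \<Rightarrow> real \<Rightarrow> real" where
  "Ppoly c d p u = (\<Sum>i\<in>{-c..d}. p i * u powi i)"

text \<open>Aperiodicity: there are no integers b, k with k \<ge> 2 and Laurent polynomial H
  (finite support S, coefficients h) with P(u) = u^b H(u^k).\<close>
definition aperiodic :: "int \<Rightarrow> int \<Rightarrow> (int \<Rightarrow> real) \<Rightarrow> bool" where
  "aperiodic c d p \<longleftrightarrow>
     \<not> (\<exists>(b::int) (k::int) (S::int set) (h::int \<Rightarrow> real). 2 \<le> k \<and> finite S \<and>
          (\<forall>u::real. u \<noteq> 0 \<longrightarrow>
             Ppoly c d p u = u powi b * (\<Sum>j\<in>S. h j * (u powi k) powi j)))"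

datatype step = Jump int | Cat

fun next_alt :: "int \<Rightarrow> step \<Rightarrow> int" where
  "next_alt h (Jump i) = h + i"
| "next_alt h Cat = 0"

fun alts_from :: "int \<Rightarrow> step list \<Rightarrow> int list" where
  "alts_from h [] = []"
| "alts_from h (s # xs) = next_alt h s # alts_from (next_alt h s) xs"

definition final_alt :: "step list \<Rightarrow> int" where
  "final_alt xs = last (0 # alts_from 0 xs)"

fun valid_from :: "(int \<Rightarrow> real) \<Rightarrow> int \<Rightarrow> step list \<Rightarrow> bool" where
  "valid_from p h [] = True"
| "valid_from p h (Jump i # xs) = (i \<in> jumps p \<and> valid_from p (h + i) xs)"
| "valid_from p h (Cat # xs) = (0 < h \<and> - h \<notin> jumps p \<and> valid_from p 0 xs)"

fun weight :: "(int \<Rightarrow> real) \<Rightarrow> real \<Rightarrow> step list \<Rightarrow> real" where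
  "weight p q [] = 1"
| "weight p q (Jump i # xs) = p i * weight p q xs"
| "weight p q (Cat # xs) = q * weight p q xs"

definition paths :: "(int \<Rightarrow> real) \<Rightarrow> nat \<Rightarrow> step list set" where
  "paths p n = {xs. set xs \<subseteq> insert Cat (Jump ` jumps p) \<and> length xs = n \<and> valid_from p 0 xs}"

definition is_meander :: "step list \<Rightarrow> bool" where
  "is_meander xs \<longleftrightarrow> (\<forall>h\<in>set (alts_from 0 xs). 0 \<le> h)"

definition cat_free :: "step list \<Rightarrow> bool" where
  "cat_free xs \<longleftrightarrow> Cat \<notin> set xs"

definition mcoef :: "(int \<Rightarrow> real) \<Rightarrow> real \<Rightarrow> nat \<Rightarrow> int \<Rightarrow> real" where
  "mcoef p q n k = (\<Sum>xs\<in>{xs\<in>paths p n. is_meander xs \<and> cat_free xs \<and> final_alt xs = k}. weight p q xs)"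

definition mtot :: "(int \<Rightarrow> real) \<Rightarrow> real \<Rightarrow> nat \<Rightarrow> real" where
  "mtot p q n = (\<Sum>xs\<in>{xs\<in>paths p n. is_meander xs \<and> cat_free xs}. weight p q xs)"

definition negset :: "(int \<Rightarrow> real) \<Rightarrow> int set" where
  "negset p = {j. 0 < j \<and> - j \<in> jumps p}"

definition Mk_fun :: "(int \<Rightarrow> real) \<Rightarrow> real \<Rightarrow> int \<Rightarrow> real \<Rightarrow> real" where
  "Mk_fun p q k z = (\<Sum>n. mcoef p q n k * z ^ n)"

definition E_fun :: "(int \<Rightarrow> real) \<Rightarrow> real \<Rightarrow> real \<Rightarrow> real" where
  "E_fun p q z = Mk_fun p q 0 z"

definition M_fun :: "(int \<Rightarrow> real) \<Rightarrow> real \<Rightarrow> real \<Rightarrow> real" where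
  "M_fun p q z = (\<Sum>n. mtot p q n * z ^ n)"

definition Q_fun :: "(int \<Rightarrow> real) \<Rightarrow> real \<Rightarrow> real \<Rightarrow> real" where
  "Q_fun p q z = z * q * (M_fun p q z - E_fun p q z - (\<Sum>j\<in>negset p. Mk_fun p q j z))"

definition D_fun :: "(int \<Rightarrow> real) \<Rightarrow> real \<Rightarrow> real \<Rightarrow> real" where
  "D_fun p q z = 1 / (1 - Q_fun p q z)"

definition F0_fun :: "(int \<Rightarrow> real) \<Rightarrow> real \<Rightarrow> real \<Rightarrow> real" where
  "F0_fun p q z = D_fun p q z * E_fun p q z"

definition Mk_fps :: "(int \<Rightarrow> real) \<Rightarrow> real \<Rightarrow> int \<Rightarrow> real fps" where
  "Mk_fps p q k = Abs_fps (\<lambda>n. mcoef p q n k)"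

definition M_fps :: "(int \<Rightarrow> real) \<Rightarrow> real \<Rightarrow> real fps" where
  "M_fps p q = Abs_fps (\<lambda>n. mtot p q n)"

definition Q_fps :: "(int \<Rightarrow> real) \<Rightarrow> real \<Rightarrow> real fps" where
  "Q_fps p q = fps_X * fps_const q * (M_fps p q - Mk_fps p q 0 - (\<Sum>j\<in>negset p. Mk_fps p q j))"

definition F0_fps :: "(int \<Rightarrow> real) \<Rightarrow> real \<Rightarrow> real fps" where
  "F0_fps p q = inverse (1 - Q_fps p q) * Mk_fps p q 0"

definition exc_coeff :: "(int \<Rightarrow> real) \<Rightarrow> real \<Rightarrow> nat \<Rightarrow> real" where
  "exc_coeff p q n = fps_nth (F0_fps p q) n"

definition tau :: "int \<Rightarrow> int \<Rightarrow> (int \<Rightarrow> real) \<Rightarrow> real" where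
  "tau c d p = (THE t. 0 < t \<and> deriv (Ppoly c d p) t = 0 \<and>
                 (\<forall>s. 0 < s \<and> deriv (Ppoly c d p) s = 0 \<longrightarrow> t \<le> s))"

definition rho :: "int \<Rightarrow> int \<Rightarrow> (int \<Rightarrow> real) \<Rightarrow> real" where
  "rho c d p = 1 / Ppoly c d p (tau c d p)"

text \<open>r is rho_0: the smallest positive real zero of 1 - Q(z) (among the points where the
  series M(z), hence Q(z), converges) with r \<le> rho.\<close>
definition is_rho0 :: "int \<Rightarrow> int \<Rightarrow> (int \<Rightarrow> real) \<Rightarrow> real \<Rightarrow> real \<Rightarrow> bool" where
  "is_rho0 c d p q r \<longleftrightarrow>
     0 < r \<and> r \<le> rho c d p \<and> summable (\<lambda>n. mtot p q n * r ^ n) \<and> 1 - Q_fun p q r = 0 \<and>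
     (\<forall>s. 0 < s \<and> s < r \<and> summable (\<lambda>n. mtot p q n * s ^ n) \<longrightarrow> 1 - Q_fun p q s \<noteq> 0)"

definition eta :: "int \<Rightarrow> int \<Rightarrow> (int \<Rightarrow> real) \<Rightarrow> real \<Rightarrow> real" where
  "eta c d p q = (THE \<eta>.
     (\<lambda>z. Q_fun p q z - (Q_fun p q (rho c d p) - \<eta> * sqrt (1 - z / rho c d p)))
       \<in> O[at_left (rho c d p)](\<lambda>z. 1 - z / rho c d p))"

end

theory Submission
  imports Defs "HOL-Complex_Analysis.Complex_Analysis" "HOL-Real_Asymp.Real_Asymp"
begin

text \<open>
  Spitzer's identity expresses the meander series through \<open>\<Sum>\<^sub>l z\<^sup>l [u\<^sup>j] P(u)\<^sup>l\<close>, a contour integral of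
  \<open>u\<^bsup>-j-1\<^esup> / (1 - z P(u))\<close> over \<open>|u| = \<tau>\<close>. By aperiodicity this integral continues analytically across
  \<open>|z| = \<rho>\<close> except at \<open>z = \<rho>\<close>; there, moving the contour over the large root that meets the saddle point \<open>\<tau>\<close>
  shows that it is an analytic function of \<open>s = sqrt (1 - z / \<rho>)\<close> divided by \<open>s\<close>. Integrating Spitzer's differential
  equation, every \<open>M\<^sub>k\<close> is analytic in \<open>s\<close>, with \<open>E'(0) / E(0) = - sqrt (2 P(\<tau>) / P''(\<tau>)) / \<tau>\<close> as a function of \<open>s\<close>.

  Summing the kernel equation at \<open>u = 1\<close> and near \<open>u = 1\<close> shows that \<open>M\<close> diverges at \<open>1 / P(1) \<le> \<rho>\<close> when \<open>\<tau> \<le> 1\<close>, so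
  that \<open>\<rho>\<^sub>0 < \<rho>\<close>; hence \<open>\<tau> > 1\<close> in the two other cases, \<open>M\<close> and \<open>Q\<close> are analytic in \<open>s\<close> as well, and \<open>E / (1 - Q)\<close>
  is analytic in \<open>s\<close> (if \<open>Q(\<rho>) < 1\<close>) or has a simple pole at \<open>s = 0\<close> (if \<open>Q(\<rho>) = 1\<close>). The coefficient asymptotics
  follow from Cauchy estimates after removing the first powers of \<open>s\<close>. If \<open>\<rho>\<^sub>0 < \<rho>\<close>, then \<open>E / (1 - Q)\<close> has a single
  simple pole in a disc of radius larger than \<open>\<rho>\<^sub>0\<close>.
\<close>

subsection \<open>Transfer for square-root singularities\<close>

text \<open>Singularity analysis usually continues a function beyond its circle of convergence. Here
  the error terms use the closed disc only: once the powers s^0, ..., s^4 are removed, three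
  derivatives in x leave a function bounded by a multiple of |1 - x|^(-1/2), and Cauchy's estimate
  on the circle of radius 1 - 1/(n+2) yields n^(-5/2). The kernel method would express E and the M_k
  through all small roots of 1 = z P(u) and would have to follow these branches over the whole disc.
  Spitzer's identity sees P only through the coefficients [u^j] P^l, so that just the two roots
  meeting at tau need control, and only near z = rho; elsewhere on the closed disc the kernel has no
  zero on the contour. Replacing p_i by rho tau^i p_i turns the jumps into a mean-zero probability
  law and moves both rho and tau to 1. The price is that M(z, 1) becomes a sum over k of normalised
  series with weights tau^(-k). Uniform bounds on the normalised coefficients sum up only if tau >
  1, which is why the position of tau relative to 1 matters.\<close>

text \<open>The map \<open>x \<mapsto> csqrt (1 - x)\<close> sends the closed unit disc onto the compact set \<open>lobe\<close>, so a function
  whose only singularity on the closed disc is of square-root type at \<open>1\<close> is the same thing as a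
  function analytic on \<open>lobe\<close>. This class is visibly closed under sums, products, quotients, exponentials
  and primitives.\<close>

definition lobe :: "complex set" where
  "lobe = {s. 0 \<le> Re s \<and> norm (1 - s\<^sup>2) \<le> 1}"

lemma lobe_0 [simp]: "0 \<in> lobe"
  by (simp add: lobe_def)

lemma eventually_norm_less: "r > 0 \<Longrightarrow> \<forall>\<^sub>F x in nhds 0. norm (x :: complex) < r"
  using eventually_nhds_in_open[OF open_ball[of "0 :: complex" r]] by (auto elim!: eventually_mono)

lemma norm_lobe_le:
  assumes "s \<in> lobe"
  shows "norm s \<le> 2"
proof -
  have "norm (s\<^sup>2) \<le> norm (1::complex) + norm (1 - s\<^sup>2)"
    using norm_triangle_ineq4[of 1 "1 - s\<^sup>2"] by simp
  also have "\<dots> \<le> 2" using assms by (simp add: lobe_def)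
  finally have "(norm s)\<^sup>2 \<le> 2" by (simp add: norm_power)
  also have "\<dots> \<le> 2\<^sup>2" by simp
  finally show ?thesis by (rule power2_le_imp_le) simp
qed

lemma compact_lobe: "compact lobe"
proof -
  have "closed ({s. 0 \<le> Re s} \<inter> {s. norm (1 - s\<^sup>2) \<le> 1})"
    by (intro closed_Int closed_Collect_le continuous_intros)
  moreover have "{s. 0 \<le> Re s} \<inter> {s. norm (1 - s\<^sup>2) \<le> 1} = lobe"
    by (auto simp: lobe_def)
  moreover have "bounded lobe"
    using norm_lobe_le by (auto simp: bounded_iff)
  ultimately show ?thesis
    by (simp add: compact_eq_bounded_closed)
qed

lemma csqrt_in_lobe:
  assumes "norm x \<le> 1"
  shows "csqrt (1 - x) \<in> lobe"
  using assms Re_csqrt[of "1 - x"] by (auto simp: lobe_def)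

text \<open>The inequality Re (1 - s^2) <= 1 says that Re (s^2) >= 0, so \<open>lobe\<close> lies in
  the sector of half-angle pi/4. In this sector the linear term of the two local roots decides which
  of them is outside the unit circle.\<close>

lemma lobe_cone:
  assumes "s \<in> lobe"
  shows "\<bar>Im s\<bar> \<le> Re s"
proof -
  have "Re (1 - s\<^sup>2) \<le> 1"
    using assms complex_Re_le_cmod[of "1 - s\<^sup>2"] by (simp add: lobe_def)
  hence "(Im s)\<^sup>2 \<le> (Re s)\<^sup>2" by (simp add: power2_eq_square)
  thus ?thesis
    using assms abs_le_square_iff[of "Im s" "Re s"] by (simp add: lobe_def)
qed

lemma lobe_Re_pos:
  assumes "s \<in> lobe" "s \<noteq> 0"
  shows "Re s > 0"
  using lobe_cone[OF assms(1)] assms(2) by (cases "Re s = 0") (auto simp: complex_eq_iff)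

lemma csqrt_lobe:
  assumes "s \<in> lobe"
  shows "csqrt (1 - (1 - s\<^sup>2)) = s"
proof (cases "s = 0")
  case False
  thus ?thesis using lobe_Re_pos[OF assms] by (simp add: csqrt_square)
qed simp

text \<open>Star-shapedness about 0, needed for primitives: 1 - (t s)^2 is the convex combination of
  1 and 1 - s^2 with weights 1 - t^2 and t^2.\<close>

lemma lobe_scale:
  assumes "s \<in> lobe" "0 \<le> t" "t \<le> 1"
  shows "of_real t * s \<in> lobe"
proof -
  have "1 - (of_real t * s)\<^sup>2 = of_real (1 - t\<^sup>2) + of_real (t\<^sup>2) * (1 - s\<^sup>2)"
    by (simp add: algebra_simps)
  also have "norm \<dots> \<le> (1 - t\<^sup>2) + t\<^sup>2 * norm (1 - s\<^sup>2)"
    using assms by (intro order_trans[OF norm_triangle_ineq])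
      (simp add: norm_mult power_le_one del: of_real_diff of_real_power)
  also have "\<dots> \<le> (1 - t\<^sup>2) + t\<^sup>2 * 1"
    using assms by (intro add_left_mono mult_left_mono) (auto simp: lobe_def)
  finally show ?thesis using assms by (simp add: lobe_def)
qed

lemma csqrt_disc:
  assumes "norm x < 1"
  shows "1 - x \<notin> \<real>\<^sub>\<le>\<^sub>0" "csqrt (1 - x) \<noteq> 0"
    "norm (1 - (csqrt (1 - x))\<^sup>2) < 1" "Re (csqrt (1 - x)) > 0"
proof -
  have "Re x < 1" using assms complex_Re_le_cmod[of x] by linarith
  thus *: "1 - x \<notin> \<real>\<^sub>\<le>\<^sub>0" by (auto simp: complex_nonpos_Reals_iff)
  show **: "csqrt (1 - x) \<noteq> 0" using assms by auto
  show "norm (1 - (csqrt (1 - x))\<^sup>2) < 1" using assms by simp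
  show "Re (csqrt (1 - x)) > 0"
    using lobe_Re_pos[OF csqrt_in_lobe **] assms by simp
qed

lemma analytic_on_lobe_open:
  assumes "H analytic_on lobe"
  obtains S where "open S" "lobe \<subseteq> S" "H holomorphic_on S"
  using assms unfolding analytic_on_holomorphic by auto

lemma analytic_lobe_bounded:
  assumes "H analytic_on lobe"
  obtains B where "B > 0" "\<And>s. s \<in> lobe \<Longrightarrow> norm (H s) \<le> B"
proof -
  have "compact (H ` lobe)"
    using assms compact_lobe
    by (intro compact_continuous_image holomorphic_on_imp_continuous_on analytic_imp_holomorphic)
  thus ?thesis using that bounded_pos[of "H ` lobe"] compact_imp_bounded by auto
qed

text \<open>Removing one Taylor coefficient at 0. Off 0 the function \<open>G\<close> is the plain
  difference quotient, so the identity holds for every s, and only the analyticity refers to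
  \<open>lobe\<close>. Iterating this extracts successive powers of s.\<close>

lemma analytic_lobe_peel:
  assumes "H analytic_on lobe"
  obtains G where "G analytic_on lobe" "\<And>s. H s = H 0 + s * G s" "G 0 = deriv H 0"
proof -
  obtain S where S: "open S" "lobe \<subseteq> S" "H holomorphic_on S"
    using analytic_on_lobe_open[OF assms] by blast
  define G where "G = (\<lambda>s. if s = 0 then deriv H 0 else (H s - H 0) / (s - 0))"
  have "G holomorphic_on S" unfolding G_def
    using S lobe_0 by (intro pole_lemma) (auto simp: interior_open)
  hence "G analytic_on lobe" using S analytic_on_open analytic_on_subset by blast
  moreover have "H s = H 0 + s * G s" for s by (simp add: G_def)
  ultimately show ?thesis by (intro that[of G]) (auto simp: G_def)
qed

lemma analytic_lobe_primitive:
  assumes "H analytic_on lobe"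
  obtains V where "V analytic_on lobe" "\<And>s. s \<in> lobe \<Longrightarrow> (V has_field_derivative H s) (at s)"
proof -
  obtain S where S: "open S" "lobe \<subseteq> S" "H holomorphic_on S"
    using analytic_on_lobe_open[OF assms] by blast
  \<comment> \<open>The neighbourhood \<open>S\<close> of \<open>lobe\<close> need not be starlike.
    Its subset of points visible from 0 is open and starlike, and it still contains
    \<open>lobe\<close> because \<open>lobe\<close> is star-shaped about 0.\<close>
  define T where "T = {s. closed_segment 0 s \<subseteq> S}"
  have seg: "closed_segment 0 s = (\<lambda>t. of_real t * s) ` {0..1}" for s :: complex
    by (auto simp: closed_segment_def image_iff scaleR_conv_of_real)
  have "open T"
  proof (rule openI)
    fix s assume "s \<in> T"
    hence sub: "closed_segment 0 s \<subseteq> S" by (simp add: T_def)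
    obtain e where e: "e > 0" "(\<Union>x\<in>closed_segment 0 s. ball x e) \<subseteq> S"
      using compact_subset_open_imp_ball_epsilon_subset[OF compact_segment S(1) sub] by metis
    have "ball s e \<subseteq> T"
    proof
      fix y assume y: "y \<in> ball s e"
      have "of_real t * y \<in> S" if t: "t \<in> {0..1}" for t :: real
      proof -
        have "dist (of_real t * s) (of_real t * y) = t * dist s y"
          using t by (simp add: dist_norm norm_mult flip: right_diff_distrib)
        also have "\<dots> \<le> dist s y" using t by (simp add: mult_left_le_one_le)
        also have "\<dots> < e" using y by simp
        finally have "of_real t * y \<in> ball (of_real t * s) e" by simp
        moreover have "of_real t * s \<in> closed_segment 0 s" using t by (auto simp: seg)
        ultimately show ?thesis using e by blast
      qed
      thus "y \<in> T" by (auto simp: T_def seg)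
    qed
    thus "\<exists>e>0. ball s e \<subseteq> T" using e by blast
  qed
  have "lobe \<subseteq> T"
  proof
    fix s assume "s \<in> lobe"
    hence "closed_segment 0 s \<subseteq> lobe" by (auto simp: seg intro: lobe_scale)
    thus "s \<in> T" using S by (auto simp: T_def)
  qed
  have "T \<subseteq> S" by (auto simp: T_def)
  have "0 \<in> T" using \<open>lobe \<subseteq> T\<close> lobe_0 by blast
  have "starlike T"
    unfolding starlike_def
  proof (intro bexI[of _ 0] ballI \<open>0 \<in> T\<close> subsetI)
    fix s y assume s: "s \<in> T" and y: "y \<in> closed_segment 0 s"
    have "closed_segment 0 y \<subseteq> closed_segment 0 s"
      using y by (simp add: subset_closed_segment)
    thus "y \<in> T" using s by (auto simp: T_def)
  qed
  moreover have holT: "H holomorphic_on T" using S \<open>T \<subseteq> S\<close> holomorphic_on_subset by blast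
  ultimately obtain V where V: "\<And>x. x \<in> T \<Longrightarrow> (V has_field_derivative H x) (at x)"
    using holomorphic_starlike_primitive[of T H "{}"] \<open>open T\<close> holomorphic_on_imp_continuous_on
      holomorphic_on_imp_differentiable_at by (metis Diff_empty finite.emptyI)
  have "V holomorphic_on T"
    using V \<open>open T\<close> by (auto simp: holomorphic_on_open)
  hence "V analytic_on lobe"
    using \<open>open T\<close> \<open>lobe \<subseteq> T\<close> analytic_on_open analytic_on_subset by blast
  thus ?thesis using that V \<open>lobe \<subseteq> T\<close> by blast
qed

lemma csqrt_comp_deriv:
  assumes "norm x < 1" "(G has_field_derivative D) (at (csqrt (1 - x)))"
  shows "((\<lambda>x. G (csqrt (1 - x))) has_field_derivative - D / (2 * csqrt (1 - x))) (at x)"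
proof -
  have "((\<lambda>x. csqrt (1 - x)) has_field_derivative -1 / (2 * csqrt (1 - x))) (at x)"
    using csqrt_disc[OF assms(1)] by (auto intro!: derivative_eq_intros)
  from DERIV_chain2[OF assms(2) this] show ?thesis by simp
qed

lemma analytic_lobe_has_deriv:
  assumes "H analytic_on lobe" "s \<in> lobe"
  shows "(H has_field_derivative deriv H s) (at s)"
  using assms analytic_on_imp_differentiable_at field_differentiable_derivI by blast

lemma analytic_lobe_comp_holomorphic:
  assumes "H analytic_on lobe"
  shows "(\<lambda>x. H (csqrt (1 - x))) holomorphic_on ball 0 1"
  unfolding holomorphic_on_open[OF open_ball]
  using csqrt_comp_deriv[OF _ analytic_lobe_has_deriv[OF assms csqrt_in_lobe]]
  by (auto intro!: exI)

text \<open>Since ds/dx = -1/(2s), one derivative in x lowers the exponent of s by two and replaces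
  the analytic factor by another one. The form s^m / s also covers m = 0, where the new exponent is
  -1.\<close>

lemma analytic_lobe_power_deriv:
  assumes "G analytic_on lobe"
  obtains G' where "G' analytic_on lobe"
    "\<And>x. norm x < 1 \<Longrightarrow> ((\<lambda>x. csqrt (1 - x) ^ Suc m * G (csqrt (1 - x))) has_field_derivative
        csqrt (1 - x) ^ m / csqrt (1 - x) * G' (csqrt (1 - x))) (at x)"
proof -
  define G' where "G' = (\<lambda>s. - (of_nat (Suc m) * G s + s * deriv G s) / 2)"
  have "G' analytic_on lobe"
    unfolding G'_def using assms by (auto intro!: analytic_intros)
  moreover have "((\<lambda>x. csqrt (1 - x) ^ Suc m * G (csqrt (1 - x))) has_field_derivative
        csqrt (1 - x) ^ m / csqrt (1 - x) * G' (csqrt (1 - x))) (at x)" if x: "norm x < 1" for x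
  proof -
    let ?s = "csqrt (1 - x)"
    have "?s \<in> lobe" using x by (intro csqrt_in_lobe) simp
    note d = analytic_lobe_has_deriv[OF assms this]
    have "((\<lambda>s. s ^ Suc m * G s) has_field_derivative
            (of_nat (Suc m) * ?s ^ m * G ?s + ?s ^ Suc m * deriv G ?s)) (at ?s)"
      by (rule derivative_eq_intros d refl | simp add: algebra_simps)+
    from csqrt_comp_deriv[OF x this] show ?thesis
      by (rule DERIV_cong) (use csqrt_disc[OF x] in \<open>simp add: G'_def field_simps\<close>)
  qed
  ultimately show ?thesis using that by blast
qed

section \<open>Coefficients of (1 - x)^(-1/2) and (1 - x)^(1/2)\<close>

definition rsqrt_coeff :: "nat \<Rightarrow> real" where
  "rsqrt_coeff n = pochhammer (1/2) n / fact n"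

definition sqrt_coeff :: "nat \<Rightarrow> real" where
  "sqrt_coeff n = - rsqrt_coeff n / (2 * real n - 1)"

lemma rsqrt_coeff_Suc: "rsqrt_coeff (Suc n) = rsqrt_coeff n * ((real n + 1/2) / (real n + 1))"
  by (simp add: rsqrt_coeff_def pochhammer_Suc field_simps)

lemma rsqrt_coeff_pos: "rsqrt_coeff n > 0"
  by (simp add: rsqrt_coeff_def pochhammer_pos)

lemma rsqrt_coeff_limit: "(\<lambda>n. rsqrt_coeff n * sqrt (real n)) \<longlonglongrightarrow> 1 / sqrt pi"
proof -
  \<comment> \<open>\<open>Gamma_series (1/2) n\<close> has n + 1 factors in its Pochhammer symbol,
    one more than \<open>rsqrt_coeff n\<close>; the quotient n / (n + 1/2) cancels the last one and
    turns 1 / sqrt n into sqrt n.\<close>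
  have "(\<lambda>n. inverse (Gamma_series (1/2) n) * (real n / (real n + 1/2))) \<longlonglongrightarrow> inverse (Gamma (1/2::real)) * 1"
    by (intro tendsto_mult tendsto_inverse Gamma_series_LIMSEQ) (simp add: Gamma_one_half_real, real_asymp)
  also have "inverse (Gamma (1/2::real)) * 1 = 1 / sqrt pi"
    by (simp add: Gamma_one_half_real field_simps)
  finally have *: "(\<lambda>n. inverse (Gamma_series (1/2) n) * (real n / (real n + 1/2))) \<longlonglongrightarrow> 1 / sqrt pi" .
  show ?thesis
  proof (rule Lim_transform_eventually[OF *])
    show "\<forall>\<^sub>F n in sequentially. inverse (Gamma_series (1/2) n) * (real n / (real n + 1/2)) =
            rsqrt_coeff n * sqrt (real n)"
      using eventually_gt_at_top[of 0]
    proof eventually_elim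
      case (elim n)
      have e: "exp (ln (real n) / 2) = sqrt (real n)"
        using elim by (simp flip: ln_sqrt)
      have "real n / sqrt (real n) = sqrt (real n)" by (simp add: real_div_sqrt)
      moreover have "inverse (Gamma_series (1/2) n) * (real n / (real n + 1/2)) =
          rsqrt_coeff n * (real n / sqrt (real n))"
        using elim by (simp add: Gamma_series_def rsqrt_coeff_def pochhammer_Suc e divide_simps add.commute)
      ultimately show ?case by simp
    qed
  qed
qed

text \<open>Wallis-type bracketing: the square times n increases, the square times n + 1/2
  decreases, and both tend to 1/pi. This yields the relative error O(1/n) without Stirling's
  formula.\<close>

lemma rsqrt_coeff_bounds:
  assumes "n > 0"
  shows "1 / (pi * (real n + 1/2)) \<le> (rsqrt_coeff n)\<^sup>2" "(rsqrt_coeff n)\<^sup>2 \<le> 1 / (pi * real n)"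
proof -
  define f where "f = (\<lambda>n. (rsqrt_coeff n)\<^sup>2 * real n)"
  define g where "g = (\<lambda>n. (rsqrt_coeff n)\<^sup>2 * (real n + 1/2))"
  have lf: "f \<longlonglongrightarrow> 1 / pi"
    using tendsto_power[OF rsqrt_coeff_limit, of 2]
    by (simp add: f_def power_mult_distrib power_divide)
  have "(\<lambda>n. f n * ((real n + 1/2) / real n)) \<longlonglongrightarrow> 1 / pi * 1"
    by (intro tendsto_mult lf) real_asymp
  moreover have "\<forall>\<^sub>F n in sequentially. f n * ((real n + 1/2) / real n) = g n"
    using eventually_gt_at_top[of 0] by eventually_elim (auto simp: f_def g_def field_simps)
  ultimately have lg: "g \<longlonglongrightarrow> 1 / pi" by (simp add: tendsto_cong)
  have sq: "0 < (rsqrt_coeff n)\<^sup>2" for n using rsqrt_coeff_pos[of n] by simp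
  have "f n \<le> f (Suc n)" for n
  proof -
    have "real n \<le> ((real n + 1/2) / (real n + 1))\<^sup>2 * (real n + 1)"
      by (simp add: divide_simps power2_eq_square) (simp add: algebra_simps)
    hence "(rsqrt_coeff n)\<^sup>2 * real n \<le> (rsqrt_coeff n)\<^sup>2 * (((real n + 1/2) / (real n + 1))\<^sup>2 * (real n + 1))"
      using sq[of n] by (intro mult_left_mono) auto
    thus ?thesis by (simp add: f_def rsqrt_coeff_Suc power_mult_distrib power_divide mult.assoc add.commute)
  qed
  hence "incseq f" by (rule incseq_SucI)
  from incseq_le[OF this lf, of n] show "(rsqrt_coeff n)\<^sup>2 \<le> 1 / (pi * real n)"
    using assms by (simp add: f_def field_simps)
  have "g (Suc n) \<le> g n" for n
  proof -
    have "((real n + 1/2) / (real n + 1))\<^sup>2 * (real n + 3/2) \<le> real n + 1/2"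
      by (simp add: divide_simps power2_eq_square) (simp add: algebra_simps)
    hence "(rsqrt_coeff n)\<^sup>2 * (((real n + 1/2) / (real n + 1))\<^sup>2 * (real n + 3/2)) \<le> (rsqrt_coeff n)\<^sup>2 * (real n + 1/2)"
      using sq[of n] by (intro mult_left_mono) auto
    thus ?thesis by (simp add: g_def rsqrt_coeff_Suc power_mult_distrib power_divide mult.assoc add.commute)
  qed
  hence "decseq g" by (rule decseq_SucI)
  from decseq_ge[OF this lg, of n] show "1 / (pi * (real n + 1/2)) \<le> (rsqrt_coeff n)\<^sup>2"
    by (simp add: g_def divide_simps add_pos_nonneg) (simp add: algebra_simps)
qed

lemma rsqrt_coeff_asymp:
  "(\<lambda>n. rsqrt_coeff n * sqrt (pi * real n) - 1) \<in> O(\<lambda>n. 1 / real n)"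
proof (rule bigoI[of _ 1])
  show "\<forall>\<^sub>F n in sequentially. norm (rsqrt_coeff n * sqrt (pi * real n) - 1) \<le> 1 * norm (1 / real n)"
    using eventually_gt_at_top[of 0]
  proof eventually_elim
    case (elim n)
    let ?y = "rsqrt_coeff n * sqrt (pi * real n)"
    have y: "?y \<ge> 0" using rsqrt_coeff_pos[of n] by simp
    have y2: "?y\<^sup>2 = (rsqrt_coeff n)\<^sup>2 * (pi * real n)" by (simp add: power_mult_distrib)
    have "?y\<^sup>2 \<le> 1" using rsqrt_coeff_bounds(2)[OF elim] elim by (simp add: y2 field_simps)
    hence y1: "?y \<le> 1" using y by (simp add: power_le_one_iff)
    have "?y\<^sup>2 \<ge> 1 / (pi * (real n + 1/2)) * (pi * real n)"
      unfolding y2 by (intro mult_right_mono rsqrt_coeff_bounds elim) auto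
    also have "1 / (pi * (real n + 1/2)) * (pi * real n) = real n / (real n + 1/2)"
      by simp
    also have "real n / (real n + 1/2) \<ge> 1 - 1 / real n"
      using elim by (simp add: field_simps)
    finally have "?y\<^sup>2 \<ge> 1 - 1 / real n" .
    moreover have "?y\<^sup>2 \<le> ?y" using y y1 by (simp add: power2_eq_square mult_left_le)
    ultimately show ?case using y1 by simp
  qed
qed

lemma one_minus_powr_fps_expansion:
  "(\<lambda>x. (1 - x) powr a) has_fps_expansion Abs_fps (\<lambda>n. pochhammer (- a) n / fact n :: complex)"
proof (rule has_fps_expansionI)
  show "\<forall>\<^sub>F u in nhds 0. (\<lambda>n. fps_nth (Abs_fps (\<lambda>n. pochhammer (- a) n / fact n)) n * u ^ n) sums ((1 - u) powr a)"
    using eventually_norm_less[OF zero_less_one]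
  proof eventually_elim
    case (elim u)
    have "(a gchoose n) * (-u) ^ n = pochhammer (- a) n / fact n * u ^ n" for n
      unfolding gbinomial_pochhammer power_minus[of u]
      by (simp add: mult_ac flip: power_mult_distrib)
    thus ?case using gen_binomial_complex[of "-u" a] elim by simp
  qed
qed

lemma csqrt_fps_expansion:
  "(\<lambda>x. csqrt (1 - x)) has_fps_expansion Abs_fps (\<lambda>n. complex_of_real (sqrt_coeff n))"
proof -
  have "pochhammer (-1/2 :: real) n = - pochhammer (1/2) n / (2 * real n - 1)" for n
  proof (induction n)
    case (Suc n)
    have "2 * real n - 1 \<noteq> 0"
      by (cases n) auto
    hence "pochhammer (-1/2 :: real) (Suc n) = - pochhammer (1/2) n / 2"
      unfolding pochhammer_Suc Suc by (simp add: divide_simps)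
    also have "\<dots> = - pochhammer (1/2) (Suc n) / (2 * real (Suc n) - 1)"
      by (simp add: pochhammer_Suc field_simps)
    finally show ?case .
  qed simp
  hence "sqrt_coeff n = pochhammer (-1/2) n / fact n" for n
    by (simp add: sqrt_coeff_def rsqrt_coeff_def)
  hence "complex_of_real (sqrt_coeff n) = pochhammer (-(1/2)) n / fact n" for n
    by (simp flip: pochhammer_of_real)
  hence "(\<lambda>x. (1 - x) powr (1/2)) has_fps_expansion Abs_fps (\<lambda>n. complex_of_real (sqrt_coeff n))"
    using one_minus_powr_fps_expansion[of "1/2"] by simp
  also have "?this \<longleftrightarrow> ?thesis"
  proof (rule has_fps_expansion_cong)
    show "\<forall>\<^sub>F x in nhds 0. (1 - x) powr (1/2) = csqrt (1 - x)"
      using eventually_norm_less[OF zero_less_one] by eventually_elim (auto simp: csqrt_conv_powr)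
  qed simp
  finally show ?thesis .
qed

lemma rsqrt_fps_expansion:
  "(\<lambda>x. 1 / csqrt (1 - x)) has_fps_expansion Abs_fps (\<lambda>n. complex_of_real (rsqrt_coeff n))"
proof -
  have "complex_of_real (rsqrt_coeff n) = pochhammer (-(-1/2)) n / fact n" for n
    by (simp add: rsqrt_coeff_def flip: pochhammer_of_real)
  hence "(\<lambda>x. (1 - x) powr (-1/2)) has_fps_expansion Abs_fps (\<lambda>n. complex_of_real (rsqrt_coeff n))"
    using one_minus_powr_fps_expansion[of "-1/2"] by simp
  also have "?this \<longleftrightarrow> ?thesis"
  proof (rule has_fps_expansion_cong)
    show "\<forall>\<^sub>F x in nhds 0. (1 - x) powr (-1/2) = 1 / csqrt (1 - x)"
      using eventually_norm_less[OF zero_less_one]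
      by eventually_elim (auto simp: csqrt_conv_powr powr_minus field_simps)
  qed simp
  finally show ?thesis .
qed

lemma rsqrt_coeff_bigo: "rsqrt_coeff \<in> O(\<lambda>n. real n powr (-1/2))"
proof (rule bigoI[of _ 1])
  show "\<forall>\<^sub>F n in sequentially. norm (rsqrt_coeff n) \<le> 1 * norm (real n powr (-1/2))"
    using eventually_gt_at_top[of 0]
  proof eventually_elim
    case (elim n)
    have "(rsqrt_coeff n)\<^sup>2 \<le> 1 / (pi * real n)" by (rule rsqrt_coeff_bounds[OF elim])
    also have "\<dots> \<le> 1 / (1 * real n)"
      using elim pi_ge_two by (intro divide_left_mono mult_right_mono) auto
    also have "\<dots> = (real n powr (-1/2))\<^sup>2"
      using elim by (simp add: powr_minus powr_half_sqrt field_simps)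
    finally show ?case using rsqrt_coeff_pos[of n]
      by (simp add: abs_le_square_iff)
  qed
qed

lemma sqrt_coeff_bigo: "sqrt_coeff \<in> O(\<lambda>n. real n powr (-3/2))"
proof -
  have "(\<lambda>n. - rsqrt_coeff n * (1 / (2 * real n - 1))) \<in> O(\<lambda>n. real n powr (-1/2) * real n powr (-1))"
    by (intro landau_o.big.mult) (use rsqrt_coeff_bigo in simp, real_asymp)
  also have "(\<lambda>n. - rsqrt_coeff n * (1 / (2 * real n - 1))) = sqrt_coeff"
    by (simp add: sqrt_coeff_def fun_eq_iff)
  also have "(\<lambda>n. real n powr (-1/2) * real n powr (-1)) = (\<lambda>n. real n powr (-3/2))"
    by (simp only: powr_add[symmetric]) simp
  finally show ?thesis .
qed

text \<open>For n >= 1 the difference is the coefficient of x^n in (1 - x)^(3/2), that is, the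
  contribution of s^3; it is smaller than \<open>sqrt_coeff\<close> by a factor of order
  1/n.\<close>

lemma sqrt_coeff_diff_bigo: "(\<lambda>n. sqrt_coeff n - sqrt_coeff (n - 1)) \<in> O(\<lambda>n. real n powr (-5/2))"
proof -
  have "(\<lambda>n. sqrt_coeff n * (-3 / (2 * real n - 3))) \<in> O(\<lambda>n. real n powr (-3/2) * real n powr (-1))"
    by (intro landau_o.big.mult) (use sqrt_coeff_bigo in simp, real_asymp)
  also have "(\<lambda>n. real n powr (-3/2) * real n powr (-1)) = (\<lambda>n. real n powr (-5/2))"
    by (simp only: powr_add[symmetric]) simp
  finally have *: "(\<lambda>n. sqrt_coeff n * (-3 / (2 * real n - 3))) \<in> O(\<lambda>n. real n powr (-5/2))" .
  have "\<forall>\<^sub>F n in at_top. sqrt_coeff n * (-3 / (2 * real n - 3)) = sqrt_coeff n - sqrt_coeff (n - 1)"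
    using eventually_gt_at_top[of 2]
  proof eventually_elim
    case (elim n)
    then obtain m where m: "n = Suc m" "m \<ge> 2" by (cases n) auto
    show ?case using m by (simp add: sqrt_coeff_def rsqrt_coeff_Suc divide_simps) (simp add: algebra_simps)
  qed
  from iffD1[OF landau_o.big.in_cong[OF this] *] show ?thesis .
qed

text \<open>Three derivatives turn s^5 into s^(-1), which grows like |1 - x|^(-1/2) at the boundary.
  Cauchy's estimate then bounds the coefficients of the third derivative by a multiple of sqrt n,
  and undoing the derivatives divides by about n^3. Starting from a lower odd power would leave a
  weaker error than n^(-5/2).\<close>

lemma fps_coeff_power5_bigo:
  assumes G: "G analytic_on lobe"
    and F: "(\<lambda>x. csqrt (1 - x) ^ 5 * G (csqrt (1 - x))) has_fps_expansion F"
  shows "(\<lambda>n. norm (fps_nth F n)) \<in> O(\<lambda>n. real n powr (-5/2))"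
proof -
  let ?s = "\<lambda>x. csqrt (1 - x)"
  obtain G1 where G1: "G1 analytic_on lobe"
    "\<And>x. norm x < 1 \<Longrightarrow> ((\<lambda>x. ?s x ^ Suc 4 * G (?s x)) has_field_derivative ?s x ^ 4 / ?s x * G1 (?s x)) (at x)"
    using analytic_lobe_power_deriv[OF G] by blast
  obtain G2 where G2: "G2 analytic_on lobe"
    "\<And>x. norm x < 1 \<Longrightarrow> ((\<lambda>x. ?s x ^ Suc 2 * G1 (?s x)) has_field_derivative ?s x ^ 2 / ?s x * G2 (?s x)) (at x)"
    using analytic_lobe_power_deriv[OF G1(1)] by blast
  obtain G3 where G3: "G3 analytic_on lobe"
    "\<And>x. norm x < 1 \<Longrightarrow> ((\<lambda>x. ?s x ^ Suc 0 * G2 (?s x)) has_field_derivative ?s x ^ 0 / ?s x * G3 (?s x)) (at x)"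
    using analytic_lobe_power_deriv[OF G2(1)] by blast
  define g0 where "g0 = (\<lambda>x. ?s x ^ 5 * G (?s x))"
  define g1 where "g1 = (\<lambda>x. ?s x ^ 3 * G1 (?s x))"
  define g2 where "g2 = (\<lambda>x. ?s x * G2 (?s x))"
  define g3 where "g3 = (\<lambda>x. G3 (?s x) / ?s x)"
  note near0 = eventually_norm_less[OF zero_less_one]
  have d0: "(g0 has_field_derivative g1 x) (at x)" if "norm x < 1" for x
  proof -
    have "?s x ^ 4 / ?s x = ?s x ^ 3" using csqrt_disc(2)[OF that] by (simp add: eval_nat_numeral)
    thus ?thesis using G1(2)[OF that] by (simp add: g0_def g1_def)
  qed
  have d1: "(g1 has_field_derivative g2 x) (at x)" if "norm x < 1" for x
  proof -
    have "?s x ^ 2 / ?s x = ?s x" using csqrt_disc(2)[OF that] by (simp add: power2_eq_square del: power2_csqrt)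
    thus ?thesis using G2(2)[OF that] by (simp add: g1_def g2_def del: power2_csqrt)
  qed
  have d2: "(g2 has_field_derivative g3 x) (at x)" if "norm x < 1" for x
    using G3(2)[OF that] by (simp add: g2_def g3_def)
  have F0: "g0 has_fps_expansion F" using F by (simp add: g0_def)
  have F1: "g1 has_fps_expansion fps_deriv F"
    by (rule iffD1[OF has_fps_expansion_cong has_fps_expansion_deriv[OF F0]])
      (use near0 in \<open>auto elim!: eventually_mono simp: DERIV_imp_deriv d0\<close>)
  have F2: "g2 has_fps_expansion fps_deriv (fps_deriv F)"
    by (rule iffD1[OF has_fps_expansion_cong has_fps_expansion_deriv[OF F1]])
      (use near0 in \<open>auto elim!: eventually_mono simp: DERIV_imp_deriv d1\<close>)
  have F3: "g3 has_fps_expansion fps_deriv (fps_deriv (fps_deriv F))"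
    by (rule iffD1[OF has_fps_expansion_cong has_fps_expansion_deriv[OF F2]])
      (use near0 in \<open>auto elim!: eventually_mono simp: DERIV_imp_deriv d2\<close>)
  have hol: "g3 holomorphic_on ball 0 1"
    unfolding g3_def using csqrt_disc
    by (intro holomorphic_intros analytic_lobe_comp_holomorphic G3) auto
  obtain B where B: "B > 0" "\<And>s. s \<in> lobe \<Longrightarrow> norm (G3 s) \<le> B"
    using analytic_lobe_bounded[OF G3(1)] by blast
  have est: "norm (fps_nth F (n + 3)) \<le> 8 * B * (sqrt (real n + 1) / real (n + 1) ^ 3)" for n
  proof -
    \<comment> \<open>On this circle |1 - x| >= 1/(n+2), so 1/|s| is at most sqrt (n+2), while
      r^(-n) remains below e.\<close>
    define r where "r = 1 - 1 / real (n + 2)"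
    have r: "0 < r" "r < 1" by (auto simp: r_def field_simps)
    have bound: "norm (g3 x) \<le> B * sqrt (real (n + 2))" if "norm (0 - x) = r" for x
    proof -
      have x: "norm x < 1" "norm x = r" using that r by auto
      have "1 / real (n + 2) = 1 - norm x" using x by (simp add: r_def)
      also have "\<dots> \<le> norm (1 - x)" using norm_triangle_ineq2[of 1 x] by simp
      finally have "1 / sqrt (real (n + 2)) \<le> norm (?s x)"
        by (simp add: norm_csqrt flip: real_sqrt_divide) (metis real_sqrt_divide real_sqrt_le_iff real_sqrt_one)
      hence "norm (G3 (?s x)) / norm (?s x) \<le> B / (1 / sqrt (real (n + 2)))"
        using B x csqrt_in_lobe by (intro frac_le) auto
      thus ?thesis by (simp add: g3_def norm_divide)
    qed
    have "norm ((deriv ^^ n) g3 0) \<le> fact n * (B * sqrt (real (n + 2))) / r ^ n"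
      using r bound hol by (intro Cauchy_inequality)
        (auto intro!: holomorphic_on_imp_continuous_on intro: holomorphic_on_subset)
    moreover have "fps_nth (fps_deriv (fps_deriv (fps_deriv F))) n = (deriv ^^ n) g3 0 / fact n"
      by (rule fps_nth_fps_expansion[OF F3])
    ultimately have "norm (fps_nth (fps_deriv (fps_deriv (fps_deriv F))) n) \<le> B * sqrt (real (n + 2)) / r ^ n"
      by (simp add: norm_divide pos_divide_le_eq mult.commute del: fps_deriv_nth)
    also have "fps_nth (fps_deriv (fps_deriv (fps_deriv F))) n =
        of_real (real (n + 1) * real (n + 2) * real (n + 3)) * fps_nth F (n + 3)"
      by (simp add: algebra_simps eval_nat_numeral)
    also have "norm \<dots> = (real (n + 1) * real (n + 2) * real (n + 3)) * norm (fps_nth F (n + 3))"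
      unfolding norm_mult norm_of_real by simp
    finally have 1: "(real (n + 1) * real (n + 2) * real (n + 3)) * norm (fps_nth F (n + 3)) \<le> B * sqrt (real (n + 2)) / r ^ n" .
    have "1 / r ^ n \<le> 4"
    proof -
      have "(1 + 1 / real (n + 1)) ^ n \<le> exp (1 / real (n + 1)) ^ n"
        using exp_ge_add_one_self[of "1 / real (n + 1)"] by (intro power_mono) auto
      also have "\<dots> = exp (real n * (1 / real (n + 1)))" by (rule exp_of_nat_mult[symmetric])
      also have "\<dots> \<le> exp 1" by (simp add: field_simps)
      also have "\<dots> \<le> 4" using exp_le by simp
      also have "1 + 1 / real (n + 1) = 1 / r" by (simp add: r_def field_simps)
      finally show ?thesis by (simp add: power_divide)
    qed
    hence 2: "B * sqrt (real (n + 2)) * (1 / r ^ n) \<le> B * sqrt (real (n + 2)) * 4"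
      using B by (intro mult_left_mono) auto
    have "real (n + 1) ^ 3 * norm (fps_nth F (n + 3)) \<le> (real (n + 1) * real (n + 2) * real (n + 3)) * norm (fps_nth F (n + 3))"
      unfolding power3_eq_cube by (intro mult_right_mono mult_mono) auto
    also have "\<dots> \<le> B * 4 * sqrt (real (n + 2))" using 1 2 by simp
    also have "sqrt (real (n + 2)) \<le> sqrt (4 * (real n + 1))" by (intro real_sqrt_le_mono) simp
    also have "\<dots> = 2 * sqrt (real n + 1)" by (simp add: real_sqrt_mult del: distrib_left_numeral mult_1_right)
    finally show ?thesis using B by (simp add: field_simps)
  qed
  have "(\<lambda>n. norm (fps_nth F (n + 3))) \<in> O(\<lambda>n. sqrt (real n + 1) / real (n + 1) ^ 3)"
  proof (intro bigoI[of _ "8 * B"] always_eventually allI)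
    fix n
    have "8 * B * (sqrt (real n + 1) / real (n + 1) ^ 3) \<le> 8 * B * norm (sqrt (real n + 1) / real (n + 1) ^ 3)"
      using B unfolding real_norm_def by (intro mult_left_mono abs_ge_self) simp
    with est[of n] show "norm (norm (fps_nth F (n + 3))) \<le> 8 * B * norm (sqrt (real n + 1) / real (n + 1) ^ 3)"
      unfolding real_norm_def abs_norm_cancel by (rule order_trans)
  qed
  also have "(\<lambda>n. sqrt (real n + 1) / real (n + 1) ^ 3) \<in> O(\<lambda>n. real (n + 3) powr (-5/2))"
    by real_asymp
  finally have *: "(\<lambda>n. norm (fps_nth F (n + 3))) \<in> O(\<lambda>n. real (n + 3) powr (-5/2))" .
  show ?thesis
  proof -
    obtain C where C: "C > 0" "\<forall>\<^sub>F n in at_top. norm (norm (fps_nth F (n + 3))) \<le> C * norm (real (n + 3) powr (-5/2))"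
      using * by (rule landau_o.bigE)
    have "\<forall>\<^sub>F n in at_top. norm (norm (fps_nth F n)) \<le> C * norm (real n powr (-5/2))"
      using C(2) by (rule iffD1[OF eventually_sequentially_seg])
    thus ?thesis by (intro bigoI)
  qed
qed

text \<open>In the expansion of \<open>H\<close> up to s^5 the even powers are polynomials in x and
  vanish from large coefficients, s^3 contributes O(n^(-5/2)), and so does the remainder. Only the
  linear term in s survives.\<close>

lemma sqrt_singularity_transfer:
  assumes H: "H analytic_on lobe" and f: "f has_fps_expansion F"
    and fH: "\<And>x. norm x < 1 \<Longrightarrow> f x = H (csqrt (1 - x))"
  shows "(\<lambda>n. norm (fps_nth F n - deriv H 0 * of_real (sqrt_coeff n))) \<in> O(\<lambda>n. real n powr (-5/2))"
proof -
  let ?s = "\<lambda>x. csqrt (1 - x)"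
  obtain H1 where H1: "H1 analytic_on lobe" "\<And>s. H s = H 0 + s * H1 s" "H1 0 = deriv H 0"
    using analytic_lobe_peel[OF H] by blast
  obtain H2 where H2: "H2 analytic_on lobe" "\<And>s. H1 s = H1 0 + s * H2 s"
    using analytic_lobe_peel[OF H1(1)] by blast
  obtain H3 where H3: "H3 analytic_on lobe" "\<And>s. H2 s = H2 0 + s * H3 s"
    using analytic_lobe_peel[OF H2(1)] by blast
  obtain H4 where H4: "H4 analytic_on lobe" "\<And>s. H3 s = H3 0 + s * H4 s"
    using analytic_lobe_peel[OF H3(1)] by blast
  obtain H5 where H5: "H5 analytic_on lobe" "\<And>s. H4 s = H4 0 + s * H5 s"
    using analytic_lobe_peel[OF H4(1)] by blast
  have exp: "H s = H 0 + H1 0 * s + H2 0 * s\<^sup>2 + H3 0 * (s\<^sup>2 * s) + H4 0 * (s\<^sup>2 * s\<^sup>2) + s ^ 5 * H5 s" for s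
    by (subst H1(2), subst H2(2), subst H3(2), subst H4(2), subst H5(2))
      (simp add: algebra_simps eval_nat_numeral)
  define S where "S = Abs_fps (\<lambda>n. complex_of_real (sqrt_coeff n))"
  define F' where "F' = F - fps_const (H 0) - fps_const (H1 0) * S - fps_const (H2 0) * (1 - fps_X)
      - fps_const (H3 0) * ((1 - fps_X) * S) - fps_const (H4 0) * ((1 - fps_X) * (1 - fps_X))"
  have "(\<lambda>x. f x - H 0 - H1 0 * ?s x - H2 0 * (1 - x) - H3 0 * ((1 - x) * ?s x) - H4 0 * ((1 - x) * (1 - x)))
      has_fps_expansion F'"
    unfolding F'_def S_def by (intro fps_expansion_intros f csqrt_fps_expansion)
  also have "?this \<longleftrightarrow> (\<lambda>x. ?s x ^ 5 * H5 (?s x)) has_fps_expansion F'"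
  proof (rule has_fps_expansion_cong)
    show "\<forall>\<^sub>F x in nhds 0. f x - H 0 - H1 0 * ?s x - H2 0 * (1 - x) - H3 0 * ((1 - x) * ?s x) - H4 0 * ((1 - x) * (1 - x))
        = ?s x ^ 5 * H5 (?s x)"
      using eventually_norm_less[OF zero_less_one]
    proof eventually_elim
      case (elim x)
      show ?case unfolding fH[OF elim] by (subst exp) simp
    qed
  qed simp
  finally have 1: "(\<lambda>n. norm (fps_nth F' n)) \<in> O(\<lambda>n. real n powr (-5/2))"
    by (rule fps_coeff_power5_bigo[OF H5(1)])
  have 2: "(\<lambda>n. norm (H3 0) * \<bar>sqrt_coeff n - sqrt_coeff (n - 1)\<bar>) \<in> O(\<lambda>n. real n powr (-5/2))"
    using sqrt_coeff_diff_bigo by simp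
  have "\<forall>\<^sub>F n in at_top. norm (fps_nth F n - deriv H 0 * of_real (sqrt_coeff n)) \<le>
      norm (norm (fps_nth F' n) + norm (H3 0) * \<bar>sqrt_coeff n - sqrt_coeff (n - 1)\<bar>)"
    \<comment> \<open>Beyond index 2 the polynomials 1, 1 - x and (1 - x)^2 have no coefficients
      left.\<close>
    using eventually_gt_at_top[of 2]
  proof eventually_elim
    case (elim n)
    hence "fps_nth F n - deriv H 0 * of_real (sqrt_coeff n) =
        fps_nth F' n + H3 0 * of_real (sqrt_coeff n - sqrt_coeff (n - 1))"
      by (cases n; cases "n - 1") (auto simp: F'_def S_def H1(3) algebra_simps fps_numeral_nth)
    also have "norm \<dots> \<le> norm (fps_nth F' n) + norm (H3 0) * \<bar>sqrt_coeff n - sqrt_coeff (n - 1)\<bar>"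
      by (rule order_trans[OF norm_triangle_ineq]) (simp only: norm_mult norm_of_real order_refl)
    finally show ?case by simp
  qed
  thus ?thesis
    by (intro landau_o.big_trans[OF landau_o.big_mono sum_in_bigo(1)[OF 1 2]]) simp
qed

subsection \<open>Powers of a centred step polynomial\<close>

text \<open>This is [u^j] P(u)^n, the total weight of unconstrained walks of n steps from 0 to
  j.\<close>

fun step_count :: "int \<Rightarrow> int \<Rightarrow> (int \<Rightarrow> real) \<Rightarrow> nat \<Rightarrow> int \<Rightarrow> real" where
  "step_count c d a 0 j = (if j = 0 then 1 else 0)"
| "step_count c d a (Suc n) j = (\<Sum>i\<in>{-c..d}. a i * step_count c d a n (j - i))"

text \<open>The jump law after normalisation: the step polynomial has its saddle point at u = 1 with
  value 1. The assumption \<open>aper\<close> is the analytic form of aperiodicity, namely that u =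
  1 is the only point of the unit circle where |P| reaches its maximum 1.\<close>

locale centred_walk =
  fixes c d :: int and a :: "int \<Rightarrow> real"
  assumes c_ge: "1 \<le> c" and d_ge: "1 \<le> d"
    and a_nonneg: "0 \<le> a i"
    and a_left: "0 < a (-c)"
    and a_sum: "(\<Sum>i\<in>{-c..d}. a i) = 1"
    and a_mean: "(\<Sum>i\<in>{-c..d}. a i * of_int i) = 0"
    and aper: "norm v = 1 \<Longrightarrow> norm (\<Sum>i\<in>{-c..d}. complex_of_real (a i) * v powi i) = 1 \<Longrightarrow> v = 1"
begin

definition P :: "complex \<Rightarrow> complex" where
  "P u = (\<Sum>i\<in>{-c..d}. of_real (a i) * u powi i)"

definition dP :: "complex \<Rightarrow> complex" where
  "dP u = (\<Sum>i\<in>{-c..d}. of_real (a i) * (of_int i * u powi (i - 1)))"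

definition ddP :: "complex \<Rightarrow> complex" where
  "ddP u = (\<Sum>i\<in>{-c..d}. of_real (a i) * (of_int i * (of_int (i - 1) * u powi (i - 2))))"

definition sigma2 :: real where
  "sigma2 = (\<Sum>i\<in>{-c..d}. a i * (of_int i * of_int (i - 1)))"

text \<open>As the mean is zero, \<open>sigma2\<close> is both P''(1) and the variance. Near u = 1
  the equation 1 - 1/P(u) = s^2 reads (sigma2/2) (u - 1)^2 ~ s^2, so \<open>kappa\<close> is the
  slope of u as a function of s.\<close>

definition kappa :: real where
  "kappa = sqrt (2 / sigma2)"

lemma DERIV_P: "u \<noteq> 0 \<Longrightarrow> (P has_field_derivative dP u) (at u)"
  unfolding P_def dP_def
  by (rule DERIV_sum) (auto intro!: derivative_eq_intros)

lemma DERIV_dP: "u \<noteq> 0 \<Longrightarrow> (dP has_field_derivative ddP u) (at u)"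
  unfolding dP_def ddP_def
  by (rule DERIV_sum) (auto intro!: derivative_eq_intros)

lemma P_holomorphic: "P holomorphic_on -{0}"
proof (rule iffD2[OF holomorphic_on_open])
  show "\<forall>x\<in>-{0}. \<exists>f'. (P has_field_derivative f') (at x)" using DERIV_P by blast
qed auto

lemma P_continuous: "0 \<notin> S \<Longrightarrow> continuous_on S P"
  using P_holomorphic by (intro holomorphic_on_imp_continuous_on) (auto elim!: holomorphic_on_subset)

lemma P_1 [simp]: "P 1 = 1"
proof -
  have "P 1 = of_real (\<Sum>i\<in>{-c..d}. a i)" unfolding P_def of_real_sum by simp
  thus ?thesis by (simp add: a_sum)
qed

lemma dP_1 [simp]: "dP 1 = 0"
proof -
  have "dP 1 = of_real (\<Sum>i\<in>{-c..d}. a i * of_int i)" unfolding dP_def of_real_sum by simp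
  thus ?thesis by (simp add: a_mean)
qed

lemma ddP_1: "ddP 1 = of_real sigma2"
  unfolding ddP_def sigma2_def of_real_sum by simp

lemma sigma2_pos: "sigma2 > 0"
  unfolding sigma2_def
proof (rule sum_pos2[of _ "-c"])
  have "(real_of_int c) * (real_of_int c + 1) > 0" using c_ge by simp
  moreover have "real_of_int (- c) * real_of_int (- c - 1) = (real_of_int c) * (real_of_int c + 1)"
    by (simp add: algebra_simps)
  ultimately show "0 < a (- c) * (real_of_int (- c) * real_of_int (- c - 1))"
    using a_left by (metis mult_pos_pos)
  fix i
  have "(0::int) \<le> i * (i - 1)" by (cases "i \<le> 0") (auto intro: mult_nonpos_nonpos)
  hence "0 \<le> real_of_int (i * (i - 1))" by (simp only: of_int_0_le_iff)
  thus "0 \<le> a i * (real_of_int i * real_of_int (i - 1))" using a_nonneg by simp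
qed (use c_ge d_ge in auto)

lemma kappa_pos: "kappa > 0"
  using sigma2_pos by (simp add: kappa_def)

lemma norm_P_le:
  assumes "norm u = 1"
  shows "norm (P u) \<le> 1"
proof -
  have "norm (P u) \<le> (\<Sum>i\<in>{-c..d}. norm (of_real (a i) * u powi i))"
    unfolding P_def by (rule norm_sum)
  also have "\<dots> = (\<Sum>i\<in>{-c..d}. a i)"
    using assms a_nonneg by (simp add: norm_mult norm_power_int)
  finally show ?thesis by (simp add: a_sum)
qed

lemma kernel_nonzero:
  assumes "norm x \<le> 1" "x \<noteq> 1" "norm u = 1"
  shows "1 - x * P u \<noteq> 0"
proof
  assume "1 - x * P u = 0"
  hence eq: "x * P u = 1" by simp
  hence "norm x * norm (P u) = 1" by (metis norm_mult norm_one)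
  moreover have "norm x * norm (P u) \<le> 1 * norm (P u)" using assms by (intro mult_right_mono) auto
  ultimately have "norm (P u) = 1" using norm_P_le[OF assms(3)] by simp
  hence "u = 1" using aper[OF assms(3)] by (simp add: P_def)
  thus False using eq assms by simp
qed

lemma P_neq_1:
  assumes "norm u = 1" "u \<noteq> 1"
  shows "P u \<noteq> 1"
  using aper[OF assms(1)] assms(2) by (auto simp: P_def)

text \<open>The function 1 - 1/P has a double zero at 1, hence is the square of a local coordinate
  \<open>\<phi>\<close> with inverse \<open>\<psi>\<close>. With x = 1 - s^2 the kernel 1 - x P(u)
  vanishes exactly when \<open>\<phi>\<close> u is s or -s, so the two roots meeting at 1 are
  \<open>\<psi>\<close> s and \<open>\<psi>\<close> (-s), analytic in s.\<close>

lemma local_parameter: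
  obtains \<phi> \<psi> r e where "r > 0" "e > 0" "\<And>u. u \<in> ball 1 r \<Longrightarrow> u \<noteq> 0 \<and> P u \<noteq> 0"
    "\<phi> holomorphic_on ball 1 r" "inj_on \<phi> (ball 1 r)" "\<phi> 1 = 0"
    "\<And>u. u \<in> ball 1 r \<Longrightarrow> 1 - 1 / P u = (\<phi> u)\<^sup>2"
    "\<psi> holomorphic_on ball 0 e" "\<And>s. s \<in> ball 0 e \<Longrightarrow> \<psi> s \<in> ball 1 r \<and> \<phi> (\<psi> s) = s"
    "\<psi> 0 = 1" "deriv \<psi> 0 = of_real kappa"
proof -
  define T where "T = (\<lambda>u. 1 - 1 / P u)"
  have "open (-{0} \<inter> P -` (-{0}))"
    using P_holomorphic by (intro continuous_open_preimage holomorphic_on_imp_continuous_on) (auto simp: open_delete)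
  then obtain r0 where r0: "r0 > 0" "ball 1 r0 \<subseteq> -{0} \<inter> P -` (-{0})"
    using openE[of "-{0} \<inter> P -` (-{0})" 1] by auto
  have nz: "u \<noteq> 0" "P u \<noteq> 0" if "u \<in> ball 1 r0" for u using that r0 by auto
  have dT: "(T has_field_derivative dP u / (P u)\<^sup>2) (at u)" if "u \<in> ball 1 r0" for u
    unfolding T_def using nz[OF that]
    by (auto intro!: derivative_eq_intros DERIV_P simp: power2_eq_square)
  have holT: "T holomorphic_on ball 1 r0"
    using dT by (subst holomorphic_on_open) (blast intro: open_ball)+
  have derivT: "deriv T u = dP u / (P u)\<^sup>2" if "u \<in> ball 1 r0" for u
    using dT[OF that] by (rule DERIV_imp_deriv)
  have one: "1 \<in> ball (1::complex) r0" using r0 by simp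
  have "((\<lambda>u. dP u / (P u)\<^sup>2) has_field_derivative of_real sigma2) (at 1)"
    by (auto intro!: derivative_eq_intros DERIV_P DERIV_dP simp: ddP_1)
  hence "(deriv T has_field_derivative of_real sigma2) (at 1)"
    by (rule has_field_derivative_transform_within_open[OF _ open_ball one]) (simp add: derivT)
  hence ddT: "deriv (deriv T) 1 = of_real sigma2" by (rule DERIV_imp_deriv)
  have D2: "(deriv ^^ 2) T 1 \<noteq> 0" using ddT sigma2_pos by (simp add: numeral_2_eq_2)
  have D1: "(deriv ^^ i) T 1 = 0" if "0 < i" "i < 2" for i
  proof -
    have "i = 1" using that by simp
    thus ?thesis using derivT[OF one] by simp
  qed
  obtain r1 g where g: "0 < r1" "g holomorphic_on ball 1 r1"
      "\<And>w. w \<in> ball 1 r1 \<Longrightarrow> T w - T 1 = ((w - 1) * g w) ^ 2" "\<And>w. w \<in> ball 1 r1 \<Longrightarrow> g w \<noteq> 0"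
  proof (rule holomorphic_factor_order_of_zero_strong[OF holT open_ball one pos2 D2 D1])
    fix g r
    assume "0 < r" "g holomorphic_on ball 1 r" "\<And>w. w \<in> ball 1 r \<Longrightarrow> T w - T 1 = ((w - 1) * g w) ^ 2"
      "\<And>w. w \<in> ball 1 r \<Longrightarrow> g w \<noteq> 0"
    thus thesis by (rule that)
  qed auto
  define r2 where "r2 = min r0 r1"
  have r2: "r2 > 0" using r0 g by (simp add: r2_def)
  define f where "f = (\<lambda>w. (w - 1) * g w)"
  have holf: "f holomorphic_on ball 1 r2"
    unfolding f_def using g(2) by (auto intro!: holomorphic_intros elim!: holomorphic_on_subset simp: r2_def)
  have Tf: "T w = (f w)\<^sup>2" if "w \<in> ball 1 r2" for w
    using g(3)[of w] that by (simp add: f_def r2_def T_def)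
  have one2: "1 \<in> ball (1::complex) r2" using r2 by simp
  have f1: "f 1 = 0" by (simp add: f_def)
  have df: "(f has_field_derivative deriv f w) (at w)" if "w \<in> ball 1 r2" for w
    using holomorphic_derivI[OF holf open_ball that] .
  have derivT': "deriv T w = 2 * f w * deriv f w" if w: "w \<in> ball 1 r2" for w
  proof -
    have "((\<lambda>w. (f w)\<^sup>2) has_field_derivative 2 * f w * deriv f w) (at w)"
      by (auto intro!: derivative_eq_intros df[OF w])
    from has_field_derivative_transform_within_open[OF this open_ball w] Tf
    show ?thesis by (intro DERIV_imp_deriv) auto
  qed
  have holdf: "deriv f holomorphic_on ball 1 r2" using holf by (intro holomorphic_deriv) auto
  have "((\<lambda>w. 2 * f w * deriv f w) has_field_derivative 2 * deriv f 1 * deriv f 1) (at 1)"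
    by (rule derivative_eq_intros df[OF one2] holomorphic_derivI[OF holdf open_ball one2] refl)+ (simp add: f1)
  hence "deriv (deriv T) 1 = 2 * deriv f 1 * deriv f 1"
    by (intro DERIV_imp_deriv, elim has_field_derivative_transform_within_open[OF _ open_ball one2])
      (simp add: derivT')
  hence "(deriv f 1)\<^sup>2 = of_real (sigma2 / 2)" by (simp add: ddT power2_eq_square)
  also have "\<dots> = (of_real (sqrt (sigma2 / 2)))\<^sup>2"
    using sigma2_pos by (simp flip: of_real_power)
  finally have sgn: "deriv f 1 = of_real (sqrt (sigma2 / 2)) \<or> deriv f 1 = - of_real (sqrt (sigma2 / 2))"
    by (simp add: power2_eq_iff)
  \<comment> \<open>The square root is determined up to sign. This choice makes the derivative at 1
    positive, so that for s in the right half-plane near 0 the root \<open>\<psi>\<close> s is the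
    one that moves outwards.\<close>
  define \<epsilon> :: complex where "\<epsilon> = (if deriv f 1 = of_real (sqrt (sigma2 / 2)) then 1 else -1)"
  have \<epsilon>2: "\<epsilon>\<^sup>2 = 1" by (simp add: \<epsilon>_def)
  define \<phi> where "\<phi> = (\<lambda>w. \<epsilon> * f w)"
  have hol\<phi>: "\<phi> holomorphic_on ball 1 r2" unfolding \<phi>_def by (intro holomorphic_intros holf)
  have "(\<phi> has_field_derivative \<epsilon> * deriv f 1) (at 1)"
    unfolding \<phi>_def by (rule DERIV_cmult[OF df[OF one2]])
  moreover have "\<epsilon> * deriv f 1 = of_real (sqrt (sigma2 / 2))" using sgn by (auto simp: \<epsilon>_def)
  ultimately have d\<phi>: "deriv \<phi> 1 = of_real (sqrt (sigma2 / 2))" using DERIV_imp_deriv by metis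
  hence d\<phi>nz: "deriv \<phi> 1 \<noteq> 0" using sigma2_pos by simp
  obtain r where r: "r > 0" "ball (1::complex) r \<subseteq> ball 1 r2" "inj_on \<phi> (ball 1 r)"
    by (rule has_complex_derivative_locally_injective[OF hol\<phi> one2 open_ball d\<phi>nz]) (rule that)
  have hol\<phi>': "\<phi> holomorphic_on ball 1 r" using hol\<phi> r(2) by (rule holomorphic_on_subset)
  obtain \<psi> where \<psi>: "\<psi> holomorphic_on (\<phi> ` ball 1 r)"
      "\<And>z. z \<in> ball 1 r \<Longrightarrow> deriv \<phi> z * deriv \<psi> (\<phi> z) = 1" "\<And>z. z \<in> ball 1 r \<Longrightarrow> \<psi> (\<phi> z) = z"
    by (rule holomorphic_has_inverse[OF hol\<phi>' open_ball r(3)]) (rule that)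
  have "open (\<phi> ` ball 1 r)" using hol\<phi>' r by (intro open_mapping_thm3) auto
  moreover have \<phi>1: "\<phi> 1 = 0" by (simp add: \<phi>_def f1)
  hence "0 \<in> \<phi> ` ball 1 r" using r by (metis centre_in_ball imageI)
  ultimately obtain e where e: "e > 0" "ball 0 e \<subseteq> \<phi> ` ball 1 r"
    using openE by blast
  show ?thesis
  proof (rule that[of r e \<phi> \<psi>])
    show "u \<noteq> 0 \<and> P u \<noteq> 0" if "u \<in> ball 1 r" for u
      using subsetD[OF r(2) that] nz[of u] by (auto simp: r2_def)
    show "1 - 1 / P u = (\<phi> u)\<^sup>2" if "u \<in> ball 1 r" for u
      using Tf[OF subsetD[OF r(2) that]] \<epsilon>2 by (auto simp: T_def \<phi>_def power_mult_distrib)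
    show "\<psi> holomorphic_on ball 0 e" using \<psi>(1) e(2) by (rule holomorphic_on_subset)
    show "\<psi> s \<in> ball 1 r \<and> \<phi> (\<psi> s) = s" if s: "s \<in> ball 0 e" for s
    proof -
      obtain u where "u \<in> ball 1 r" "s = \<phi> u" using subsetD[OF e(2) s] by (rule imageE)
      thus ?thesis using \<psi>(3) by simp
    qed
    show "\<psi> 0 = 1" using \<psi>(3)[of 1] r \<phi>1 by simp
    have "of_real (sqrt (sigma2 / 2)) * deriv \<psi> 0 = 1" using \<psi>(2)[of 1] r \<phi>1 d\<phi> by simp
    moreover have "sqrt (sigma2 / 2) * kappa = 1"
      using sigma2_pos by (simp add: kappa_def flip: real_sqrt_mult)
    hence "complex_of_real (sqrt (sigma2 / 2)) * of_real kappa = 1" by (metis of_real_1 of_real_mult)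
    ultimately show "deriv \<psi> 0 = of_real kappa"
      by (metis mult_cancel_left mult_zero_left zero_neq_one)
  qed (use r e hol\<phi>' \<phi>1 in auto)
qed

text \<open>Here \<open>\<psi>\<close> (+-s) = 1 +- kappa s + O(s^2), and in the cone Re s >= |s|/3,
  so the linear term outweighs the quadratic ones. The aperture 2 exceeds the aperture 1 of
  \<open>lobe_cone\<close>, so that the interior of the cone is a neighbourhood of each nonzero
  point of \<open>lobe\<close>.\<close>

lemma moduli_in_cone:
  assumes hol: "\<psi> holomorphic_on ball 0 e" and e: "e > 0" and "\<psi> 0 = 1" and "deriv \<psi> 0 = of_real kappa"
  obtains e' where "e' > 0"
    "\<And>s. s \<noteq> 0 \<Longrightarrow> norm s < e' \<Longrightarrow> \<bar>Im s\<bar> \<le> 2 * Re s \<Longrightarrow> norm (\<psi> s) > 1 \<and> norm (\<psi> (-s)) < 1"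
proof -
  define h1 where "h1 = (\<lambda>s. if s = 0 then deriv \<psi> 0 else (\<psi> s - \<psi> 0) / (s - 0))"
  have h1: "h1 holomorphic_on ball 0 e"
    unfolding h1_def using hol e by (intro pole_lemma) auto
  define h where "h = (\<lambda>s. if s = 0 then deriv h1 0 else (h1 s - h1 0) / (s - 0))"
  have h: "h holomorphic_on ball 0 e"
    unfolding h_def using h1 e by (intro pole_lemma) auto
  have expand: "\<psi> s = 1 + of_real kappa * s + s\<^sup>2 * h s" for s
    using assms by (auto simp: h_def h1_def power2_eq_square field_simps)
  have "compact (h ` cball 0 (e/2))"
    using h e by (intro compact_continuous_image holomorphic_on_imp_continuous_on)
      (auto elim!: holomorphic_on_subset)
  then obtain B where B: "B > 0" "\<And>s. s \<in> cball 0 (e/2) \<Longrightarrow> norm (h s) \<le> B"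
    using bounded_pos[of "h ` cball 0 (e/2)"] compact_imp_bounded by auto
  \<comment> \<open>The second bound ensures (kappa^2 + B) |s| < kappa/3: kappa^2 comes from |1 -
    kappa s|^2, \<open>B\<close> from the Taylor remainder, and kappa/3 from Re s >= |s|/3.\<close>
  define e' where "e' = min (e/2) (kappa / (3 * (kappa\<^sup>2 + B)))"
  have "e' > 0" using e B kappa_pos by (simp add: e'_def add_pos_pos)
  moreover have "norm (\<psi> s) > 1 \<and> norm (\<psi> (-s)) < 1"
    if s: "s \<noteq> 0" "norm s < e'" "\<bar>Im s\<bar> \<le> 2 * Re s" for s
  proof -
    have n0: "norm s > 0" using s by simp
    have Re: "norm s \<le> 3 * Re s" using cmod_le[of s] s(3) by linarith
    have "norm s * (3 * (kappa\<^sup>2 + B)) < kappa"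
      using s(2) B kappa_pos by (simp add: e'_def pos_less_divide_eq add_pos_pos)
    hence sm: "(kappa\<^sup>2 + B) * norm s < kappa / 3" by (simp add: algebra_simps)
    have hs: "norm (s\<^sup>2 * h s) \<le> (norm s)\<^sup>2 * B" "norm ((-s)\<^sup>2 * h (-s)) \<le> (norm s)\<^sup>2 * B"
      using B(2)[of s] B(2)[of "-s"] s(2) by (auto simp: norm_mult norm_power e'_def intro!: mult_left_mono)
    have "(kappa\<^sup>2 + B) * norm s * norm s < kappa / 3 * norm s"
      using sm n0 by (intro mult_strict_right_mono) auto
    hence sm2: "kappa\<^sup>2 * (norm s)\<^sup>2 + (norm s)\<^sup>2 * B < kappa * norm s / 3"
      by (simp add: algebra_simps power2_eq_square)
    have Rek: "kappa * norm s / 3 \<le> kappa * Re s" using Re kappa_pos by simp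
    have "1 + kappa * Re s \<le> norm (1 + of_real kappa * s)"
      using complex_Re_le_cmod[of "1 + of_real kappa * s"] by simp
    also have "\<dots> \<le> norm (\<psi> s) + norm (s\<^sup>2 * h s)"
      using norm_triangle_ineq4[of "\<psi> s" "s\<^sup>2 * h s"] by (simp add: expand)
    finally have g1: "norm (\<psi> s) > 1" using hs(1) sm2 Rek by (smt (verit) zero_le_power2 mult_nonneg_nonneg)
    have "(norm (1 - of_real kappa * s))\<^sup>2 = (1 - kappa * Re s)\<^sup>2 + (kappa * Im s)\<^sup>2"
      by (simp add: cmod_power2)
    also have "\<dots> = 1 - 2 * (kappa * Re s) + kappa\<^sup>2 * ((Re s)\<^sup>2 + (Im s)\<^sup>2)"
      by (simp add: power2_eq_square algebra_simps)
    also have "(Re s)\<^sup>2 + (Im s)\<^sup>2 = (norm s)\<^sup>2" by (simp add: cmod_power2)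
    finally have n2: "(norm (1 - of_real kappa * s))\<^sup>2 = 1 - 2 * (kappa * Re s) + kappa\<^sup>2 * (norm s)\<^sup>2" .
    have "2 * norm (1 - of_real kappa * s) \<le> 1 + (norm (1 - of_real kappa * s))\<^sup>2"
      using sum_squares_bound[of 1 "norm (1 - of_real kappa * s)"] by simp
    hence n3: "norm (1 - of_real kappa * s) \<le> 1 - kappa * Re s + kappa\<^sup>2 * (norm s)\<^sup>2 / 2"
      using n2 by simp
    have "norm (\<psi> (-s)) \<le> norm (1 - of_real kappa * s) + norm ((-s)\<^sup>2 * h (-s))"
      using norm_triangle_ineq[of "1 - of_real kappa * s" "(-s)\<^sup>2 * h (-s)"] expand[of "-s"] by simp
    also have "\<dots> < 1"
      using n3 hs(2) sm2 Rek zero_le_power2[of "kappa * norm s"] unfolding power_mult_distrib by linarith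
    finally show ?thesis using g1 by simp
  qed
  ultimately show ?thesis using that by blast
qed

end

section \<open>Continuation of the series of [u^j] P^l across the unit circle\<close>

context centred_walk
begin

text \<open>The geometric sum of x^l P(u)^(l+1) u^(-j-1) over l >= 0. The exponent l + 1 goes with
  x^l because Spitzer's equation sums over l >= 1 and is divided by x.\<close>

definition kern :: "int \<Rightarrow> complex \<Rightarrow> complex \<Rightarrow> complex" where
  "kern j x u = P u * u powi (-j - 1) / (1 - x * P u)"

lemma kern_integral_holomorphic:
  assumes r: "r > 0" and nz: "\<And>x u. x \<in> ball x0 e \<Longrightarrow> norm u = r \<Longrightarrow> 1 - x * P u \<noteq> 0"
  shows "(\<lambda>x. contour_integral (circlepath 0 r) (kern j x)) holomorphic_on ball x0 e"
proof -
  let ?\<gamma> = "circlepath 0 r"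
  have n\<gamma>: "norm (?\<gamma> t) = r" for t using r by (simp add: circlepath norm_mult)
  hence \<gamma>0: "?\<gamma> t \<noteq> 0" for t using r by (metis norm_zero less_irrefl)
  define p where "p = (\<lambda>t. P (?\<gamma> t))"
  define g where "g = (\<lambda>t. p t * ?\<gamma> t powi (-j - 1) * (2 * pi * \<i> * r * exp (2 * of_real pi * \<i> * t)))"
  have c\<gamma>: "continuous_on {0..1} ?\<gamma>" unfolding circlepath by (intro continuous_intros)
  have cp: "continuous_on {0..1} p"
    unfolding p_def using \<gamma>0 by (intro continuous_on_compose2[OF P_continuous c\<gamma>, of "-{0}"]) auto
  have cg: "continuous_on {0..1} g"
    unfolding g_def using \<gamma>0 by (intro continuous_intros cp c\<gamma>) auto
  have nz': "1 - x * p t \<noteq> 0" if "x \<in> ball x0 e" for x t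
    using nz[OF that n\<gamma>] by (simp add: p_def)
  have eq: "contour_integral ?\<gamma> (kern j x) = integral (cbox 0 1) (\<lambda>t. g t / (1 - x * p t))" for x
    unfolding contour_integral_integral cbox_interval
    by (intro arg_cong2[where f = integral] refl ext)
      (simp add: kern_def g_def p_def vector_derivative_circlepath)
  have cp2: "continuous_on (ball x0 e \<times> cbox 0 1) (\<lambda>z. p (snd z))"
    by (intro continuous_on_compose2[OF cp] continuous_intros) auto
  have cg2: "continuous_on (ball x0 e \<times> cbox 0 1) (\<lambda>z. g (snd z))"
    by (intro continuous_on_compose2[OF cg] continuous_intros) auto
  show ?thesis unfolding eq
  proof (rule leibniz_rule_holomorphic[where fx = "\<lambda>x t. g t * p t / (1 - x * p t)\<^sup>2"])
    fix x t assume "x \<in> ball x0 e"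
    thus "((\<lambda>x. g t / (1 - x * p t)) has_field_derivative g t * p t / (1 - x * p t)\<^sup>2) (at x within ball x0 e)"
      using nz' by (auto intro!: derivative_eq_intros simp: power2_eq_square)
  next
    fix x assume "x \<in> ball x0 e"
    thus "(\<lambda>t. g t / (1 - x * p t)) integrable_on cbox 0 1"
      using nz' cg cp by (intro integrable_continuous continuous_intros) auto
  next
    show "continuous_on (ball x0 e \<times> cbox 0 1) (\<lambda>(x, t). g t * p t / (1 - x * p t)\<^sup>2)"
      unfolding split_beta using nz' cp2 cg2
      by (intro continuous_intros) auto
  qed auto
qed

lemma P_power_integral:
  "((\<lambda>u. P u ^ n * u powi (-j - 1)) has_contour_integral 2 * pi * \<i> * step_count c d a n j) (circlepath 0 1)"
proof (induction n arbitrary: j)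
  case 0
  show ?case
  proof (cases "j = 0")
    case True
    have "((\<lambda>u. 1 / (u - 0)) has_contour_integral 2 * of_real pi * \<i>) (circlepath 0 1)"
      using Cauchy_integral_circlepath_simple[of "\<lambda>_. 1" 0 1 0] by simp
    thus ?thesis using True by (simp add: power_int_minus divide_inverse)
  next
    case False
    have "((\<lambda>u. u powi (-j - 1)) has_contour_integral 0) (circlepath 0 1)"
    proof (rule Cauchy_theorem_primitive[where S = "-{0}"])
      fix u :: complex assume "u \<in> -{0}"
      thus "((\<lambda>u. u powi (-j) / of_int (-j)) has_field_derivative u powi (-j - 1)) (at u within -{0})"
        using False by (auto intro!: derivative_eq_intros)
    qed auto
    thus ?thesis using False by simp
  qed
next
  case (Suc n)
  have "((\<lambda>u. \<Sum>i\<in>{-c..d}. of_real (a i) * (P u ^ n * u powi (-(j - i) - 1))) has_contour_integral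
      (\<Sum>i\<in>{-c..d}. of_real (a i) * (2 * pi * \<i> * step_count c d a n (j - i)))) (circlepath 0 1)"
    by (intro has_contour_integral_sum has_contour_integral_lmul Suc) auto
  also have "(\<Sum>i\<in>{-c..d}. of_real (a i) * (2 * pi * \<i> * step_count c d a n (j - i))) =
      2 * pi * \<i> * step_count c d a (Suc n) j"
    by (simp add: sum_distrib_left algebra_simps)
  finally show ?case
  proof (rule has_contour_integral_eq)
    fix u assume "u \<in> path_image (circlepath 0 1)"
    hence u: "u \<noteq> 0" by auto
    have "u powi (-(j - i) - 1) = u powi i * u powi (-j - 1)" for i
      using u by (simp add: algebra_simps flip: power_int_add)
    thus "(\<Sum>i\<in>{-c..d}. of_real (a i) * (P u ^ n * u powi (-(j - i) - 1))) = P u ^ Suc n * u powi (-j - 1)"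
      by (simp add: P_def sum_distrib_left sum_distrib_right algebra_simps)
  qed
qed

lemma step_count_series:
  assumes x: "norm x < 1"
  shows "(\<lambda>l. of_real (step_count c d a (Suc l) j) * x ^ l) sums
           (contour_integral (circlepath 0 1) (kern j x) / (2 * pi * \<i>))"
proof -
  define f where "f = (\<lambda>l u. x ^ l * (P u ^ Suc l * u powi (-j - 1)))"
  have fi: "(f l has_contour_integral x ^ l * (2 * pi * \<i> * step_count c d a (Suc l) j)) (circlepath 0 1)" for l
    unfolding f_def by (intro has_contour_integral_lmul P_power_integral)
  have bound: "norm (f l u) \<le> norm x ^ l" if "u \<in> sphere 0 1" for l u
  proof -
    have "norm (P u) ^ Suc l \<le> 1" using that by (intro power_le_one norm_P_le) auto
    hence "norm x ^ l * norm (P u) ^ Suc l \<le> norm x ^ l * 1" by (intro mult_left_mono) auto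
    thus ?thesis using that by (simp add: f_def norm_mult norm_power norm_power_int)
  qed
  have "uniform_limit (sphere 0 1) (\<lambda>n u. \<Sum>l<n. f l u) (\<lambda>u. suminf (\<lambda>l. f l u)) sequentially"
    using bound x by (intro Weierstrass_m_test) auto
  moreover have "suminf (\<lambda>l. f l u) = kern j x u" if "u \<in> sphere 0 1" for u
  proof -
    have "norm (x * P u) < 1"
      using mult_left_le[OF norm_P_le[of u], of "norm x"] that x by (simp add: norm_mult)
    hence "(\<lambda>l. (x * P u) ^ l * (P u * u powi (-j - 1))) sums (1 / (1 - x * P u) * (P u * u powi (-j - 1)))"
      by (intro sums_mult2 geometric_sums)
    also have "(\<lambda>l. (x * P u) ^ l * (P u * u powi (-j - 1))) = (\<lambda>l. f l u)"
      by (simp add: f_def power_mult_distrib fun_eq_iff mult_ac)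
    finally show ?thesis by (simp add: sums_iff kern_def)
  qed
  ultimately have ul: "uniform_limit (sphere 0 1) (\<lambda>n u. \<Sum>l<n. f l u) (kern j x) sequentially"
    by (metis (mono_tags, lifting) uniform_limit_cong')
  have si: "((\<lambda>u. \<Sum>l<n. f l u) has_contour_integral (\<Sum>l<n. x ^ l * (2 * pi * \<i> * step_count c d a (Suc l) j))) (circlepath 0 1)" for n
    by (intro has_contour_integral_sum fi) auto
  have ci: "(\<lambda>u. \<Sum>l<n. f l u) contour_integrable_on circlepath 0 1" for n
    using si by (rule has_contour_integral_integrable)
  have "(\<lambda>n. contour_integral (circlepath 0 1) (\<lambda>u. \<Sum>l<n. f l u)) \<longlonglongrightarrow> contour_integral (circlepath 0 1) (kern j x)"
    by (rule contour_integral_uniform_limit_circlepath(2)[OF always_eventually[OF allI[OF ci]] ul]) simp_all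
  hence "(\<lambda>l. x ^ l * (2 * pi * \<i> * step_count c d a (Suc l) j)) sums contour_integral (circlepath 0 1) (kern j x)"
    unfolding sums_def contour_integral_unique[OF si] .
  from sums_divide[OF this, of "2 * pi * \<i>"] show ?thesis by (simp add: mult_ac)
qed

text \<open>At x = 1 the solutions of P(u) = 1 with 1 <= |u| <= 2 outside the ball form a compact
  set that misses the unit circle, so they have a least modulus above 1, and \<open>R\<close> is
  taken halfway towards it. On the resulting compact set |1 - P| is bounded below, which allows x to
  vary near 1.\<close>

lemma annulus_zeros:
  assumes r: "r > 0" and near: "\<And>u. u \<in> ball 1 r \<Longrightarrow> u \<noteq> 1 \<Longrightarrow> P u \<noteq> 1"
  obtains R e where "R > 1" "e > 0"
    "\<And>x u. x \<in> ball 1 e \<Longrightarrow> norm u = R \<Longrightarrow> 1 - x * P u \<noteq> 0"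
    "\<And>x u. x \<in> ball 1 e \<Longrightarrow> 1 \<le> norm u \<Longrightarrow> norm u \<le> R \<Longrightarrow> 1 - x * P u = 0 \<Longrightarrow> u \<in> ball 1 r"
proof -
  define Z where "Z = {u \<in> cball 0 2 - ball 0 1 - ball 1 r. P u = 1}"
  have comp: "compact (cball 0 \<rho> - ball 0 1 - ball (1::complex) r)" for \<rho> :: real
    by (intro compact_diff) auto
  obtain R where R: "R > 1" "\<And>u. 1 \<le> norm u \<Longrightarrow> norm u \<le> R \<Longrightarrow> u \<notin> ball 1 r \<Longrightarrow> P u \<noteq> 1"
  proof (cases "Z = {}")
    case True
    show ?thesis by (rule that[of 2]) (use True in \<open>auto simp: Z_def\<close>)
  next
    case False
    have "closed ((cball 0 2 - ball 0 1 - ball 1 r) \<inter> P -` {1})"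
      by (intro continuous_closed_preimage P_continuous compact_imp_closed comp) auto
    moreover have "(cball 0 2 - ball 0 1 - ball 1 r) \<inter> P -` {1} = Z" by (auto simp: Z_def)
    moreover have "bounded Z" by (rule bounded_subset[OF bounded_cball[of 0 2]]) (auto simp: Z_def)
    ultimately have "compact Z" by (simp add: compact_eq_bounded_closed)
    then obtain z where z: "z \<in> Z" "\<And>u. u \<in> Z \<Longrightarrow> norm z \<le> norm u"
      using continuous_attains_inf[of Z norm] False continuous_on_norm_id by blast
    have "norm z \<noteq> 1"
      using z(1) P_neq_1[of z] r by (cases "z = 1") (auto simp: Z_def)
    hence "norm z > 1" using z(1) by (auto simp: Z_def)
    show ?thesis
    proof (rule that[of "(1 + norm z) / 2"])
      fix u :: complex assume u: "1 \<le> norm u" "norm u \<le> (1 + norm z) / 2" "u \<notin> ball 1 r"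
      have "norm z \<le> 2" using z(1) by (auto simp: Z_def)
      hence "u \<notin> Z" using z(2)[of u] u \<open>norm z > 1\<close> by auto
      thus "P u \<noteq> 1" using u \<open>norm z \<le> 2\<close> by (auto simp: Z_def)
    qed (use \<open>norm z > 1\<close> in auto)
  qed
  \<comment> \<open>The full circle |u| = R is included, even its part inside the ball, since it
    becomes a contour; there \<open>near\<close> excludes zeros.\<close>
  define C :: "complex set" where "C = (cball 0 R - ball 0 1 - ball 1 r) \<union> sphere 0 R"
  have C0: "0 \<notin> C" using R(1) by (auto simp: C_def)
  have "compact C" unfolding C_def using comp by (intro compact_Un) auto
  have P1: "P u \<noteq> 1" if "u \<in> C" for u
  proof (cases "u \<in> ball 1 r")
    case True
    hence "norm u = R" using that by (auto simp: C_def)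
    hence "u \<noteq> 1" using R(1) by auto
    thus ?thesis using near[OF True] by simp
  next
    case False
    have "1 \<le> norm u" "norm u \<le> R" using that R(1) by (auto simp: C_def)
    thus ?thesis using R(2) False by blast
  qed
  have "C \<noteq> {}" using R(1) by (auto simp: C_def intro!: exI[of _ "of_real R"])
  moreover have "continuous_on C (\<lambda>u. norm (1 - P u))"
    by (intro continuous_intros P_continuous C0)
  ultimately obtain u0 where u0: "u0 \<in> C" "\<And>u. u \<in> C \<Longrightarrow> norm (1 - P u0) \<le> norm (1 - P u)"
    using continuous_attains_inf[OF \<open>compact C\<close>] by blast
  have "compact (P ` C)" using \<open>compact C\<close> P_continuous[OF C0] by (intro compact_continuous_image)
  then obtain B where B: "B > 0" "\<And>u. u \<in> C \<Longrightarrow> norm (P u) \<le> B"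
    using bounded_pos[of "P ` C"] compact_imp_bounded by auto
  \<comment> \<open>If 1 = x P(u), then |1 - P(u)| = |x - 1| |P(u)| <= |x - 1| B, which must not
    reach the minimum of |1 - P| on \<open>C\<close>.\<close>
  define e where "e = norm (1 - P u0) / B"
  have e: "e > 0" using P1[OF u0(1)] B by (simp add: e_def)
  have nz: "1 - x * P u \<noteq> 0" if x: "x \<in> ball 1 e" and u: "u \<in> C" for x u
  proof
    assume "1 - x * P u = 0"
    hence "1 - P u = (x - 1) * P u" by (simp add: algebra_simps)
    hence "norm (1 - P u) = norm (x - 1) * norm (P u)" by (simp add: norm_mult)
    also have "\<dots> \<le> norm (x - 1) * B" using B(2)[OF u] by (intro mult_left_mono) auto
    also have "\<dots> < e * B" using x B by (intro mult_strict_right_mono) (auto simp: dist_norm norm_minus_commute)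
    also have "\<dots> = norm (1 - P u0)" using B by (simp add: e_def)
    finally show False using u0(2)[OF u] by simp
  qed
  show ?thesis
  proof (rule that[OF R(1) e])
    show "1 - x * P u \<noteq> 0" if "x \<in> ball 1 e" "norm u = R" for x u :: complex
      using that by (intro nz) (auto simp: C_def)
    show "u \<in> ball 1 r" if "x \<in> ball 1 e" "1 \<le> norm u" "norm u \<le> R" "1 - x * P u = 0" for x u :: complex
      using nz[of x u] that by (auto simp: C_def)
  qed
qed

text \<open>Between |u| = 1 and |u| = R the integrand has the single pole \<open>\<psi>\<close> s,
  because \<open>\<psi>\<close> (-s) lies inside the unit circle. Differentiating 1 - 1/P =
  \<open>\<phi>\<close>^2 gives P' = 2 s \<open>\<phi>\<close>' P^2 at the pole; with x P = 1 the
  residue becomes - v^(-j-1) \<open>\<psi>\<close>'(s) / (2s), where v = \<open>\<psi>\<close>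
  s.\<close>

lemma contour_shift:
  assumes \<phi>: "\<phi> holomorphic_on ball 1 r" "inj_on \<phi> (ball 1 r)"
      "\<And>u. u \<in> ball 1 r \<Longrightarrow> u \<noteq> 0 \<and> P u \<noteq> 0" "\<And>u. u \<in> ball 1 r \<Longrightarrow> 1 - 1 / P u = (\<phi> u)\<^sup>2"
    and \<psi>: "\<psi> holomorphic_on ball 0 e" "\<And>s. s \<in> ball 0 e \<Longrightarrow> \<psi> s \<in> ball 1 r \<and> \<phi> (\<psi> s) = s"
    and s: "s \<noteq> 0" "s \<in> ball 0 e" and x: "x = 1 - s\<^sup>2"
    and mod: "norm (\<psi> s) > 1" "norm (\<psi> s) < R" "norm (\<psi> (-s)) < 1"
    and zeros: "\<And>u. 1 \<le> norm u \<Longrightarrow> norm u \<le> R \<Longrightarrow> 1 - x * P u = 0 \<Longrightarrow> u \<in> ball 1 r"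
  shows "contour_integral (circlepath 0 1) (kern j x) =
     contour_integral (circlepath 0 R) (kern j x) + 2 * pi * \<i> * (\<psi> s powi (-j - 1) * deriv \<psi> s / (2 * s))"
proof -
  define v where "v = \<psi> s"
  define v' where "v' = \<psi> (-s)"
  have ms: "-s \<in> ball 0 e" using s by simp
  have v: "v \<in> ball 1 r" "\<phi> v = s" and v': "v' \<in> ball 1 r" "\<phi> v' = -s"
    using \<psi>(2)[OF s(2)] \<psi>(2)[OF ms] by (auto simp: v_def v'_def)
  have zero_iff: "1 - x * P u = 0 \<longleftrightarrow> u = v \<or> u = v'" if u: "u \<in> ball 1 r" for u
  proof -
    have "1 - x * P u = 0 \<longleftrightarrow> 1 - 1 / P u = s\<^sup>2"
      unfolding x using \<phi>(3)[OF u] by (auto simp: field_simps)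
    also have "\<dots> \<longleftrightarrow> \<phi> u = \<phi> v \<or> \<phi> u = \<phi> v'"
      using \<phi>(4)[OF u] v v' by (simp add: power2_eq_iff)
    also have "\<dots> \<longleftrightarrow> u = v \<or> u = v'"
      using inj_onD[OF \<phi>(2) _ u v(1)] inj_onD[OF \<phi>(2) _ u v'(1)] by blast
    finally show ?thesis .
  qed
  have "v \<noteq> v'" using v v' s by auto
  have v0: "v \<noteq> 0" "P v \<noteq> 0" using \<phi>(3)[OF v(1)] by auto
  have xP: "x * P v = 1" using zero_iff[OF v(1)] by simp
  hence x0: "x \<noteq> 0" by auto
  \<comment> \<open>The second set restores the pole \<open>v\<close>, the only zero of the kernel
    in \<open>S\<close>; \<open>v'\<close> remains excluded.\<close>
  define S where "S = {u \<in> -{0}. 1 - x * P u \<noteq> 0} \<union> (ball 1 r - {v'})"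
  have "open ((-{0}) \<inter> (\<lambda>u. 1 - x * P u) -` (-{0}))"
    by (intro continuous_open_preimage continuous_intros P_continuous) auto
  moreover have "(-{0}) \<inter> (\<lambda>u. 1 - x * P u) -` (-{0}) = {u \<in> -{0}. 1 - x * P u \<noteq> 0}" by auto
  ultimately have "open S" unfolding S_def by (auto intro!: open_Un open_delete)
  have S0: "S \<subseteq> -{0}" using \<phi>(3)[of 0] by (auto simp: S_def)
  have Snz: "1 - x * P u \<noteq> 0" if "u \<in> S" "u \<noteq> v" for u
    using that zero_iff[of u] unfolding S_def by blast
  have "v \<in> S" using v \<open>v \<noteq> v'\<close> by (auto simp: S_def)
  have annS: "u \<in> S" if "1 \<le> norm u" "norm u \<le> R" for u
  proof (cases "1 - x * P u = 0")
    case True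
    hence "u \<in> ball 1 r" using zeros that by blast
    moreover have "u \<noteq> v'" using that mod(3) by (auto simp: v'_def)
    ultimately show ?thesis by (auto simp: S_def)
  next
    case False
    have "u \<noteq> 0" using that by auto
    with False show ?thesis by (auto simp: S_def)
  qed
  \<comment> \<open>The kernel with its zero at \<open>v\<close> divided out. It has no zero on
    \<open>S\<close>, since its value at \<open>v\<close> is -x P'(v), which is nonzero.\<close>
  define k where "k = (\<lambda>u. if u = v then deriv (\<lambda>u. 1 - x * P u) v else ((1 - x * P u) - (1 - x * P v)) / (u - v))"
  have holP: "P holomorphic_on S" using P_holomorphic S0 by (rule holomorphic_on_subset)
  have holk: "k holomorphic_on S"
    unfolding k_def using \<open>open S\<close> \<open>v \<in> S\<close>
    by (intro pole_lemma holomorphic_intros holP) (auto simp: interior_open)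
  have d\<phi>: "(\<phi> has_field_derivative deriv \<phi> v) (at v)"
    using holomorphic_derivI[OF \<phi>(1) open_ball v(1)] .
  have d\<psi>: "(\<psi> has_field_derivative deriv \<psi> s) (at s)"
    using holomorphic_derivI[OF \<psi>(1) open_ball s(2)] .
  have "((\<lambda>s. \<phi> (\<psi> s)) has_field_derivative deriv \<phi> v * deriv \<psi> s) (at s)"
    using DERIV_chain2[OF _ d\<psi>, of \<phi>] d\<phi> by (simp add: v_def)
  moreover have "((\<lambda>s. \<phi> (\<psi> s)) has_field_derivative 1) (at s)"
    by (rule has_field_derivative_transform_within_open[OF DERIV_ident open_ball s(2)]) (simp add: \<psi>(2))
  ultimately have inv: "deriv \<phi> v * deriv \<psi> s = 1" by (rule DERIV_unique)
  have "((\<lambda>u. (\<phi> u)\<^sup>2) has_field_derivative 2 * s * deriv \<phi> v) (at v)"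
    using v(2) by (auto intro!: derivative_eq_intros d\<phi>)
  hence "((\<lambda>u. 1 - 1 / P u) has_field_derivative 2 * s * deriv \<phi> v) (at v)"
    by (rule has_field_derivative_transform_within_open[OF _ open_ball v(1)]) (simp add: \<phi>(4))
  moreover have "((\<lambda>u. 1 - 1 / P u) has_field_derivative dP v / (P v)\<^sup>2) (at v)"
    using v0 by (auto intro!: derivative_eq_intros DERIV_P simp: power2_eq_square)
  ultimately have "2 * s * deriv \<phi> v = dP v / (P v)\<^sup>2" by (rule DERIV_unique)
  hence dPv: "dP v = 2 * s * deriv \<phi> v * (P v)\<^sup>2" using v0 by (simp add: field_simps)
  have "deriv \<phi> v \<noteq> 0" using inv by auto
  hence dP0: "dP v \<noteq> 0" using dPv v0 s by simp
  have "((\<lambda>u. 1 - x * P u) has_field_derivative - (x * dP v)) (at v)"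
    using v0 by (auto intro!: derivative_eq_intros DERIV_P)
  hence kv: "k v = - (x * dP v)" by (simp add: k_def DERIV_imp_deriv)
  have knz: "k u \<noteq> 0" if "u \<in> S" for u
    using Snz[OF that] kv x0 dP0 xP by (cases "u = v") (auto simp: k_def)
  define N where "N = (\<lambda>u. P u * u powi (-j - 1) / k u)"
  have holN: "N holomorphic_on S"
    unfolding N_def using S0 knz by (intro holomorphic_intros holP holk) auto
  \<comment> \<open>The integrand minus its principal part \<open>N v / (u - v)\<close>. Being
    holomorphic on \<open>S\<close>, it has equal integrals over both circles, and the principal
    part is integrated separately.\<close>
  define g where "g = (\<lambda>u. if u = v then deriv N v else (N u - N v) / (u - v))"
  have holg: "g holomorphic_on S"
    unfolding g_def using \<open>open S\<close> \<open>v \<in> S\<close> by (intro pole_lemma holN) (auto simp: interior_open)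
  have R: "R > 1" using mod by linarith
  have kern_eq: "kern j x u = g u + N v / (u - v)" if "u \<in> S" "u \<noteq> v" for u
  proof -
    have "1 - x * P u = k u * (u - v)" using that xP by (simp add: k_def)
    hence "kern j x u = N u / (u - v)" by (simp add: kern_def N_def)
    thus ?thesis using that by (simp add: g_def diff_divide_distrib)
  qed
  have kern_on: "g u + N v / (u - v) = kern j x u" if "norm u = 1 \<or> norm u = R" for u
  proof -
    have "u \<noteq> v" using that mod by (auto simp: v_def)
    moreover have "u \<in> S" using that R by (intro annS) auto
    ultimately show ?thesis by (simp add: kern_eq)
  qed
  have homo: "homotopic_loops S (circlepath 0 1) (circlepath 0 R)"
  proof (rule homotopic_loops_linear)
    fix t
    show "closed_segment (circlepath 0 1 t) (circlepath 0 R t) \<subseteq> S"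
    proof
      fix u assume "u \<in> closed_segment (circlepath 0 1 t) (circlepath 0 R t)"
      then obtain t' where l: "0 \<le> t'" "t' \<le> 1"
          "u = of_real (1 - t') * circlepath 0 1 t + of_real t' * circlepath 0 R t"
        by (auto simp: closed_segment_def scaleR_conv_of_real)
      have "u = of_real (1 + t' * (R - 1)) * exp (2 * of_real pi * \<i> * of_real t)"
        unfolding l(3) circlepath by (simp add: algebra_simps)
      hence "norm u = \<bar>1 + t' * (R - 1)\<bar>" by (simp only: norm_mult norm_of_real) simp
      also have "\<dots> = 1 + t' * (R - 1)" using l R by simp
      finally have nu: "norm u = 1 + t' * (R - 1)" .
      have "t' * (R - 1) \<le> 1 * (R - 1)" using l R by (intro mult_right_mono) auto
      hence "norm u \<le> R" using nu by simp
      moreover have "1 \<le> norm u" using nu l R by simp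
      ultimately show "u \<in> S" by (intro annS)
    qed
  qed auto
  have geq: "contour_integral (circlepath 0 1) g = contour_integral (circlepath 0 R) g"
    by (rule Cauchy_theorem_homotopic_loops[OF homo \<open>open S\<close> holg]) simp_all
  have sub: "path_image (circlepath 0 1) \<subseteq> S" "path_image (circlepath 0 R) \<subseteq> S"
    using R annS by auto
  have gi: "g contour_integrable_on circlepath 0 1" "g contour_integrable_on circlepath 0 R"
    using holg \<open>open S\<close> sub by (auto intro!: contour_integrable_holomorphic_simple)
  have "((\<lambda>u. N v / (u - v)) has_contour_integral 0) (circlepath 0 1)"
    using mod by (intro Cauchy_theorem_convex_simple[of _ "ball 0 (norm v)"] holomorphic_intros) (auto simp: v_def)
  from has_contour_integral_add[OF has_contour_integral_integral[OF gi(1)] this]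
  have "(kern j x has_contour_integral contour_integral (circlepath 0 1) g + 0) (circlepath 0 1)"
    by (rule has_contour_integral_eq) (use kern_on in auto)
  hence 1: "contour_integral (circlepath 0 1) (kern j x) = contour_integral (circlepath 0 1) g"
    using contour_integral_unique by force
  have "((\<lambda>u. N v / (u - v)) has_contour_integral 2 * of_real pi * \<i> * N v) (circlepath 0 R)"
    using mod by (intro Cauchy_integral_circlepath_simple[of "\<lambda>_. N v"] holomorphic_intros) (auto simp: v_def)
  from has_contour_integral_add[OF has_contour_integral_integral[OF gi(2)] this]
  have "(kern j x has_contour_integral contour_integral (circlepath 0 R) g + 2 * of_real pi * \<i> * N v) (circlepath 0 R)"
    by (rule has_contour_integral_eq) (use kern_on R in auto)
  hence 2: "contour_integral (circlepath 0 R) (kern j x) = contour_integral (circlepath 0 R) g + 2 * of_real pi * \<i> * N v"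
    by (rule contour_integral_unique)
  have "N v = - (P v * v powi (-j - 1) / (x * dP v))" by (simp add: N_def kv)
  also have "\<dots> = - (v powi (-j - 1) / (x * P v * (2 * s * deriv \<phi> v)))"
    using v0 by (simp add: dPv power2_eq_square)
  also have "\<dots> = - (v powi (-j - 1) * deriv \<psi> s / (2 * s))"
  proof -
    have "1 / deriv \<phi> v = deriv \<psi> s" using inv by (metis nonzero_eq_divide_eq mult.commute \<open>deriv \<phi> v \<noteq> 0\<close>)
    hence "v powi (-j - 1) * deriv \<psi> s / (2 * s) = v powi (-j - 1) * (1 / deriv \<phi> v) / (2 * s)" by simp
    thus ?thesis using xP by (simp add: mult_ac)
  qed
  finally show ?thesis using 1 2 geq by (simp add: v_def)
qed

text \<open>Away from s = 0 the unit-circle integral is analytic because the kernel does not vanish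
  on the contour. Near s = 0 it is replaced by the integral over the larger circle, analytic in x at
  1, plus the residue; after multiplication by s the sum is analytic in s. At s = 0 only the residue
  \<open>\<psi>\<close>'(0)/2 = kappa/2 remains, which does not depend on j.\<close>

theorem step_count_singularity:
  obtains H where "H analytic_on lobe" "H 0 = of_real (kappa / 2)"
    "\<And>x. norm x < 1 \<Longrightarrow> (\<lambda>l. of_real (step_count c d a (Suc l) j) * x ^ l) sums (H (csqrt (1 - x)) / csqrt (1 - x))"
proof -
  obtain \<phi> \<psi> r e0 where re: "r > 0" "e0 > 0"
    and \<phi>3: "\<And>u. u \<in> ball 1 r \<Longrightarrow> u \<noteq> 0 \<and> P u \<noteq> 0"
    and \<phi>: "\<phi> holomorphic_on ball 1 r" "inj_on \<phi> (ball 1 r)" "\<phi> 1 = 0"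
    and \<phi>4: "\<And>u. u \<in> ball 1 r \<Longrightarrow> 1 - 1 / P u = (\<phi> u)\<^sup>2"
    and \<psi>: "\<psi> holomorphic_on ball 0 e0" "\<And>s. s \<in> ball 0 e0 \<Longrightarrow> \<psi> s \<in> ball 1 r \<and> \<phi> (\<psi> s) = s"
    and \<psi>0: "\<psi> 0 = 1" "deriv \<psi> 0 = of_real kappa"
    by (rule local_parameter) blast
  obtain e1 where e1: "e1 > 0"
    "\<And>s. s \<noteq> 0 \<Longrightarrow> norm s < e1 \<Longrightarrow> \<bar>Im s\<bar> \<le> 2 * Re s \<Longrightarrow> norm (\<psi> s) > 1 \<and> norm (\<psi> (-s)) < 1"
    using moduli_in_cone[OF \<psi>(1) re(2) \<psi>0] by blast
  have P1: "P u \<noteq> 1" if u: "u \<in> ball 1 r" "u \<noteq> 1" for u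
  proof
    assume "P u = 1"
    hence "\<phi> u = \<phi> 1" using \<phi>4[OF u(1)] \<phi>(3) by simp
    thus False using inj_onD[OF \<phi>(2) _ u(1), of 1] re u(2) by simp
  qed
  obtain R e2 where R: "R > 1" "e2 > 0"
    "\<And>x u. x \<in> ball 1 e2 \<Longrightarrow> norm u = R \<Longrightarrow> 1 - x * P u \<noteq> 0"
    "\<And>x u. x \<in> ball 1 e2 \<Longrightarrow> 1 \<le> norm u \<Longrightarrow> norm u \<le> R \<Longrightarrow> 1 - x * P u = 0 \<Longrightarrow> u \<in> ball 1 r"
    using annulus_zeros[OF re(1) P1] by blast
  have "isCont \<psi> 0" using \<psi>(1) re(2) continuous_on_eq_continuous_at[of "ball 0 e0" \<psi>]
    by (auto intro: holomorphic_on_imp_continuous_on)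
  then obtain e3 where e3: "e3 > 0" "\<And>s. norm s < e3 \<Longrightarrow> norm (\<psi> s - 1) < R - 1"
    using R(1) \<psi>0 unfolding continuous_at_eps_delta by (auto simp: dist_norm dest!: spec[of _ "R - 1"])
  define e where "e = Min {e0, e1, sqrt e2, e3}"
  have e: "e > 0" "e \<le> e0" "e \<le> e1" "e \<le> sqrt e2" "e \<le> e3"
    using re e1(1) R(2) e3(1) by (auto simp: e_def)
  have xs: "1 - s\<^sup>2 \<in> ball 1 e2" if "norm s < e" for s :: complex
  proof -
    have "(norm s)\<^sup>2 < (sqrt e2)\<^sup>2" using that e by (intro power_strict_mono) auto
    thus ?thesis using R(2) by (simp add: dist_norm norm_power)
  qed
  define I where "I = (\<lambda>x. contour_integral (circlepath 0 1) (kern j x) / (2 * pi * \<i>))"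
  define J where "J = (\<lambda>x. contour_integral (circlepath 0 R) (kern j x) / (2 * pi * \<i>))"
  define h where "h = (\<lambda>s. s * J (1 - s\<^sup>2) + \<psi> s powi (-j - 1) * deriv \<psi> s / 2)"
  have shift: "h s = s * I (1 - s\<^sup>2)" if s: "s \<noteq> 0" "norm s < e" "\<bar>Im s\<bar> \<le> 2 * Re s" for s
  proof -
    have "norm (\<psi> s) \<le> norm (\<psi> s - 1) + 1" using norm_triangle_ineq[of "\<psi> s - 1" 1] by simp
    also have "\<dots> < R" using e3(2)[of s] s e by simp
    finally have lt: "norm (\<psi> s) < R" .
    have "contour_integral (circlepath 0 1) (kern j (1 - s\<^sup>2)) =
       contour_integral (circlepath 0 R) (kern j (1 - s\<^sup>2)) + 2 * pi * \<i> * (\<psi> s powi (-j - 1) * deriv \<psi> s / (2 * s))"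
      using e1(2)[of s] s e
      by (intro contour_shift[OF \<phi>(1,2) \<phi>3 \<phi>4 \<psi> s(1) _ refl _ lt _ R(4)[OF xs[OF s(2)]]]) auto
    thus ?thesis using s(1) by (simp add: h_def I_def J_def field_simps)
  qed
  have J: "J holomorphic_on ball 1 e2"
    unfolding J_def using R by (intro holomorphic_intros kern_integral_holomorphic) auto
  have "(\<lambda>s. J (1 - s\<^sup>2)) holomorphic_on ball 0 e"
    using xs by (intro holomorphic_on_compose_gen[OF _ J, unfolded o_def] holomorphic_intros) auto
  moreover have "\<psi> holomorphic_on ball 0 e" using \<psi>(1) e(2) by (auto elim!: holomorphic_on_subset)
  moreover have "\<psi> s \<noteq> 0" if "s \<in> ball 0 e" for s using \<psi>(2)[of s] \<phi>3[of "\<psi> s"] that e by auto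
  ultimately have hol_h: "h holomorphic_on ball 0 e"
    unfolding h_def by (intro holomorphic_intros) auto
  \<comment> \<open>The two formulas agree in the cone up to radius \<open>e\<close>. Switching at
    e/2 leaves room for them to agree on a neighbourhood of every nonzero point of
    \<open>lobe\<close> where the switch occurs.\<close>
  define H where "H = (\<lambda>s. if norm s < e / 2 then h s else s * I (1 - s\<^sup>2))"
  have "H analytic_on {s}" if s: "s \<in> lobe" for s
  proof (cases "norm s < e / 2")
    case True
    have "h analytic_on ball 0 (e / 2)"
      using holomorphic_on_subset[OF hol_h subset_ball[of "e / 2" e 0]] e by (subst analytic_on_open) auto
    hence "h analytic_on {s}" by (rule analytic_on_subset) (use True in auto)
    moreover have "\<forall>\<^sub>F y in nhds s. h y = H y"
      using eventually_nhds_in_open[OF open_ball[of 0 "e / 2"], of s] True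
      by (auto elim!: eventually_mono simp: H_def)
    ultimately show ?thesis using iffD1[OF analytic_at_cong[OF _ refl]] by metis
  next
    case False
    hence s0: "s \<noteq> 0" using e by auto
    hence Re: "Re s > 0" using lobe_Re_pos s by blast
    have cone: "\<bar>Im s\<bar> < 2 * Re s" using lobe_cone[OF s] Re by simp
    define x0 where "x0 = 1 - s\<^sup>2"
    have x0: "norm x0 \<le> 1" "x0 \<noteq> 1" using s s0 by (auto simp: lobe_def x0_def)
    obtain u0 where u0: "norm u0 = 1" "\<And>u. norm u = 1 \<Longrightarrow> norm (1 - x0 * P u0) \<le> norm (1 - x0 * P u)"
    proof -
      have "continuous_on (sphere 0 1) (\<lambda>u. norm (1 - x0 * P u))"
        by (intro continuous_intros P_continuous) auto
      then obtain u0 where "u0 \<in> sphere 0 1" "\<forall>u\<in>sphere 0 1. norm (1 - x0 * P u0) \<le> norm (1 - x0 * P u)"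
        using continuous_attains_inf[of "sphere (0::complex) 1" "\<lambda>u. norm (1 - x0 * P u)"] by auto
      thus ?thesis by (intro that[of u0]) auto
    qed
    define \<delta> where "\<delta> = norm (1 - x0 * P u0)"
    have \<delta>: "\<delta> > 0" using kernel_nonzero[OF x0 u0(1)] by (simp add: \<delta>_def)
    have "1 - x * P u \<noteq> 0" if "x \<in> ball x0 \<delta>" "norm u = 1" for x u
    proof
      assume "1 - x * P u = 0"
      hence "1 - x0 * P u = (x - x0) * P u" by (simp add: algebra_simps)
      hence "norm (1 - x0 * P u) = norm (x - x0) * norm (P u)" by (simp add: norm_mult)
      also have "\<dots> \<le> norm (x - x0)" using norm_P_le[OF that(2)] by (simp add: mult_left_le)
      also have "\<dots> < \<delta>" using that by (simp add: dist_norm norm_minus_commute)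
      finally show False using u0(2)[OF that(2)] by (simp add: \<delta>_def)
    qed
    hence "I holomorphic_on ball x0 \<delta>"
      unfolding I_def by (intro holomorphic_intros kern_integral_holomorphic) auto
    hence "I analytic_on {x0}" using \<delta> by (auto simp: analytic_at_ball)
    hence "I analytic_on (\<lambda>s. 1 - s\<^sup>2) ` {s}" by (simp add: x0_def)
    hence "(I \<circ> (\<lambda>s. 1 - s\<^sup>2)) analytic_on {s}"
      by (intro analytic_on_compose analytic_intros)
    hence an: "(\<lambda>s. s * I (1 - s\<^sup>2)) analytic_on {s}"
      by (auto simp: o_def intro!: analytic_intros)
    have "open {y. \<bar>Im y\<bar> < 2 * Re y}" by (intro open_Collect_less continuous_intros)
    hence "\<forall>\<^sub>F y in nhds s. y \<in> {y. \<bar>Im y\<bar> < 2 * Re y}"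
      using cone by (intro eventually_nhds_in_open) auto
    hence "\<forall>\<^sub>F y in nhds s. y * I (1 - y\<^sup>2) = H y"
    proof eventually_elim
      case (elim y)
      hence "y \<noteq> 0" by auto
      thus ?case using elim shift[of y] e by (auto simp: H_def)
    qed
    from iffD1[OF analytic_at_cong[OF this refl] an] show ?thesis .
  qed
  hence "H analytic_on lobe" using analytic_on_analytic_at by blast
  moreover have "H 0 = of_real (kappa / 2)" using e by (simp add: H_def h_def \<psi>0)
  moreover have "(\<lambda>l. of_real (step_count c d a (Suc l) j) * x ^ l) sums (H (csqrt (1 - x)) / csqrt (1 - x))"
    if x: "norm x < 1" for x
  proof -
    let ?s = "csqrt (1 - x)"
    have s: "?s \<noteq> 0" "\<bar>Im ?s\<bar> \<le> 2 * Re ?s"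
      using csqrt_disc[OF x] lobe_cone[OF csqrt_in_lobe[of x]] x by auto
    have "H ?s = ?s * I (1 - ?s\<^sup>2)" using shift[OF s(1) _ s(2)] e by (auto simp: H_def simp del: power2_csqrt)
    hence "H ?s / ?s = I x" using s by simp
    thus ?thesis using step_count_series[OF x, of j] by (simp add: I_def)
  qed
  ultimately show ?thesis using that by blast
qed

end

subsection \<open>Spitzer's identity\<close>

lemma fls_mult_neg_supp:
  fixes f g :: "'a::comm_ring_1 fls"
  assumes "\<And>k. k \<ge> 0 \<Longrightarrow> fls_nth f k = 0" "\<And>k. k \<ge> 0 \<Longrightarrow> fls_nth g k = 0" "k \<ge> 0"
  shows "fls_nth (f * g) k = 0"
  unfolding fls_times_nth(2)
proof (rule sum.neutral, intro ballI)
  fix i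
  show "fls_nth f i * fls_nth g (k - i) = 0" using assms by (cases "i \<ge> 0") auto
qed

lemma fls_mult_nonneg_supp:
  fixes f g :: "'a::comm_ring_1 fls"
  assumes "\<And>k. k < 0 \<Longrightarrow> fls_nth f k = 0" "\<And>k. k < 0 \<Longrightarrow> fls_nth g k = 0"
  shows "fls_nth (f * g) k = (\<Sum>j\<in>{0..k}. fls_nth f j * fls_nth g (k - j))"
  unfolding fls_times_nth(2)
proof (rule sum.mono_neutral_cong_left)
  have "fls_subdegree f \<ge> 0" "fls_subdegree g \<ge> 0"
    using assms by (auto intro: fls_subdegree_ge0I)
  thus "{fls_subdegree f..k - fls_subdegree g} \<subseteq> {0..k}" by auto
  show "\<forall>i\<in>{0..k} - {fls_subdegree f..k - fls_subdegree g}. fls_nth f i * fls_nth g (k - i) = 0"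
    by (force simp: not_le)
qed auto

text \<open>Spitzer's identity in differentiated form. With \<open>K = 1 - z P(u)\<close> and \<open>M = \<Sum> m n k z^n u^k\<close>
  the product \<open>K M\<close> is \<open>1 - N\<close>, where \<open>N\<close> has only negative powers of \<open>u\<close>. Taking logarithmic derivatives
  and separating the signs of the powers of \<open>u\<close> shows that both sides of the resulting equation vanish.\<close>

theorem spitzer_recurrence:
  fixes m :: "nat \<Rightarrow> int \<Rightarrow> real" and a :: "int \<Rightarrow> real"
  assumes m0: "\<And>k. m 0 k = (if k = 0 then 1 else 0)"
    and mneg: "\<And>n k. k < 0 \<Longrightarrow> m n k = 0"
    and mSuc: "\<And>n k. k \<ge> 0 \<Longrightarrow> m (Suc n) k = (\<Sum>i\<in>{-c..d}. a i * m n (k - i))"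
    and "k \<ge> 0"
  shows "real n * m n k = (\<Sum>l\<in>{1..n}. \<Sum>j\<in>{0..k}. step_count c d a l j * m (n - l) (k - j))"
proof -
  define Ps :: "real fls" where "Ps = (\<Sum>i\<in>{-c..d}. fls_const (a i) * fls_shift (-i) 1)"
  have Ps_mult: "fls_nth (Ps * X) k = (\<Sum>i\<in>{-c..d}. a i * fls_nth X (k - i))" for X k
  proof -
    have "Ps * X = (\<Sum>i\<in>{-c..d}. fls_const (a i) * fls_shift (-i) X)"
      unfolding Ps_def sum_distrib_right by (simp add: mult.assoc fls_shifted_times_simps)
    thus ?thesis by (simp add: fls_nth_sum)
  qed
  have Ps_power: "fls_nth (Ps ^ l) j = step_count c d a l j" for l j
    by (induction l arbitrary: j) (auto simp: Ps_mult)
  define Mn :: "nat \<Rightarrow> real fls" where "Mn n = fps_to_fls (Abs_fps (\<lambda>k. m n (int k)))" for n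
  have Mn_nth: "fls_nth (Mn n) k = m n k" for n k by (simp add: Mn_def mneg)
  have Mn0: "Mn 0 = 1" by (rule fls_eqI) (simp add: Mn_nth m0)
  define M where "M = Abs_fps Mn"
  define K :: "real fls fps" where "K = 1 - fps_X * fps_const Ps"
  define N where "N = 1 - K * M"
  have N0: "fps_nth N 0 = 0" by (simp add: N_def K_def M_def Mn0 left_diff_distrib mult.assoc)
  \<comment> \<open>\<open>N\<close> collects the steps that would leave the half-line, hence only
    negative powers of u; this is where \<open>mSuc\<close> enters.\<close>
  have Nneg: "fls_nth (fps_nth N n) k = 0" if "k \<ge> 0" for n k
  proof (cases n)
    case (Suc n')
    have "fps_nth N n = Ps * Mn n' - Mn n"
      by (simp add: N_def K_def M_def Suc left_diff_distrib mult.assoc)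
    thus ?thesis using that by (simp add: Ps_mult Mn_nth Suc mSuc)
  qed (simp add: N0)
  define pos :: "real fls \<Rightarrow> real fls" where "pos X = fps_to_fls (fls_regpart X)" for X
  have pos_nth: "fls_nth (pos X) k = (if k < 0 then 0 else fls_nth X k)" for X k by (simp add: pos_def)
  \<comment> \<open>\<open>Bp\<close> and \<open>Bm\<close> split z P / (1 - z P) = - z K'/K into
    its nonnegative and negative powers of u.\<close>
  define Bp where "Bp = Abs_fps (\<lambda>l. if l = 0 then 0 else pos (Ps ^ l))"
  define Bm where "Bm = Abs_fps (\<lambda>l. if l = 0 then 0 else Ps ^ l - pos (Ps ^ l))"
  have B: "(Bp + Bm) * K = fps_X * fps_const Ps"
  proof (rule fps_ext)
    fix n
    show "fps_nth ((Bp + Bm) * K) n = fps_nth (fps_X * fps_const Ps) n"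
      by (cases n) (auto simp: Bp_def Bm_def K_def right_diff_distrib mult.assoc[symmetric] fps_mult_right_const_nth)
  qed
  \<comment> \<open>The quotient \<open>Y\<close> of this by \<open>M\<close> is z M'/M - Bp. By K M
    = 1 - N it also equals Bm - z N'/(1 - N).\<close>
  define X where "X = fps_X * fps_deriv M - Bp * M"
  define Y where "Y = X * inverse M"
  have M0: "fps_nth M 0 = 1" by (simp add: M_def Mn0)
  have XY: "X = Y * M"
    unfolding Y_def using M0 by (simp add: mult.assoc inverse_mult_eq_1)
  have dK: "fps_X * fps_deriv K = - ((Bp + Bm) * K)"
    unfolding B by (simp add: K_def)
  have KM: "K * M = 1 - N" by (simp add: N_def)
  have "fps_X * fps_deriv (1 - N) = fps_X * fps_deriv K * M + K * (fps_X * fps_deriv M)"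
    unfolding KM[symmetric] by (simp add: algebra_simps)
  also have "\<dots> = K * X - Bm * (1 - N)"
    unfolding dK KM[symmetric] X_def by (simp add: algebra_simps)
  finally have "K * X = Bm * (1 - N) - fps_X * fps_deriv N"
    by (simp add: algebra_simps)
  moreover have "K * X = (1 - N) * Y" unfolding XY KM[symmetric] by (simp add: mult_ac)
  ultimately have YN: "(1 - N) * Y = Bm * (1 - N) - fps_X * fps_deriv N" by simp
  \<comment> \<open>Once the lower coefficients of \<open>Y\<close> vanish, its n-th one equals that
    of \<open>Y * M\<close> and that of \<open>Y * (1 - N)\<close>. The first has no negative and
    the second no nonnegative powers of u, so no support statement about the inverses of
    \<open>M\<close> and 1 - \<open>N\<close> has to be proved.\<close>
  have Y0: "fps_nth Y n = 0" for n
  proof (induction n rule: less_induct)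
    case (less n)
    have conv: "fps_nth (Y * G) n = fps_nth Y n" if "fps_nth G 0 = 1" for G :: "real fls fps"
    proof -
      have "fps_nth (Y * G) n = (\<Sum>i\<in>{0..n}. if i = n then fps_nth Y n else 0)"
        unfolding fps_mult_nth by (rule sum.cong) (use less that in auto)
      thus ?thesis by simp
    qed
    have Xn: "fps_nth Y n = fps_nth X n" unfolding XY by (rule conv[symmetric, OF M0])
    have Nn: "fps_nth Y n = fps_nth (Bm * (1 - N) - fps_X * fps_deriv N) n"
      unfolding YN[symmetric] mult.commute[of _ Y] by (rule conv[symmetric]) (simp add: N0)
    show ?case
    proof (rule fls_eqI)
      fix k
      show "fls_nth (fps_nth Y n) k = fls_nth 0 k"
      proof (cases "k < 0")
        case True
        have "fls_nth (fps_nth Bp i * fps_nth M (n - i)) k = 0" for i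
          using True by (subst fls_mult_nonneg_supp) (auto simp: Bp_def M_def pos_nth Mn_nth mneg)
        moreover have "fps_nth (fps_X * fps_deriv M) n = of_nat n * Mn n" by (cases n) (auto simp: M_def)
        ultimately show ?thesis using True
          by (simp add: Xn X_def fps_mult_nth fls_nth_sum Mn_nth mneg)
      next
        case False
        have "fls_nth (fps_nth Bm i * fps_nth N (n - i)) k = 0" for i
          using False by (intro fls_mult_neg_supp Nneg) (auto simp: Bm_def pos_nth)
        moreover have "fps_nth (fps_X * fps_deriv N) n = of_nat n * fps_nth N n" by (cases n) auto
        moreover have "fls_nth (fps_nth Bm n) k = 0" using False by (auto simp: Bm_def pos_nth)
        ultimately show ?thesis using False
          by (simp add: Nn right_diff_distrib fps_mult_nth[of Bm N] fls_nth_sum Nneg)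
      qed
    qed
  qed
  have "X = 0" unfolding XY by (rule fps_ext) (simp add: fps_mult_nth Y0)
  hence eq: "fps_nth (fps_X * fps_deriv M) n = fps_nth (Bp * M) n" by (simp add: X_def)
  have "fps_nth (fps_X * fps_deriv M) n = of_nat n * Mn n" by (cases n) (auto simp: M_def)
  hence "real n * m n k = fls_nth (fps_nth (Bp * M) n) k" using eq by (simp add: Mn_nth flip: eq)
  also have "\<dots> = (\<Sum>l\<in>{0..n}. fls_nth (fps_nth Bp l * fps_nth M (n - l)) k)" by (simp add: fps_mult_nth fls_nth_sum)
  also have "\<dots> = (\<Sum>l\<in>{1..n}. fls_nth (fps_nth Bp l * fps_nth M (n - l)) k)"
    by (rule sum.mono_neutral_right) (auto simp: Bp_def not_le)
  also have "\<dots> = (\<Sum>l\<in>{1..n}. \<Sum>j\<in>{0..k}. step_count c d a l j * m (n - l) (k - j))"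
  proof (rule sum.cong[OF refl])
    fix l assume l: "l \<in> {1..n}"
    have "fls_nth (fps_nth Bp l * fps_nth M (n - l)) k = (\<Sum>j\<in>{0..k}. fls_nth (fps_nth Bp l) j * fls_nth (fps_nth M (n - l)) (k - j))"
      by (rule fls_mult_nonneg_supp) (auto simp: Bp_def M_def pos_nth Mn_nth mneg)
    also have "\<dots> = (\<Sum>j\<in>{0..k}. step_count c d a l j * m (n - l) (k - j))"
      using l by (intro sum.cong refl) (auto simp: Bp_def M_def pos_nth Mn_nth Ps_power)
    finally show "fls_nth (fps_nth Bp l * fps_nth M (n - l)) k = (\<Sum>j\<in>{0..k}. step_count c d a l j * m (n - l) (k - j))" .
  qed
  finally show ?thesis .
qed

subsection \<open>Catastrophe-free meanders\<close>

lemma alts_from_append: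
  "alts_from h (xs @ ys) = alts_from h xs @ alts_from (last (h # alts_from h xs)) ys"
  by (induction xs arbitrary: h) auto

lemma final_alt_snoc: "final_alt (xs @ [s]) = next_alt (final_alt xs) s"
  by (simp add: final_alt_def alts_from_append)

lemma valid_from_append:
  "valid_from p h (xs @ ys) \<longleftrightarrow> valid_from p h xs \<and> valid_from p (last (h # alts_from h xs)) ys"
  by (induction p h xs rule: valid_from.induct) auto

lemma weight_append: "weight p q (xs @ ys) = weight p q xs * weight p q ys"
  by (induction p q xs rule: weight.induct) auto

definition free_meanders :: "(int \<Rightarrow> real) \<Rightarrow> nat \<Rightarrow> step list set" where
  "free_meanders p n = {xs \<in> paths p n. is_meander xs \<and> cat_free xs}"

lemma free_meanders_0: "free_meanders p 0 = {[]}"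
  by (auto simp: free_meanders_def paths_def is_meander_def cat_free_def)

lemma free_meanders_Suc:
  "free_meanders p (Suc n) =
     {xs @ [Jump i] | xs i. xs \<in> free_meanders p n \<and> i \<in> jumps p \<and> 0 \<le> final_alt xs + i}"
proof (intro equalityI subsetI)
  fix ys assume "ys \<in> free_meanders p (Suc n)"
  hence ys: "set ys \<subseteq> insert Cat (Jump ` jumps p)" "length ys = Suc n" "valid_from p 0 ys"
      "\<forall>h\<in>set (alts_from 0 ys). 0 \<le> h" "Cat \<notin> set ys"
    by (auto simp: free_meanders_def paths_def is_meander_def cat_free_def)
  obtain xs s where xs: "ys = xs @ [s]" using ys(2) by (cases ys rule: rev_cases) auto
  then obtain i where i: "s = Jump i" "i \<in> jumps p" using ys(1,5) by auto
  have "final_alt ys \<in> set (alts_from 0 ys)" by (auto simp: final_alt_def alts_from_append xs)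
  hence "0 \<le> final_alt xs + i" using ys(4) by (simp add: xs i final_alt_snoc)
  moreover have "xs \<in> free_meanders p n"
    using ys by (auto simp: xs free_meanders_def paths_def is_meander_def cat_free_def valid_from_append alts_from_append)
  ultimately show "ys \<in> {xs @ [Jump i] | xs i. xs \<in> free_meanders p n \<and> i \<in> jumps p \<and> 0 \<le> final_alt xs + i}"
    using xs i by blast
next
  fix ys assume "ys \<in> {xs @ [Jump i] | xs i. xs \<in> free_meanders p n \<and> i \<in> jumps p \<and> 0 \<le> final_alt xs + i}"
  then obtain xs i where "ys = xs @ [Jump i]" "xs \<in> free_meanders p n" "i \<in> jumps p" "0 \<le> final_alt xs + i" by blast
  thus "ys \<in> free_meanders p (Suc n)"
    by (auto simp: free_meanders_def paths_def is_meander_def cat_free_def valid_from_append alts_from_append final_alt_def)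
qed

lemma finite_free_meanders:
  assumes "finite (jumps p)"
  shows "finite (free_meanders p n)"
proof (rule finite_subset)
  show "free_meanders p n \<subseteq> {xs. set xs \<subseteq> insert Cat (Jump ` jumps p) \<and> length xs = n}"
    by (auto simp: free_meanders_def paths_def)
  show "finite {xs. set xs \<subseteq> insert Cat (Jump ` jumps p) \<and> length xs = n}"
    using assms by (intro finite_lists_length_eq) auto
qed

lemma free_meanders_final:
  assumes "jumps p \<subseteq> {..d}" "xs \<in> free_meanders p n"
  shows "final_alt xs \<in> {0..int n * d}"
  using assms(2)
proof (induction n arbitrary: xs)
  case 0
  thus ?case by (simp add: free_meanders_0 final_alt_def)
next
  case (Suc n)
  then obtain ys i where ys: "xs = ys @ [Jump i]" "ys \<in> free_meanders p n" "i \<in> jumps p" "0 \<le> final_alt ys + i"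
    by (auto simp: free_meanders_Suc)
  have "i \<le> d" using ys assms(1) by auto
  thus ?case using Suc.IH[OF ys(2)] ys by (auto simp: final_alt_snoc algebra_simps)
qed

lemma mcoef_alt: "mcoef p q n k = (\<Sum>xs\<in>{xs \<in> free_meanders p n. final_alt xs = k}. weight p q xs)"
  unfolding mcoef_def free_meanders_def by (intro sum.cong) auto

lemma mcoef_0: "mcoef p q 0 k = (if k = 0 then 1 else 0)"
proof -
  have "{xs \<in> free_meanders p 0. final_alt xs = k} = (if k = 0 then {[]} else {})"
    by (auto simp: free_meanders_0 final_alt_def)
  thus ?thesis by (simp add: mcoef_alt)
qed

context
  fixes p :: "int \<Rightarrow> real" and c d :: int
  assumes supp: "\<forall>i. i < - c \<or> d < i \<longrightarrow> p i = 0"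
begin

lemma jumps_subset: "jumps p \<subseteq> {-c..d}"
  using supp by (force simp: jumps_def not_le)

lemma finite_jumps: "finite (jumps p)"
  using jumps_subset by (rule finite_subset) simp

lemma mcoef_eq_0: "k \<notin> {0..int n * d} \<Longrightarrow> mcoef p q n k = 0"
  unfolding mcoef_alt using jumps_subset free_meanders_final[of p d]
  by (intro sum.neutral) (auto simp: subset_iff)

lemma mcoef_Suc:
  assumes "k \<ge> 0"
  shows "mcoef p q (Suc n) k = (\<Sum>i\<in>{-c..d}. p i * mcoef p q n (k - i))"
proof -
  let ?A = "\<lambda>n k. {xs \<in> free_meanders p n. final_alt xs = k}"
  let ?S = "SIGMA i:jumps p. ?A n (k - i)"
  have bij: "bij_betw (\<lambda>(i, xs). xs @ [Jump i]) ?S (?A (Suc n) k)"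
    by (rule bij_betwI[where g = "\<lambda>ys. (case last ys of Jump i \<Rightarrow> (i, butlast ys) | Cat \<Rightarrow> undefined)"])
      (use assms in \<open>auto simp: free_meanders_Suc final_alt_snoc\<close>)
  have "mcoef p q (Suc n) k = (\<Sum>(i, xs)\<in>?S. weight p q xs * p i)"
    unfolding mcoef_alt by (subst sum.reindex_bij_betw[OF bij, symmetric])
      (simp add: weight_append split_beta)
  also have "\<dots> = (\<Sum>i\<in>jumps p. \<Sum>xs\<in>?A n (k - i). weight p q xs * p i)"
    by (rule sum.Sigma[symmetric]) (use finite_jumps finite_free_meanders[OF finite_jumps] in auto)
  also have "\<dots> = (\<Sum>i\<in>jumps p. p i * mcoef p q n (k - i))"
    by (simp add: mcoef_alt sum_distrib_left mult.commute)
  also have "\<dots> = (\<Sum>i\<in>{-c..d}. p i * mcoef p q n (k - i))"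
    by (rule sum.mono_neutral_left) (use jumps_subset in \<open>auto simp: jumps_def\<close>)
  finally show ?thesis .
qed

lemma mtot_eq: "mtot p q n = (\<Sum>k\<in>{0..int n * d}. mcoef p q n k)"
proof -
  have "mtot p q n = (\<Sum>xs\<in>free_meanders p n. weight p q xs)"
    by (simp add: mtot_def free_meanders_def)
  also have "\<dots> = (\<Sum>k\<in>{0..int n * d}. mcoef p q n k)"
    unfolding mcoef_alt
    by (rule sum.group[symmetric])
      (use finite_free_meanders[OF finite_jumps] jumps_subset free_meanders_final[of p d] in \<open>auto simp: subset_iff\<close>)
  finally show ?thesis .
qed

lemma mtot_eq': "N \<ge> int n * d \<Longrightarrow> mtot p q n = (\<Sum>k\<in>{0..N}. mcoef p q n k)"
  unfolding mtot_eq by (rule sum.mono_neutral_left) (auto intro: mcoef_eq_0)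

end

subsection \<open>Singular structure of the meander series\<close>

lemma summable_bounded_coeffs:
  fixes f :: "nat \<Rightarrow> complex"
  assumes "\<And>n. norm (f n) \<le> C" "norm x < 1"
  shows "summable (\<lambda>n. norm (f n * x ^ n))"
proof (rule summable_comparison_test')
  show "summable (\<lambda>n. C * norm x ^ n)" using assms(2) by (intro summable_mult summable_geometric) auto
  show "norm (norm (f n * x ^ n)) \<le> C * norm x ^ n" if "n \<ge> 0" for n
    using assms(1)[of n] by (simp add: norm_mult norm_power mult_right_mono)
qed

lemma power_series_deriv:
  fixes f :: "nat \<Rightarrow> complex"
  assumes "\<And>n. norm (f n) \<le> C" "norm x < 1"
  shows "((\<lambda>x. \<Sum>n. f n * x ^ n) has_field_derivative (\<Sum>n. of_nat (Suc n) * f (Suc n) * x ^ n)) (at x)"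
proof -
  have "((\<lambda>x. \<Sum>n. f n * x ^ n) has_field_derivative (\<Sum>n. diffs f n * x ^ n)) (at x)"
    using summable_bounded_coeffs[OF assms(1)] assms(2)
    by (intro termdiffs_strong'[of 1]) (auto intro: summable_norm_cancel)
  thus ?thesis by (simp add: diffs_def)
qed

lemma power_series_holomorphic_disc:
  fixes f :: "nat \<Rightarrow> complex"
  assumes "\<And>n. norm (f n) \<le> C"
  shows "(\<lambda>x. \<Sum>n. f n * x ^ n) holomorphic_on ball 0 1"
  using power_series_deriv[OF assms] by (subst holomorphic_on_open) (auto intro!: exI)

lemma const_on_disc:
  assumes "\<And>x. norm x < 1 \<Longrightarrow> (f has_field_derivative 0) (at x)"
  obtains K where "\<And>x::complex. norm x < 1 \<Longrightarrow> f x = (K::complex)"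
proof -
  have "\<exists>K. \<forall>x\<in>ball 0 1. f x = K"
    using assms by (intro has_field_derivative_zero_constant) (auto intro: has_field_derivative_at_within)
  thus ?thesis using that by auto
qed

context centred_walk
begin

lemma step_count_bounds: "0 \<le> step_count c d a n j" "step_count c d a n j \<le> 1"
proof (induction n arbitrary: j)
  case (Suc n)
  { case 1 show ?case using Suc(1) a_nonneg by (auto intro!: sum_nonneg mult_nonneg_nonneg) }
  { case 2
    have "step_count c d a (Suc n) j \<le> (\<Sum>i\<in>{-c..d}. a i * 1)"
      unfolding step_count.simps using Suc(2) a_nonneg by (intro sum_mono mult_left_mono) auto
    thus ?case by (simp add: a_sum) }
qed auto

end

text \<open>Here \<open>m n k\<close> is the probability that the normalised walk stays nonnegative
  for n steps and ends at k; hence the bounds 0 and 1.\<close>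

locale centred_meanders = centred_walk +
  fixes m :: "nat \<Rightarrow> int \<Rightarrow> real"
  assumes m0: "m 0 k = (if k = 0 then 1 else 0)"
    and mneg: "k < 0 \<Longrightarrow> m n k = 0"
    and mSuc: "k \<ge> 0 \<Longrightarrow> m (Suc n) k = (\<Sum>i\<in>{-c..d}. a i * m n (k - i))"
begin

lemma m_bounds: "0 \<le> m n k" "m n k \<le> 1"
proof (induction n arbitrary: k)
  case (Suc n)
  { case 1 show ?case using Suc(1) a_nonneg
      by (cases "k < 0") (auto simp: mneg mSuc intro!: sum_nonneg mult_nonneg_nonneg) }
  { case 2
    have "m (Suc n) k \<le> (\<Sum>i\<in>{-c..d}. a i * 1)" if "k \<ge> 0"
      unfolding mSuc[OF that] using Suc(2) a_nonneg by (intro sum_mono mult_left_mono) auto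
    thus ?case by (cases "k < 0") (auto simp: mneg a_sum) }
qed (auto simp: m0)

definition Mf :: "int \<Rightarrow> complex \<Rightarrow> complex" where
  "Mf k x = (\<Sum>n. of_real (m n k) * x ^ n)"

lemma Mf_sums:
  assumes "norm x < 1"
  shows "(\<lambda>n. of_real (m n k) * x ^ n) sums Mf k x"
  unfolding Mf_def
  by (intro summable_sums summable_norm_cancel[OF summable_bounded_coeffs[of _ 1]] assms) (use m_bounds in auto)

text \<open>\<open>spitzer_recurrence\<close> at \<open>Suc n\<close>, multiplied by x^n and summed;
  the sum over l is a Cauchy product. The equations form a triangular linear system in k whose
  diagonal entries are all \<open>C 0\<close>.\<close>

lemma Mf_deriv:
  assumes C: "\<And>j. (\<lambda>l. of_real (step_count c d a (Suc l) j) * x ^ l) sums C j" and x: "norm x < 1" and "k \<ge> 0"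
  shows "(Mf k has_field_derivative (\<Sum>j\<in>{0..k}. C j * Mf (k - j) x)) (at x)"
proof -
  have "(\<lambda>n. \<Sum>i\<le>n. (of_real (step_count c d a (Suc i) j) * x ^ i) * (of_real (m (n - i) (k - j)) * x ^ (n - i))) sums
      ((\<Sum>l. of_real (step_count c d a (Suc l) j) * x ^ l) * (\<Sum>n. of_real (m n (k - j)) * x ^ n))" for j
    by (intro Cauchy_product_sums summable_bounded_coeffs[of _ 1] x)
      (use m_bounds step_count_bounds in \<open>auto simp del: step_count.simps\<close>)
  hence "(\<lambda>n. \<Sum>i\<le>n. (of_real (step_count c d a (Suc i) j) * x ^ i) * (of_real (m (n - i) (k - j)) * x ^ (n - i))) sums
      (C j * Mf (k - j) x)" for j
    using C[of j] by (simp add: sums_iff Mf_def del: step_count.simps)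
  hence "(\<lambda>n. \<Sum>j\<in>{0..k}. \<Sum>i\<le>n. (of_real (step_count c d a (Suc i) j) * x ^ i) * (of_real (m (n - i) (k - j)) * x ^ (n - i))) sums
      (\<Sum>j\<in>{0..k}. C j * Mf (k - j) x)" by (intro sums_sum)
  also have "(\<lambda>n. \<Sum>j\<in>{0..k}. \<Sum>i\<le>n. (of_real (step_count c d a (Suc i) j) * x ^ i) * (of_real (m (n - i) (k - j)) * x ^ (n - i))) =
      (\<lambda>n. of_nat (Suc n) * of_real (m (Suc n) k) * x ^ n)"
  proof
    fix n
    have "real (Suc n) * m (Suc n) k = (\<Sum>l\<in>{1..Suc n}. \<Sum>j\<in>{0..k}. step_count c d a l j * m (Suc n - l) (k - j))"
      by (rule spitzer_recurrence) (use assms in \<open>auto simp: m0 mneg mSuc\<close>)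
    also have "\<dots> = (\<Sum>i\<le>n. \<Sum>j\<in>{0..k}. step_count c d a (Suc i) j * m (n - i) (k - j))"
      by (rule sum.reindex_bij_witness[of _ Suc "\<lambda>l. l - 1"]) auto
    finally have "complex_of_real (real (Suc n) * m (Suc n) k) =
        (\<Sum>i\<le>n. \<Sum>j\<in>{0..k}. of_real (step_count c d a (Suc i) j) * of_real (m (n - i) (k - j)))"
      by (simp del: step_count.simps of_nat_Suc)
    hence "of_nat (Suc n) * of_real (m (Suc n) k) * x ^ n =
        (\<Sum>i\<le>n. \<Sum>j\<in>{0..k}. of_real (step_count c d a (Suc i) j) * of_real (m (n - i) (k - j)) * x ^ n)"
      by (simp add: sum_distrib_right del: step_count.simps of_nat_Suc)
    also have "\<dots> = (\<Sum>i\<le>n. \<Sum>j\<in>{0..k}. (of_real (step_count c d a (Suc i) j) * x ^ i) * (of_real (m (n - i) (k - j)) * x ^ (n - i)))"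
    proof (intro sum.cong refl)
      fix i j assume "i \<in> {..n}"
      hence "x ^ n = x ^ i * x ^ (n - i)" by (simp flip: power_add)
      thus "of_real (step_count c d a (Suc i) j) * of_real (m (n - i) (k - j)) * x ^ n =
          (of_real (step_count c d a (Suc i) j) * x ^ i) * (of_real (m (n - i) (k - j)) * x ^ (n - i))"
        by (simp add: mult_ac del: step_count.simps)
    qed
    also have "\<dots> = (\<Sum>j\<in>{0..k}. \<Sum>i\<le>n. (of_real (step_count c d a (Suc i) j) * x ^ i) * (of_real (m (n - i) (k - j)) * x ^ (n - i)))"
      by (rule sum.swap)
    finally show "(\<Sum>j\<in>{0..k}. \<Sum>i\<le>n. (of_real (step_count c d a (Suc i) j) * x ^ i) * (of_real (m (n - i) (k - j)) * x ^ (n - i))) =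
      of_nat (Suc n) * of_real (m (Suc n) k) * x ^ n" ..
  qed
  finally have "(\<Sum>n. of_nat (Suc n) * of_real (m (Suc n) k) * x ^ n) = (\<Sum>j\<in>{0..k}. C j * Mf (k - j) x)"
    by (simp add: sums_iff)
  moreover have "((\<lambda>x. \<Sum>n. of_real (m n k) * x ^ n) has_field_derivative
      (\<Sum>n. of_nat (Suc n) * of_real (m (Suc n) k) * x ^ n)) (at x)"
    by (rule power_series_deriv[of _ 1]) (use m_bounds x in auto)
  ultimately show ?thesis by (simp add: Mf_def[abs_def])
qed

text \<open>The diagonal coefficient of the system is removed by the integrating factor exp (-W).
  Then \<open>Y\<close> 0 is constant and each further \<open>Y\<close> k is a primitive of
  functions already known. The factor 1/s is harmless because dx = -2 s ds. So \<open>G\<close> 0 is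
  a nonzero constant times exp V with V'(0) = -2 H_0(0) = -kappa.\<close>

theorem meander_singularity:
  obtains G where "\<And>k. k \<ge> 0 \<Longrightarrow> G k analytic_on lobe"
    "\<And>k x. k \<ge> 0 \<Longrightarrow> norm x < 1 \<Longrightarrow> Mf k x = G k (csqrt (1 - x))"
    "deriv (G 0) 0 = - of_real kappa * G 0 0" "G 0 0 \<noteq> 0"
proof -
  let ?s = "\<lambda>x. csqrt (1 - x)"
  have "\<forall>j. \<exists>H. H analytic_on lobe \<and> H 0 = of_real (kappa / 2) \<and>
    (\<forall>x. norm x < 1 \<longrightarrow> (\<lambda>l. of_real (step_count c d a (Suc l) j) * x ^ l) sums (H (?s x) / ?s x))"
    using step_count_singularity by metis
  then obtain H where H: "\<And>j. H j analytic_on lobe" "\<And>j. H j 0 = of_real (kappa / 2)"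
    "\<And>j x. norm x < 1 \<Longrightarrow> (\<lambda>l. of_real (step_count c d a (Suc l) j) * x ^ l) sums (H j (?s x) / ?s x)"
    by metis
  have Md: "(Mf k has_field_derivative (\<Sum>j\<in>{0..k}. H j (?s x) / ?s x * Mf (k - j) x)) (at x)"
    if "norm x < 1" "k \<ge> 0" for k x
    using H(3)[OF that(1)] that by (rule Mf_deriv)
  \<comment> \<open>A primitive in s of -2 H is, as a function of x, a primitive of H / s.\<close>
  have "(\<lambda>s. - 2 * H 0 s) analytic_on lobe" by (intro analytic_intros H)
  then obtain V where V: "V analytic_on lobe" "\<And>s. s \<in> lobe \<Longrightarrow> (V has_field_derivative - 2 * H 0 s) (at s)"
    using analytic_lobe_primitive by blast
  define W where "W = (\<lambda>x. V (?s x))"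
  have Wd: "(W has_field_derivative H 0 (?s x) / ?s x) (at x)" if x: "norm x < 1" for x
  proof -
    have "?s x \<in> lobe" using x by (intro csqrt_in_lobe) auto
    from csqrt_comp_deriv[OF x V(2)[OF this]] show ?thesis by (simp add: W_def)
  qed
  define Y where "Y = (\<lambda>k x. Mf k x * exp (- W x))"
  have Yd: "(Y k has_field_derivative (\<Sum>j\<in>{1..k}. H j (?s x) * Y (k - j) x) / ?s x) (at x)"
    if x: "norm x < 1" and k: "k \<ge> 0" for k x
  proof -
    have 1: "(Y k has_field_derivative (\<Sum>j\<in>{0..k}. H j (?s x) / ?s x * Mf (k - j) x) * exp (- W x)
        + Mf k x * (exp (- W x) * - (H 0 (?s x) / ?s x))) (at x)"
      unfolding Y_def by (rule derivative_eq_intros Md[OF that] Wd[OF x] refl)+ (simp add: mult_ac)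
    have "{0..k} = insert 0 {1..k}" using k by auto
    hence 2: "(\<Sum>j\<in>{0..k}. H j (?s x) / ?s x * Mf (k - j) x) =
        H 0 (?s x) / ?s x * Mf k x + (\<Sum>j\<in>{1..k}. H j (?s x) / ?s x * Mf (k - j) x)" by simp
    show ?thesis
      by (rule DERIV_cong[OF 1], unfold 2) (simp add: Y_def algebra_simps sum_distrib_left sum_distrib_right sum_divide_distrib)
  qed
  have ex: "\<exists>y. y analytic_on lobe \<and> (\<forall>x. norm x < 1 \<longrightarrow> Y (int k) x = y (?s x))" for k
  proof (induction k rule: less_induct)
    case (less k)
    have "\<forall>j\<in>{1..int k}. \<exists>y. y analytic_on lobe \<and> (\<forall>x. norm x < 1 \<longrightarrow> Y (int k - j) x = y (?s x))"
    proof
      fix j assume "j \<in> {1..int k}"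
      hence "int (nat (int k - j)) = int k - j" "nat (int k - j) < k" by auto
      thus "\<exists>y. y analytic_on lobe \<and> (\<forall>x. norm x < 1 \<longrightarrow> Y (int k - j) x = y (?s x))"
        using less[of "nat (int k - j)"] by metis
    qed
    then obtain y where y: "\<And>j. j \<in> {1..int k} \<Longrightarrow> y j analytic_on lobe"
      "\<And>j x. j \<in> {1..int k} \<Longrightarrow> norm x < 1 \<Longrightarrow> Y (int k - j) x = y j (?s x)"
      by metis
    have "(\<lambda>s. - 2 * (\<Sum>j\<in>{1..int k}. H j s * y j s)) analytic_on lobe"
      using y H by (intro analytic_intros) auto
    then obtain z where z: "z analytic_on lobe"
      "\<And>s. s \<in> lobe \<Longrightarrow> (z has_field_derivative - 2 * (\<Sum>j\<in>{1..int k}. H j s * y j s)) (at s)"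
      using analytic_lobe_primitive by blast
    have zd: "((\<lambda>x. z (?s x)) has_field_derivative (\<Sum>j\<in>{1..int k}. H j (?s x) * Y (int k - j) x) / ?s x) (at x)"
      if x: "norm x < 1" for x
    proof -
      have "?s x \<in> lobe" using x by (intro csqrt_in_lobe) auto
      from csqrt_comp_deriv[OF x z(2)[OF this]] show ?thesis using y(2)[OF _ x] by simp
    qed
    have "((\<lambda>x. Y (int k) x - z (?s x)) has_field_derivative 0) (at x)" if x: "norm x < 1" for x
      using DERIV_diff[OF Yd[OF x, of "int k"] zd[OF x]] by simp
    then obtain K where K: "\<And>x. norm x < 1 \<Longrightarrow> Y (int k) x - z (?s x) = K"
      using const_on_disc by blast
    have "(\<lambda>s. z s + K) analytic_on lobe" by (intro analytic_intros z)
    moreover have "\<forall>x. norm x < 1 \<longrightarrow> Y (int k) x = z (?s x) + K" using K by (auto simp: algebra_simps)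
    ultimately show ?case by blast
  qed
  have "((\<lambda>x. Y 0 x) has_field_derivative 0) (at x)" if "norm x < 1" for x
    using Yd[OF that, of 0] by simp
  then obtain K where K: "\<And>x. norm x < 1 \<Longrightarrow> Y 0 x = K" using const_on_disc by blast
  have "Mf 0 0 = 1"
  proof -
    have "(\<lambda>n. of_real (m n 0) * (0::complex) ^ n) sums of_real (m 0 0)" by (rule powser_sums_zero)
    thus ?thesis by (simp add: Mf_def sums_iff m0)
  qed
  hence K0: "K \<noteq> 0" using K[of 0] by (auto simp: Y_def)
  have "\<forall>k\<ge>0. \<exists>y. y analytic_on lobe \<and> (\<forall>x. norm x < 1 \<longrightarrow> Y k x = y (?s x))"
    using ex by (metis nonneg_int_cases)
  then obtain y where y: "\<And>k. k \<ge> 0 \<Longrightarrow> y k analytic_on lobe"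
    "\<And>k x. k \<ge> 0 \<Longrightarrow> norm x < 1 \<Longrightarrow> Y k x = y k (?s x)" by metis
  define G where "G = (\<lambda>k s. (if k = 0 then K else y k s) * exp (V s))"
  show ?thesis
  proof (rule that[of G])
    show "G k analytic_on lobe" if "k \<ge> 0" for k
      unfolding G_def using y(1)[OF that] V(1) by (cases "k = 0") (auto intro!: analytic_intros)
    show "Mf k x = G k (?s x)" if "k \<ge> 0" "norm x < 1" for k x
    proof -
      have "Mf k x = Y k x * exp (W x)" by (simp add: Y_def mult.assoc flip: exp_add)
      also have "Y k x = (if k = 0 then K else y k (?s x))" using K y(2) that by auto
      finally show ?thesis by (simp add: G_def W_def)
    qed
    have "(G 0 has_field_derivative K * (exp (V 0) * (- 2 * H 0 0))) (at 0)"
      unfolding G_def by (auto intro!: derivative_eq_intros V(2))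
    hence "deriv (G 0) 0 = K * (exp (V 0) * (- 2 * H 0 0))" by (rule DERIV_imp_deriv)
    thus "deriv (G 0) 0 = - of_real kappa * G 0 0" by (simp add: G_def H(2))
    show "G 0 0 \<noteq> 0" using K0 by (simp add: G_def)
  qed
qed

text \<open>The recurrence gives (1 - B x) T(x) = N(s) with \<open>N\<close> analytic in s, so T
  could be singular elsewhere only at x = 1/B. Boundedness of \<open>t\<close> makes T analytic in
  the open disc, and B different from 1 keeps 1/B off the unit circle.\<close>

theorem total_singularity:
  fixes t :: "nat \<Rightarrow> real" and B :: real and r :: "int \<Rightarrow> real" and I :: "int set"
  assumes t0: "t 0 = 1" and tSuc: "\<And>n. t (Suc n) = B * t n - (\<Sum>k\<in>I. r k * m n k)"
    and bound: "\<And>n. \<bar>t n\<bar> \<le> C" and B: "B > 0" "B \<noteq> 1" and I: "finite I" "\<And>k. k \<in> I \<Longrightarrow> k \<ge> 0"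
  obtains G where "G analytic_on lobe"
    "\<And>x. norm x < 1 \<Longrightarrow> (\<lambda>n. of_real (t n) * x ^ n) sums G (csqrt (1 - x))"
proof -
  obtain G where G: "\<And>k. k \<ge> 0 \<Longrightarrow> G k analytic_on lobe"
    "\<And>k x. k \<ge> 0 \<Longrightarrow> norm x < 1 \<Longrightarrow> Mf k x = G k (csqrt (1 - x))"
    using meander_singularity by metis
  define Tf where "Tf = (\<lambda>x. \<Sum>n. complex_of_real (t n) * x ^ n)"
  have Tsums: "(\<lambda>n. of_real (t n) * x ^ n) sums Tf x" if "norm x < 1" for x :: complex
    unfolding Tf_def using bound
    by (intro summable_sums summable_norm_cancel[OF summable_bounded_coeffs[of _ C]] that) auto
  have holT: "Tf holomorphic_on ball 0 1"
    unfolding Tf_def using bound by (intro power_series_holomorphic_disc[of _ C]) auto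
  define N where "N = (\<lambda>s. 1 - (1 - s\<^sup>2) * (\<Sum>k\<in>I. of_real (r k) * G k s))"
  have anN: "N analytic_on lobe" unfolding N_def by (intro analytic_intros G I)
  have feq: "(1 - of_real B * x) * Tf x = N (csqrt (1 - x))" if x: "norm x < 1" for x
  proof -
    have "(\<lambda>n. of_real (t (Suc n)) * x ^ Suc n) sums (Tf x - of_real (t 0) * x ^ 0)"
      by (subst sums_Suc_iff) (use Tsums[OF x] in simp)
    moreover have "(\<lambda>n. x * (of_real B * (of_real (t n) * x ^ n) - (\<Sum>k\<in>I. of_real (r k) * (of_real (m n k) * x ^ n)))) sums
        (x * (of_real B * Tf x - (\<Sum>k\<in>I. of_real (r k) * Mf k x)))"
      by (intro sums_mult sums_diff sums_sum Tsums Mf_sums x)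
    moreover have "(\<lambda>n. x * (of_real B * (of_real (t n) * x ^ n) - (\<Sum>k\<in>I. of_real (r k) * (of_real (m n k) * x ^ n)))) =
        (\<lambda>n. of_real (t (Suc n)) * x ^ Suc n)"
      by (simp add: fun_eq_iff tSuc algebra_simps sum_distrib_left sum_distrib_right)
    ultimately have "Tf x - 1 = x * (of_real B * Tf x - (\<Sum>k\<in>I. of_real (r k) * Mf k x))"
      using t0 sums_unique2 by auto
    moreover have "(\<Sum>k\<in>I. of_real (r k) * Mf k x) = (\<Sum>k\<in>I. of_real (r k) * G k (csqrt (1 - x)))"
      using I G(2) x by (intro sum.cong) auto
    ultimately show ?thesis by (simp add: N_def algebra_simps)
  qed
  define L where "L = {s. Re s > 0 \<and> norm (1 - s\<^sup>2) < 1}"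
  have "open L" unfolding L_def by (intro open_Collect_conj open_Collect_less continuous_intros)
  \<comment> \<open>Inside the disc the series itself is used, because for B > 1 the quotient is
    undefined at the interior point x = 1/B; the quotient only serves on the boundary.\<close>
  define F where "F = (\<lambda>s. if s \<in> L then Tf (1 - s\<^sup>2) else N s / (1 - of_real B * (1 - s\<^sup>2)))"
  have "F analytic_on {s}" if s: "s \<in> lobe" for s
  proof (cases "s \<in> L")
    case True
    have "(\<lambda>s. Tf (1 - s\<^sup>2)) holomorphic_on L"
      by (intro holomorphic_on_compose_gen[OF _ holT, unfolded o_def] holomorphic_intros) (auto simp: L_def)
    hence "F holomorphic_on L" by (rule holomorphic_transform) (simp add: F_def)
    thus ?thesis using True \<open>open L\<close> analytic_at by blast
  next
    case False
    have nz: "1 - of_real B * (1 - s\<^sup>2) \<noteq> 0"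
    proof
      assume "1 - of_real B * (1 - s\<^sup>2) = 0"
      hence "of_real B * (1 - s\<^sup>2) = 1" by simp
      hence "B * norm (1 - s\<^sup>2) = 1" using B(1) by (metis abs_of_pos norm_mult norm_of_real norm_one)
      moreover have "norm (1 - s\<^sup>2) = 1"
      proof (cases "s = 0")
        case f: False
        thus ?thesis using s False lobe_Re_pos[OF s f] by (auto simp: L_def lobe_def)
      qed simp
      ultimately show False using B by simp
    qed
    have "N analytic_on {s}" using anN s analytic_on_subset by blast
    hence an: "(\<lambda>s. N s / (1 - of_real B * (1 - s\<^sup>2))) analytic_on {s}"
      using nz by (intro analytic_intros) auto
    have "\<forall>\<^sub>F y in nhds s. 1 - of_real B * (1 - y\<^sup>2) \<noteq> 0"
      using nz by (intro tendsto_imp_eventually_ne[of _ "1 - of_real B * (1 - s\<^sup>2)"] tendsto_intros filterlim_ident) auto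
    hence "\<forall>\<^sub>F y in nhds s. N y / (1 - of_real B * (1 - y\<^sup>2)) = F y"
    proof eventually_elim
      case (elim y)
      show ?case
      proof (cases "y \<in> L")
        case True
        hence "csqrt (y\<^sup>2) = y" by (intro csqrt_square) (auto simp: L_def)
        thus ?thesis using feq[of "1 - y\<^sup>2"] True elim by (simp add: F_def L_def field_simps)
      qed (simp add: F_def)
    qed
    from iffD1[OF analytic_at_cong[OF this refl] an] show ?thesis .
  qed
  hence "F analytic_on lobe" using analytic_on_analytic_at by blast
  moreover have "(\<lambda>n. of_real (t n) * x ^ n) sums F (csqrt (1 - x))" if "norm x < 1" for x
    using Tsums[OF that] csqrt_disc(3,4)[OF that] by (simp add: F_def L_def)
  ultimately show ?thesis using that by blast
qed

end

subsection \<open>The saddle point and the normalised walk\<close>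

locale catastrophe_model =
  fixes c d :: int and p :: "int \<Rightarrow> real" and q :: real
  assumes c_ge: "1 \<le> c" and d_ge: "1 \<le> d"
    and p_nonneg: "0 \<le> p i"
    and p_supp: "\<forall>i. i < - c \<or> d < i \<longrightarrow> p i = 0"
    and p_left: "p (- c) \<noteq> 0" and p_right: "p d \<noteq> 0"
    and q_pos: "0 < q"
    and aper: "aperiodic c d p"
begin

lemma p_left_pos: "p (-c) > 0" and p_right_pos: "p d > 0"
  using p_left p_right p_nonneg[of "-c"] p_nonneg[of d] by auto

abbreviation Pr :: "real \<Rightarrow> real" where "Pr \<equiv> Ppoly c d p"

definition dPr :: "real \<Rightarrow> real" where
  "dPr u = (\<Sum>i\<in>{-c..d}. p i * (of_int i * u powi (i - 1)))"

definition ddPr :: "real \<Rightarrow> real" where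
  "ddPr u = (\<Sum>i\<in>{-c..d}. p i * (of_int i * (of_int (i - 1) * u powi (i - 2))))"

lemma DERIV_Pr: "u \<noteq> 0 \<Longrightarrow> (Pr has_real_derivative dPr u) (at u)"
  unfolding Ppoly_def[abs_def] dPr_def
  by (rule DERIV_sum) (auto intro!: derivative_eq_intros)

lemma DERIV_dPr: "u \<noteq> 0 \<Longrightarrow> (dPr has_real_derivative ddPr u) (at u)"
  unfolding dPr_def[abs_def] ddPr_def
  by (rule DERIV_sum) (auto intro!: derivative_eq_intros)

lemma ddPr_pos:
  assumes "u > 0"
  shows "ddPr u > 0"
  unfolding ddPr_def
proof (rule sum_pos2[of _ "-c"])
  have nn: "0 \<le> real_of_int i * (real_of_int (i - 1) * u powi (i - 2))" for i
  proof -
    have "(0::int) \<le> i * (i - 1)" by (cases "i \<le> 0") (auto intro: mult_nonpos_nonpos)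
    hence "0 \<le> real_of_int (i * (i - 1)) * u powi (i - 2)"
      using assms by (intro mult_nonneg_nonneg) (auto simp only: of_int_0_le_iff intro: zero_le_power_int less_imp_le)
    thus ?thesis by (simp add: mult.assoc)
  qed
  have "real_of_int (-c) * (real_of_int (-c - 1) * u powi (-c - 2)) \<noteq> 0"
    using assms c_ge by simp
  hence "0 < real_of_int (-c) * (real_of_int (-c - 1) * u powi (-c - 2))"
    using nn[of "-c"] by linarith
  thus "0 < p (-c) * (real_of_int (-c) * (real_of_int (-c - 1) * u powi (-c - 2)))"
    using p_left_pos by (rule mult_pos_pos[rotated])
  show "0 \<le> p i * (real_of_int i * (real_of_int (i - 1) * u powi (i - 2)))" for i
    using p_nonneg nn by (rule mult_nonneg_nonneg)
qed (use c_ge d_ge in auto)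

lemma dPr_strict_mono:
  assumes "0 < u" "u < v"
  shows "dPr u < dPr v"
proof (rule DERIV_pos_imp_increasing[OF assms(2)])
  fix x assume "u \<le> x" "x \<le> v"
  thus "\<exists>y. (dPr has_real_derivative y) (at x) \<and> 0 < y"
    using DERIV_dPr[of x] ddPr_pos[of x] assms by auto
qed

text \<open>The sign of u P'(u) is governed by the term of exponent d for large u and of exponent -c
  for small u. All other terms are bounded through \<open>S\<close>, and the intermediate value
  theorem applies.\<close>

lemma dPr_root: "\<exists>t>0. dPr t = 0"
proof -
  define S where "S = (\<Sum>i\<in>{-c..d}. p i * \<bar>of_int i\<bar>)"
  have S: "S \<ge> 0" unfolding S_def by (intro sum_nonneg mult_nonneg_nonneg p_nonneg) auto
  have split: "u * dPr u = (\<Sum>i\<in>{-c..d}. p i * of_int i * u powi i)" if "u > 0" for u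
    unfolding dPr_def sum_distrib_left using that
    by (intro sum.cong refl) (simp add: power_int_diff field_simps)
  have large: "dPr u > 0" if u: "u > 1" "u > S / p d" for u
  proof -
    have "(\<Sum>i\<in>{-c..d} - {d}. p i * of_int i * u powi i) \<ge> (\<Sum>i\<in>{-c..d} - {d}. - (p i * \<bar>of_int i\<bar>))"
    proof (rule sum_mono)
      fix i assume "i \<in> {-c..d} - {d}"
      show "- (p i * \<bar>of_int i\<bar>) \<le> p i * of_int i * u powi i"
      proof (cases "i \<ge> 0")
        case True
        hence "0 \<le> p i * of_int i * u powi i" using u p_nonneg by (intro mult_nonneg_nonneg zero_le_power_int) auto
        moreover have "- (p i * \<bar>of_int i\<bar>) \<le> 0" using p_nonneg[of i] by simp
        ultimately show ?thesis by linarith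
      next
        case False
        have "u powi i \<le> 1" using False u power_int_increasing[of i 0 u] by simp
        hence "p i * \<bar>of_int i\<bar> * u powi i \<le> p i * \<bar>of_int i\<bar> * 1" using p_nonneg by (intro mult_left_mono) auto
        thus ?thesis using False by simp
      qed
    qed
    also have "(\<Sum>i\<in>{-c..d} - {d}. - (p i * \<bar>real_of_int i\<bar>)) \<ge> - S"
      unfolding S_def sum_negf neg_le_iff_le using p_nonneg by (intro sum_mono2) auto
    finally have "(\<Sum>i\<in>{-c..d} - {d}. p i * of_int i * u powi i) \<ge> - S" by simp
    moreover have "p d * of_int d * u powi d \<ge> p d * 1 * u"
      using u d_ge p_right_pos power_int_increasing[of 1 d u]
      by (intro mult_mono) auto
    moreover have "p d * u > S" using u p_right_pos by (simp add: field_simps)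
    moreover have "u * dPr u = p d * of_int d * u powi d + (\<Sum>i\<in>{-c..d} - {d}. p i * of_int i * u powi i)"
      using split[of u] u c_ge d_ge sum.remove[of "{-c..d}" d "\<lambda>i. p i * of_int i * u powi i"] by simp
    ultimately have "u * dPr u > 0" by simp
    thus ?thesis using u by (simp add: zero_less_mult_iff)
  qed
  have small: "dPr u < 0" if u: "0 < u" "u < 1" "u * S < p (-c)" for u
  proof -
    have "(\<Sum>i\<in>{-c..d} - {-c}. p i * of_int i * u powi i) \<le> (\<Sum>i\<in>{-c..d} - {-c}. p i * \<bar>of_int i\<bar> * u)"
    proof (rule sum_mono)
      fix i assume "i \<in> {-c..d} - {-c}"
      show "p i * of_int i * u powi i \<le> p i * \<bar>of_int i\<bar> * u"
      proof (cases "i \<ge> 1")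
        case True
        hence "u powi i \<le> u powi 1" using u by (intro power_int_decreasing) auto
        thus ?thesis using True p_nonneg by (auto intro!: mult_left_mono)
      next
        case False
        have neg: "p i * of_int i \<le> 0" using False p_nonneg[of i] by (intro mult_nonneg_nonpos) auto
        have "p i * of_int i * u powi i \<le> 0"
          by (rule mult_nonpos_nonneg[OF neg zero_le_power_int]) (use u in simp)
        moreover have "0 \<le> p i * \<bar>of_int i\<bar> * u" using p_nonneg[of i] u by simp
        ultimately show ?thesis by linarith
      qed
    qed
    also have "\<dots> = (\<Sum>i\<in>{-c..d} - {-c}. p i * \<bar>of_int i\<bar>) * u" by (simp add: sum_distrib_right)
    also have "\<dots> \<le> S * u"
      unfolding S_def using u p_nonneg by (intro mult_right_mono sum_mono2) auto
    finally have "(\<Sum>i\<in>{-c..d} - {-c}. p i * of_int i * u powi i) \<le> S * u" .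
    moreover have "p (-c) * of_int (-c) * u powi (-c) \<le> - p (-c)"
    proof -
      have "u powi 0 \<le> u powi (-c)" using u c_ge by (intro power_int_decreasing) auto
      hence "1 \<le> of_int c * u powi (-c)" using c_ge mult_mono[of 1 "real_of_int c" 1 "u powi (-c)"] by simp
      hence "p (-c) * 1 \<le> p (-c) * (of_int c * u powi (-c))" using p_left_pos by (intro mult_left_mono) auto
      thus ?thesis by simp
    qed
    moreover have "u * dPr u = p (-c) * of_int (-c) * u powi (-c) + (\<Sum>i\<in>{-c..d} - {-c}. p i * of_int i * u powi i)"
      using split[of u] u c_ge d_ge sum.remove[of "{-c..d}" "-c" "\<lambda>i. p i * of_int i * u powi i"] by simp
    ultimately have "u * dPr u < 0" using u by (simp add: mult.commute)
    thus ?thesis using u by (simp add: mult_less_0_iff)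
  qed
  define u where "u = min (1/2) (p (-c) / (2 * (S + 1)))"
  define v where "v = max 2 (S / p d + 1)"
  have "u > 0" using p_left_pos S by (simp add: u_def)
  have "u * S \<le> p (-c) / (2 * (S + 1)) * S" using S by (intro mult_right_mono) (auto simp: u_def)
  also have "\<dots> < p (-c)"
  proof -
    have "p (-c) * S < p (-c) * (2 * (S + 1))" using p_left_pos S by (intro mult_strict_left_mono) auto
    thus ?thesis using S by (simp add: field_simps)
  qed
  finally have "dPr u < 0" using \<open>u > 0\<close> by (intro small) (auto simp: u_def)
  moreover have "dPr v > 0" by (intro large) (auto simp: v_def)
  moreover have "u \<le> v" by (auto simp: u_def v_def)
  moreover have "continuous_on {u..v} dPr"
    using \<open>u > 0\<close> by (intro continuous_at_imp_continuous_on ballI DERIV_isCont[OF DERIV_dPr]) auto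
  ultimately obtain t where "u \<le> t" "dPr t = 0" using IVT'[of dPr u 0 v] by auto
  thus ?thesis using \<open>u > 0\<close> by (intro exI[of _ t]) auto
qed

abbreviation \<tau> :: real where "\<tau> \<equiv> tau c d p"
abbreviation \<rho> :: real where "\<rho> \<equiv> rho c d p"

lemma tau_pos: "\<tau> > 0" and dPr_tau: "dPr \<tau> = 0"
proof -
  obtain t where t: "t > 0" "dPr t = 0" using dPr_root by blast
  have D: "deriv Pr s = dPr s" if "s > 0" for s
    using DERIV_Pr[of s] that by (intro DERIV_imp_deriv) auto
  have uniq: "s = t" if "s > 0" "dPr s = 0" for s
    using that t dPr_strict_mono[of s t] dPr_strict_mono[of t s] by (cases s t rule: linorder_cases) auto
  have "\<tau> = t"
    unfolding tau_def
  proof (rule the_equality)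
    show "0 < t \<and> deriv Pr t = 0 \<and> (\<forall>s. 0 < s \<and> deriv Pr s = 0 \<longrightarrow> t \<le> s)"
    proof (intro conjI allI impI)
      show "t \<le> s" if "0 < s \<and> deriv Pr s = 0" for s using uniq[of s] D[of s] that by simp
    qed (use t D[of t] in simp_all)
    show "s = t" if "0 < s \<and> deriv Pr s = 0 \<and> (\<forall>r. 0 < r \<and> deriv Pr r = 0 \<longrightarrow> s \<le> r)" for s
      using uniq[of s] D[of s] that by simp
  qed
  thus "\<tau> > 0" "dPr \<tau> = 0" using t by auto
qed

lemma deriv2_Pr_tau: "deriv (deriv Pr) \<tau> = ddPr \<tau>"
proof (rule DERIV_imp_deriv)
  show "(deriv Pr has_real_derivative ddPr \<tau>) (at \<tau>)"
  proof (rule has_field_derivative_transform_within_open)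
    show "(dPr has_real_derivative ddPr \<tau>) (at \<tau>)" using tau_pos by (intro DERIV_dPr) auto
    show "\<tau> \<in> {0<..}" using tau_pos by simp
    show "dPr x = deriv Pr x" if "x \<in> {0<..}" for x
      using DERIV_Pr[of x] that by (intro DERIV_imp_deriv[symmetric]) auto
  qed auto
qed

lemma Pr_pos: "u > 0 \<Longrightarrow> Pr u > 0"
  unfolding Ppoly_def using c_ge d_ge p_left_pos p_nonneg
  by (intro sum_pos2[of _ "-c"]) (auto intro!: mult_nonneg_nonneg zero_le_power_int)

lemma rho_pos: "\<rho> > 0" and rho_Pr: "\<rho> * Pr \<tau> = 1"
  using Pr_pos[OF tau_pos] by (auto simp: rho_def)

lemma Pr_gt_tau:
  assumes "u > 0" "u \<noteq> \<tau>"
  shows "Pr u > Pr \<tau>"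
proof (cases "u > \<tau>")
  case True
  show ?thesis
  proof (rule DERIV_pos_imp_increasing_open[OF True])
    fix x assume "\<tau> < x" "x < u"
    thus "\<exists>y. (Pr has_real_derivative y) (at x) \<and> 0 < y"
      using DERIV_Pr[of x] dPr_strict_mono[of \<tau> x] tau_pos dPr_tau by auto
  qed (use tau_pos in \<open>auto intro!: continuous_at_imp_continuous_on DERIV_isCont[OF DERIV_Pr]\<close>)
next
  case False
  hence "u < \<tau>" using assms by simp
  thus ?thesis
  proof (rule DERIV_neg_imp_decreasing_open)
    fix x assume "u < x" "x < \<tau>"
    thus "\<exists>y. (Pr has_real_derivative y) (at x) \<and> y < 0"
      using DERIV_Pr[of x] dPr_strict_mono[of x \<tau>] assms dPr_tau by auto
  qed (use assms in \<open>auto intro!: continuous_at_imp_continuous_on DERIV_isCont[OF DERIV_Pr]\<close>)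
qed

lemma dPr_1_nonneg: "\<tau> \<le> 1 \<Longrightarrow> dPr 1 \<ge> 0"
  using dPr_strict_mono[of \<tau> 1] tau_pos dPr_tau by (cases "\<tau> = 1") auto

lemma inverse_Pr_1_le: "1 / Pr 1 \<le> \<rho>"
  using Pr_gt_tau[of 1] Pr_pos[OF tau_pos] by (cases "\<tau> = 1") (auto simp: rho_def field_simps)

text \<open>Exponential tilting: the coefficients of rho P(tau u), a probability law by rho P(tau) =
  1 with mean zero by P'(tau) = 0.\<close>

definition na :: "int \<Rightarrow> real" where
  "na i = \<rho> * p i * \<tau> powi i"

lemma na_nonneg: "0 \<le> na i"
  unfolding na_def using rho_pos p_nonneg tau_pos by (intro mult_nonneg_nonneg zero_le_power_int) auto

lemma na_pos_iff: "na i > 0 \<longleftrightarrow> p i \<noteq> 0"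
  using rho_pos tau_pos p_nonneg[of i] by (auto simp: na_def zero_less_mult_iff)

lemma na_sum: "(\<Sum>i\<in>{-c..d}. na i) = 1"
proof -
  have "(\<Sum>i\<in>{-c..d}. na i) = \<rho> * Pr \<tau>"
    unfolding Ppoly_def sum_distrib_left by (intro sum.cong refl) (simp add: na_def)
  thus ?thesis by (simp add: rho_Pr)
qed

text \<open>Equality in the triangle inequality makes v^i the same for all jumps i, hence v^(i+c) =
  1. The order k of v as a root of unity therefore divides every i + c, so P(u) = u^(-c) H(u^k),
  which contradicts aperiodicity unless k = 1.\<close>

lemma na_aperiodic:
  fixes v :: complex
  assumes v: "norm v = 1" and n1: "norm (\<Sum>i\<in>{-c..d}. complex_of_real (na i) * v powi i) = 1"
  shows "v = 1"
proof -
  define y where "y = (\<Sum>i\<in>{-c..d}. complex_of_real (na i) * v powi i)"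
  have v0: "v \<noteq> 0" using v by auto
  have yy: "y * cnj y = 1" using n1 complex_norm_square[of y] by (simp add: y_def)
  have ny: "norm y = 1" using n1 by (simp add: y_def)
  have le: "Re (v powi i * cnj y) \<le> 1" for i
    using complex_Re_le_cmod[of "v powi i * cnj y"] v ny by (simp add: norm_mult norm_power_int)
  have "y * cnj y = (\<Sum>i\<in>{-c..d}. complex_of_real (na i) * v powi i) * cnj y" by (simp only: y_def)
  also have "\<dots> = (\<Sum>i\<in>{-c..d}. of_real (na i) * (v powi i * cnj y))"
    unfolding sum_distrib_right by (simp only: mult.assoc)
  finally have "Re (y * cnj y) = (\<Sum>i\<in>{-c..d}. na i * Re (v powi i * cnj y))" by (simp add: Re_sum)
  hence "(\<Sum>i\<in>{-c..d}. na i * (1 - Re (v powi i * cnj y))) = 0"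
    by (simp add: right_diff_distrib sum_subtractf na_sum yy)
  hence zero: "na i * (1 - Re (v powi i * cnj y)) = 0" if "i \<in> {-c..d}" for i
    using that le na_nonneg by (subst (asm) sum_nonneg_eq_0_iff) auto
  have same: "v powi i = y" if "p i \<noteq> 0" for i
  proof -
    have "i \<in> {-c..d}" using p_supp that by force
    hence "Re (v powi i * cnj y) = 1" using zero[of i] na_pos_iff[of i] that by auto
    moreover have "norm (v powi i * cnj y) = 1" using v ny by (simp add: norm_mult norm_power_int)
    ultimately have "v powi i * cnj y = 1"
      using cmod_power2[of "v powi i * cnj y"] by (intro complex_eqI) auto
    hence "v powi i * (y * cnj y) = y" by (simp add: mult_ac)
    thus ?thesis by (simp add: yy)
  qed
  have y0: "y \<noteq> 0" using ny by auto
  have pow1: "v powi (i + c) = 1" if "p i \<noteq> 0" for i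
  proof -
    have "v powi (i + c) = v powi i / v powi (-c)" using v0 by (simp add: power_int_add power_int_minus field_simps)
    thus ?thesis using same[OF that] same[OF p_left] y0 by simp
  qed
  have ex: "\<exists>n>0. v ^ n = 1"
  proof (intro exI[of _ "nat (d + c)"] conjI)
    show "v ^ nat (d + c) = 1" using pow1[OF p_right] c_ge d_ge by (simp add: power_int_def)
  qed (use c_ge d_ge in auto)
  define k where "k = (LEAST n. n > 0 \<and> v ^ n = 1)"
  have k: "k > 0" "v ^ k = 1" using LeastI_ex[OF ex] by (auto simp: k_def)
  have kdvd: "int k dvd n" if n: "v powi n = 1" for n
  proof (rule ccontr)
    assume "\<not> int k dvd n"
    hence "n mod int k > 0" using k by (metis mod_0_imp_dvd of_nat_0_less_iff order_le_less pos_mod_sign)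
    have "v powi n = v powi (int k * (n div int k) + n mod int k)" by simp
    also have "\<dots> = v powi (int k * (n div int k)) * v powi (n mod int k)"
      by (rule power_int_add) (use v0 in simp)
    also have "v powi (int k * (n div int k)) = (v powi int k) powi (n div int k)" by (rule power_int_mult)
    also have "(v powi int k) powi (n div int k) * v powi (n mod int k) = v ^ nat (n mod int k)" using k \<open>n mod int k > 0\<close> by (simp add: power_int_def)
    finally have "v ^ nat (n mod int k) = 1" using n by simp
    moreover have "nat (n mod int k) < k" using k by (simp add: nat_less_iff)
    ultimately show False using \<open>n mod int k > 0\<close> not_less_Least[of "nat (n mod int k)" "\<lambda>n. n > 0 \<and> v ^ n = 1"]
      by (auto simp: k_def)
  qed
  show ?thesis
  proof (rule ccontr)
    assume "v \<noteq> 1"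
    hence "k \<noteq> 1" using k by auto
    hence k2: "2 \<le> int k" using k by simp
    \<comment> \<open>The range for j is simply large enough: exponents k j - c beyond d carry
      weight zero.\<close>
    have "Ppoly c d p u = u powi (-c) * (\<Sum>j\<in>{0..c + d}. p (int k * j - c) * (u powi int k) powi j)"
      if u: "u \<noteq> 0" for u :: real
    proof -
      have "u powi (-c) * (\<Sum>j\<in>{0..c + d}. p (int k * j - c) * (u powi int k) powi j) =
          (\<Sum>j\<in>{0..c + d}. p (int k * j - c) * u powi (int k * j - c))"
        unfolding sum_distrib_left
      proof (intro sum.cong refl)
        fix j
        have 1: "u powi (int k * j - c) = u powi (int k * j) * u powi (-c)"
          using power_int_add[of u "int k * j" "-c"] u by simp
        have 2: "(u powi int k) powi j = u powi (int k * j)" by (rule power_int_mult[symmetric])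
        show "u powi (-c) * (p (int k * j - c) * (u powi int k) powi j) = p (int k * j - c) * u powi (int k * j - c)"
          unfolding 1 2 by (simp only: mult_ac)
      qed
      also have "\<dots> = (\<Sum>i\<in>(\<lambda>j. int k * j - c) ` {0..c + d}. p i * u powi i)"
        using k by (subst sum.reindex) (auto simp: inj_on_def)
      also have "\<dots> = (\<Sum>i\<in>{-c..d}. p i * u powi i)"
      proof (rule sum.mono_neutral_cong)
        fix i assume i: "i \<in> {-c..d} - (\<lambda>j. int k * j - c) ` {0..c + d}"
        show "p i * u powi i = 0"
        proof (rule ccontr)
          assume "p i * u powi i \<noteq> 0"
          hence "int k dvd i + c" using kdvd[OF pow1] by auto
          then obtain j where j: "i + c = int k * j" by blast
          have "0 \<le> int k * j" "int k * j \<le> c + d" using j i by auto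
          hence "0 \<le> j" using k by (simp add: zero_le_mult_iff)
          moreover have "j \<le> int k * j" using k \<open>0 \<le> j\<close> mult_right_mono[of 1 "int k" j] by simp
          ultimately have "j \<in> {0..c + d}" using \<open>int k * j \<le> c + d\<close> by simp
          moreover have "i = int k * j - c" using j by simp
          ultimately show False using i by blast
        qed
      qed (use p_supp in auto)
      finally show ?thesis by (simp add: Ppoly_def)
    qed
    thus False using aper k2 unfolding aperiodic_def by (metis finite_atLeastAtMost_int)
  qed
qed

sublocale centred_walk c d na
proof
  show "(\<Sum>i\<in>{-c..d}. na i * of_int i) = 0"
  proof -
    have "(\<Sum>i\<in>{-c..d}. na i * of_int i) = \<rho> * \<tau> * dPr \<tau>"
      unfolding dPr_def sum_distrib_left using tau_pos
      by (intro sum.cong refl) (simp add: na_def power_int_diff)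
    thus ?thesis by (simp add: dPr_tau)
  qed
  show "v = 1" if "norm v = 1" "norm (\<Sum>i\<in>{-c..d}. complex_of_real (na i) * v powi i) = 1" for v
    using that by (rule na_aperiodic)
qed (use c_ge d_ge na_nonneg na_sum na_pos_iff p_left in auto)

lemma kappa_eq: "kappa = sqrt (2 * Pr \<tau> / deriv (deriv Pr) \<tau>) * (1 / \<tau>)"
proof -
  have "sigma2 = \<rho> * \<tau>\<^sup>2 * ddPr \<tau>"
    unfolding sigma2_def ddPr_def sum_distrib_left using tau_pos
    by (intro sum.cong refl) (simp add: na_def power_int_diff field_simps)
  hence "2 / sigma2 = (2 * Pr \<tau> / ddPr \<tau>) / \<tau>\<^sup>2"
    using tau_pos Pr_pos[OF tau_pos] ddPr_pos[OF tau_pos] by (simp add: rho_def)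
  thus ?thesis using tau_pos unfolding kappa_def deriv2_Pr_tau by (simp add: real_sqrt_divide real_sqrt_mult)
qed

end

subsection \<open>Kernel equation and the catastrophe series\<close>

context catastrophe_model
begin

abbreviation mc :: "nat \<Rightarrow> int \<Rightarrow> real" where "mc \<equiv> mcoef p q"

lemmas mc_Suc = mcoef_Suc[OF p_supp, of _ q]
lemmas mc_eq_0 = mcoef_eq_0[OF p_supp, of _ _ q]

lemma mc_neg: "k < 0 \<Longrightarrow> mc n k = 0"
  by (rule mc_eq_0) auto

lemma mc_nonneg: "0 \<le> mc n k"
proof (induction n arbitrary: k)
  case (Suc n)
  thus ?case using p_nonneg
    by (cases "k < 0") (auto simp: mc_neg mc_Suc intro!: sum_nonneg mult_nonneg_nonneg)
qed (simp add: mcoef_0)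

definition nm :: "nat \<Rightarrow> int \<Rightarrow> real" where
  "nm n k = mc n k * \<rho> ^ n * \<tau> powi k"

sublocale centred_meanders c d na nm
proof
  show "nm 0 k = (if k = 0 then 1 else 0)" for k by (simp add: nm_def mcoef_0)
  show "nm n k = 0" if "k < 0" for n k using that by (simp add: nm_def mc_neg)
  show "nm (Suc n) k = (\<Sum>i\<in>{-c..d}. na i * nm n (k - i))" if "k \<ge> 0" for n k
  proof -
    have "nm (Suc n) k = (\<Sum>i\<in>{-c..d}. p i * mc n (k - i)) * (\<rho> * \<rho> ^ n) * \<tau> powi k"
      using that by (simp add: nm_def mc_Suc)
    also have "\<dots> = (\<Sum>i\<in>{-c..d}. na i * nm n (k - i))"
      unfolding sum_distrib_right
    proof (intro sum.cong refl)
      fix i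
      have 1: "\<tau> powi k = \<tau> powi i * \<tau> powi (k - i)"
        using power_int_add[of \<tau> i "k - i"] tau_pos by simp
      show "p i * mc n (k - i) * (\<rho> * \<rho> ^ n) * \<tau> powi k = na i * nm n (k - i)"
        unfolding 1 na_def nm_def by (simp only: mult_ac)
    qed
    finally show ?thesis .
  qed
qed

section \<open>Kernel equation and divergence at 1/P(1)\<close>

definition Mu :: "nat \<Rightarrow> real \<Rightarrow> real" where
  "Mu n u = (\<Sum>k\<in>{0..int n * d}. mc n k * u powi k)"

text \<open>The part of u^k P(u) with negative exponents, that is, the jumps from altitude k that
  end below 0.\<close>

definition rem :: "int \<Rightarrow> real \<Rightarrow> real" where
  "rem k u = (\<Sum>i\<in>{-c..d}. if i + k < 0 then p i * u powi (i + k) else 0)"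

lemma Mu_1: "Mu n 1 = mtot p q n"
  by (simp add: Mu_def mtot_eq[OF p_supp])

text \<open>The kernel equation by coefficients of z: add an arbitrary jump, then remove the
  endpoints below 0. Only altitudes k < c can produce these, as no jump is lower than -c.\<close>

lemma Mu_Suc:
  assumes "u \<noteq> 0"
  shows "Mu (Suc n) u = Pr u * Mu n u - (\<Sum>k\<in>{0..<c}. rem k u * mc n k)"
proof -
  define A where "A = {0..int n * d}"
  have [simp]: "finite A" by (simp add: A_def)
  have main: "(\<Sum>k\<in>A. mc n k * u powi (k + i)) =
      (\<Sum>k\<in>{0..int (Suc n) * d}. mc n (k - i) * u powi k) +
      (\<Sum>k\<in>{0..<c}. if i + k < 0 then mc n k * u powi (i + k) else 0)" if i: "i \<in> {-c..d}" for i
  proof -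
    have "(\<Sum>k\<in>A. mc n k * u powi (k + i)) =
        (\<Sum>k\<in>{k \<in> A. 0 \<le> k + i}. mc n k * u powi (k + i)) + (\<Sum>k\<in>{k \<in> A. \<not> 0 \<le> k + i}. mc n k * u powi (k + i))"
      by (subst sum.union_disjoint[symmetric]) (auto intro!: sum.cong)
    also have "(\<Sum>k\<in>{k \<in> A. 0 \<le> k + i}. mc n k * u powi (k + i)) =
        (\<Sum>k\<in>{0..int (Suc n) * d}. mc n (k - i) * u powi k)"
    proof (rule sum.reindex_bij_witness_not_neutral[where i = "\<lambda>k. k - i" and j = "\<lambda>k. k + i"
          and S' = "{k \<in> A. mc n k = 0}" and T' = "{k \<in> {0..int (Suc n) * d}. mc n (k - i) = 0}"])
      show "finite {k \<in> A. mc n k = 0}" by simp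
      show "finite {k \<in> {0..int (Suc n) * d}. mc n (k - i) = 0}" by (rule finite_subset[of _ "{0..int (Suc n) * d}"]) auto
      fix k assume "k \<in> {0..int (Suc n) * d} - {k \<in> {0..int (Suc n) * d}. mc n (k - i) = 0}"
      hence "mc n (k - i) \<noteq> 0" "0 \<le> k" by auto
      hence "k - i \<in> A" using mc_eq_0[of "k - i" n] by (auto simp: A_def)
      thus "k - i \<in> {k \<in> A. 0 \<le> k + i} - {k \<in> A. mc n k = 0}" using \<open>mc n (k - i) \<noteq> 0\<close> \<open>0 \<le> k\<close> by auto
    qed (use i in \<open>auto simp: A_def algebra_simps\<close>)
    also have "(\<Sum>k\<in>{k \<in> A. \<not> 0 \<le> k + i}. mc n k * u powi (k + i)) =
        (\<Sum>k\<in>{k \<in> {0..<c}. i + k < 0}. mc n k * u powi (i + k))"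
    proof (rule sum.mono_neutral_cong)
      show "finite {k \<in> A. \<not> 0 \<le> k + i}" by simp
      show "finite {k \<in> {0..<c}. i + k < 0}" by (rule finite_subset[of _ "{0..<c}"]) auto
      fix k assume "k \<in> {k \<in> {0..<c}. i + k < 0} - {k \<in> A. \<not> 0 \<le> k + i}"
      hence "k \<notin> A" by auto
      thus "mc n k * u powi (i + k) = 0" using mc_eq_0[of k n] by (simp add: A_def)
    qed (use i in \<open>auto simp: A_def add.commute\<close>)
    also have "\<dots> = (\<Sum>k\<in>{0..<c}. if i + k < 0 then mc n k * u powi (i + k) else 0)"
      by (subst sum.inter_filter) auto
    finally show ?thesis .
  qed
  have "Pr u * Mu n u = (\<Sum>i\<in>{-c..d}. p i * (\<Sum>k\<in>A. mc n k * u powi (k + i)))"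
    unfolding Ppoly_def Mu_def A_def sum_distrib_right
  proof (intro sum.cong refl)
    fix i
    show "p i * u powi i * (\<Sum>k = 0..int n * d. mc n k * u powi k) = p i * (\<Sum>k = 0..int n * d. mc n k * u powi (k + i))"
      using assms by (simp add: sum_distrib_left power_int_add mult_ac)
  qed
  also have "\<dots> = (\<Sum>i\<in>{-c..d}. p i * ((\<Sum>k\<in>{0..int (Suc n) * d}. mc n (k - i) * u powi k) +
      (\<Sum>k\<in>{0..<c}. if i + k < 0 then mc n k * u powi (i + k) else 0)))"
    using main by (intro sum.cong refl) (simp only:)
  also have "\<dots> = (\<Sum>i\<in>{-c..d}. p i * (\<Sum>k\<in>{0..int (Suc n) * d}. mc n (k - i) * u powi k)) +
      (\<Sum>i\<in>{-c..d}. p i * (\<Sum>k\<in>{0..<c}. if i + k < 0 then mc n k * u powi (i + k) else 0))"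
    by (simp only: distrib_left sum.distrib)
  also have "(\<Sum>i\<in>{-c..d}. p i * (\<Sum>k\<in>{0..int (Suc n) * d}. mc n (k - i) * u powi k)) =
      (\<Sum>i\<in>{-c..d}. \<Sum>k\<in>{0..int (Suc n) * d}. p i * mc n (k - i) * u powi k)"
    by (simp only: sum_distrib_left mult.assoc)
  also have "\<dots> = (\<Sum>k\<in>{0..int (Suc n) * d}. \<Sum>i\<in>{-c..d}. p i * mc n (k - i) * u powi k)"
    by (rule sum.swap)
  also have "\<dots> = Mu (Suc n) u"
    unfolding Mu_def by (intro sum.cong refl) (auto simp: mc_Suc sum_distrib_right)
  also have "(\<Sum>i\<in>{-c..d}. p i * (\<Sum>k\<in>{0..<c}. if i + k < 0 then mc n k * u powi (i + k) else 0)) =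
      (\<Sum>i\<in>{-c..d}. \<Sum>k\<in>{0..<c}. (if i + k < 0 then p i * u powi (i + k) else 0) * mc n k)"
    unfolding sum_distrib_left by (intro sum.cong refl) auto
  also have "\<dots> = (\<Sum>k\<in>{0..<c}. \<Sum>i\<in>{-c..d}. (if i + k < 0 then p i * u powi (i + k) else 0) * mc n k)"
    by (rule sum.swap)
  also have "\<dots> = (\<Sum>k\<in>{0..<c}. rem k u * mc n k)"
    by (simp only: rem_def sum_distrib_right)
  finally show ?thesis by simp
qed

lemma rem_nonneg: "u > 0 \<Longrightarrow> rem k u \<ge> 0"
  unfolding rem_def using p_nonneg by (intro sum_nonneg) (auto intro!: mult_nonneg_nonneg zero_le_power_int)

lemma mtot_nonneg: "0 \<le> mtot p q n"
  unfolding mtot_eq[OF p_supp] by (intro sum_nonneg mc_nonneg)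

lemma mc_le_mtot: "mc n k \<le> mtot p q n"
proof (cases "k \<in> {0..int n * d}")
  case True
  thus ?thesis unfolding mtot_eq[OF p_supp] by (intro member_le_sum mc_nonneg) auto
qed (use mc_eq_0[of k n] mtot_nonneg in simp)

lemma mtot_le: "mtot p q n \<le> Pr 1 ^ n"
proof (induction n)
  case 0
  show ?case by (simp add: mtot_eq[OF p_supp] mcoef_0)
next
  case (Suc n)
  have "0 \<le> (\<Sum>k\<in>{0..<c}. rem k 1 * mc n k)"
    by (intro sum_nonneg mult_nonneg_nonneg rem_nonneg mc_nonneg) auto
  hence "mtot p q (Suc n) \<le> Pr 1 * mtot p q n"
    using Mu_Suc[of 1 n] by (simp add: Mu_1)
  also have "\<dots> \<le> Pr 1 * Pr 1 ^ n" using Suc Pr_pos[of 1] by (intro mult_left_mono) auto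
  finally show ?case by simp
qed

lemma mc_rho_le: "mc n k * \<rho> ^ n \<le> \<tau> powi (-k)"
proof -
  have "mc n k * \<rho> ^ n = nm n k * \<tau> powi (-k)"
    using tau_pos by (simp add: nm_def power_int_minus)
  also have "\<dots> \<le> 1 * \<tau> powi (-k)"
    using tau_pos by (intro mult_right_mono m_bounds zero_le_power_int) auto
  finally show ?thesis by simp
qed

text \<open>The normalised probabilities are at most 1, so each altitude k contributes at most
  tau^(-k); for tau > 1 this is a geometric series.\<close>

lemma mtot_rho_le:
  assumes "\<tau> > 1"
  shows "mtot p q n * \<rho> ^ n \<le> 1 / (1 - 1 / \<tau>)"
proof -
  have "mtot p q n * \<rho> ^ n = (\<Sum>k\<in>{0..int n * d}. mc n k * \<rho> ^ n)"
    by (simp add: mtot_eq[OF p_supp] sum_distrib_right)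
  also have "\<dots> \<le> (\<Sum>k\<in>{0..int n * d}. \<tau> powi (-k))" by (intro sum_mono mc_rho_le)
  also have "int n * d = int (n * nat d)" using d_ge by simp
  also have "(\<Sum>k\<in>{0..int (n * nat d)}. \<tau> powi (-k)) = (\<Sum>k\<in>{0..n * nat d}. (1 / \<tau>) ^ k)"
    by (rule sum.reindex_bij_witness[of _ int nat])
      (auto simp: power_int_minus power_int_def nat_le_iff divide_inverse power_inverse simp del: of_nat_mult)
  also have "\<dots> \<le> (\<Sum>k. (1 / \<tau>) ^ k)"
    using assms by (intro sum_le_suminf summable_geometric) auto
  also have "\<dots> = 1 / (1 - 1 / \<tau>)" using assms by (intro suminf_geometric) auto
  finally show ?thesis .
qed

text \<open>Suppose M converges at r = 1/P(1). The kernel equation (r P(u) - 1) A(u) = S(u) - 1 at u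
  = 1 gives S(1) = 1. All exponents in \<open>rem\<close> are at most -1, so S(u) >= 1/u for u < 1,
  whence (r P(u) - 1) A(u) >= 1 - u. As A(u) <= A(1) < infinity, P would decrease towards u = 1 with
  a definite slope, although P'(1) >= 0 when tau <= 1.\<close>

lemma not_summable_mtot:
  assumes "\<tau> \<le> 1"
  shows "\<not> summable (\<lambda>n. mtot p q n * (1 / Pr 1) ^ n)"
proof
  define r where "r = 1 / Pr 1"
  assume "summable (\<lambda>n. mtot p q n * (1 / Pr 1) ^ n)"
  hence sm: "summable (\<lambda>n. mtot p q n * r ^ n)" by (simp add: r_def)
  have r: "r > 0" "r * Pr 1 = 1" using Pr_pos[of 1] by (auto simp: r_def)
  have sk: "summable (\<lambda>n. mc n k * r ^ n)" for k
    by (rule summable_comparison_test'[OF sm])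
      (use r mc_nonneg mc_le_mtot in \<open>auto simp: abs_mult intro!: mult_right_mono\<close>)
  have Mu_le: "0 \<le> Mu n u" "Mu n u \<le> mtot p q n" if "0 < u" "u \<le> 1" for n u
  proof -
    show "0 \<le> Mu n u" unfolding Mu_def using that mc_nonneg
      by (intro sum_nonneg mult_nonneg_nonneg zero_le_power_int) auto
    have "Mu n u \<le> (\<Sum>k\<in>{0..int n * d}. mc n k * 1)"
      unfolding Mu_def using that mc_nonneg
    proof (intro sum_mono mult_left_mono)
      fix k assume "k \<in> {0..int n * d}"
      thus "u powi k \<le> 1" using that power_int_decreasing[of 0 k u] by simp
    qed
    thus "Mu n u \<le> mtot p q n" by (simp add: mtot_eq[OF p_supp])
  qed
  have su: "summable (\<lambda>n. Mu n u * r ^ n)" if "0 < u" "u \<le> 1" for u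
    by (rule summable_comparison_test'[OF sm])
      (use r Mu_le[OF that] in \<open>auto simp: abs_mult intro!: mult_right_mono\<close>)
  \<comment> \<open>\<open>A u\<close> is M(r, u), and \<open>S\<close> is the boundary term of the
    kernel equation.\<close>
  define A where "A = (\<lambda>u. \<Sum>n. Mu n u * r ^ n)"
  define S where "S = (\<lambda>u. r * (\<Sum>k\<in>{0..<c}. rem k u * (\<Sum>n. mc n k * r ^ n)))"
  have feq: "A u - 1 = r * Pr u * A u - S u" if u: "0 < u" "u \<le> 1" for u
  proof -
    have "(\<lambda>n. Mu n u * r ^ n) sums A u" using su[OF u] by (simp add: A_def summable_sums)
    moreover have "Mu 0 u = 1" by (simp add: Mu_def mcoef_0)
    ultimately have 1: "(\<lambda>n. Mu (Suc n) u * r ^ Suc n) sums (A u - 1)"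
      using sums_Suc_iff[of "\<lambda>n. Mu n u * r ^ n" "A u - 1"] by simp
    have 2: "(\<lambda>n. r * Pr u * (Mu n u * r ^ n) - r * (\<Sum>k\<in>{0..<c}. rem k u * (mc n k * r ^ n))) sums (r * Pr u * A u - S u)"
      unfolding S_def using su[OF u] sk
      by (intro sums_diff sums_mult sums_sum) (auto simp: A_def summable_sums)
    have 3: "(\<lambda>n. r * Pr u * (Mu n u * r ^ n) - r * (\<Sum>k\<in>{0..<c}. rem k u * (mc n k * r ^ n))) = (\<lambda>n. Mu (Suc n) u * r ^ Suc n)"
      using u by (simp add: fun_eq_iff Mu_Suc algebra_simps sum_distrib_left)
    from 1 2[unfolded 3] show ?thesis by (rule sums_unique2)
  qed
  have S1: "S 1 = 1" using feq[of 1] r by simp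
  have Su: "S u \<ge> 1 / u" if u: "0 < u" "u \<le> 1" for u
  proof -
    have "rem k 1 * (1 / u) \<le> rem k u" for k
      unfolding rem_def sum_distrib_right
    proof (intro sum_mono)
      fix i
      have "u powi (-1) \<le> u powi (i + k)" if "i + k < 0" using that u by (intro power_int_decreasing) auto
      thus "(if i + k < 0 then p i * 1 powi (i + k) else 0) * (1 / u) \<le> (if i + k < 0 then p i * u powi (i + k) else 0)"
        using p_nonneg[of i] by (auto simp: power_int_minus divide_inverse intro!: mult_left_mono)
    qed
    hence "r * (\<Sum>k\<in>{0..<c}. rem k 1 * (1 / u) * (\<Sum>n. mc n k * r ^ n)) \<le> S u"
      unfolding S_def using r mc_nonneg sk by (intro mult_left_mono sum_mono mult_right_mono suminf_nonneg) auto
    also have "r * (\<Sum>k\<in>{0..<c}. rem k 1 * (1 / u) * (\<Sum>n. mc n k * r ^ n)) = S 1 * (1 / u)"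
      by (simp add: S_def sum_distrib_left sum_distrib_right mult_ac)
    finally show ?thesis by (simp add: S1)
  qed
  have A1: "A 1 \<ge> 1"
  proof -
    have "(\<Sum>n\<in>{0}. Mu n 1 * r ^ n) \<le> A 1"
      unfolding A_def using su[of 1] Mu_le[of 1] r by (intro sum_le_suminf) auto
    thus ?thesis by (simp add: Mu_def mcoef_0)
  qed
  define C where "C = Pr 1 / A 1"
  have C: "C > 0" using A1 Pr_pos[of 1] by (simp add: C_def)
  have low: "Pr u - Pr 1 \<ge> C * (1 - u)" if u: "0 < u" "u < 1" for u
  proof -
    have "A u \<ge> 0" unfolding A_def using su[of u] Mu_le[of u] r u by (intro suminf_nonneg) auto
    have "A u \<le> A 1" unfolding A_def using su[of u] su[of 1] Mu_le[of u] r u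
      by (intro suminf_le mult_right_mono) (auto simp: Mu_1)
    have "1 - u \<le> 1 / u - 1" using u sum_squares_ge_zero[of "1 - u" 0] by (simp add: field_simps)
    also have "\<dots> \<le> (r * Pr u - 1) * A u" using feq[of u] Su[of u] u by (simp add: algebra_simps)
    finally have 1: "1 - u \<le> (r * Pr u - 1) * A u" .
    hence "0 < (r * Pr u - 1) * A u" using u by simp
    hence "0 < r * Pr u - 1" using \<open>A u \<ge> 0\<close> by (simp add: zero_less_mult_iff)
    hence "(r * Pr u - 1) * A u \<le> (r * Pr u - 1) * A 1" using \<open>A u \<le> A 1\<close> by (intro mult_left_mono) auto
    hence "1 - u \<le> (r * Pr u - 1) * A 1" using 1 by linarith
    hence "(1 - u) * Pr 1 \<le> (r * Pr u - 1) * A 1 * Pr 1" using Pr_pos[of 1] by (intro mult_right_mono) auto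
    also have "\<dots> = (Pr u - Pr 1) * A 1" using r by (simp add: algebra_simps)
    finally show ?thesis using A1 by (simp add: C_def field_simps)
  qed
  have "((\<lambda>u. Pr u + C * u) has_real_derivative dPr 1 + C * 1) (at 1)"
    by (intro derivative_intros DERIV_Pr) auto
  from DERIV_pos_inc_left[OF this] C dPr_1_nonneg[OF assms]
  obtain e where e: "e > 0" "\<And>h. h > 0 \<Longrightarrow> h < e \<Longrightarrow> Pr (1 - h) + C * (1 - h) < Pr 1 + C * 1" by auto
  define h where "h = min (e / 2) (1 / 2)"
  have h: "0 < h" "h < e" "h < 1" using e by (auto simp: h_def min_def)
  have "Pr (1 - h) + C * (1 - h) < Pr 1 + C * 1" by (rule e(2)) (use h in auto)
  moreover have "Pr (1 - h) - Pr 1 \<ge> C * (1 - (1 - h))" by (rule low) (use h in auto)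
  ultimately show False by (simp add: algebra_simps)
qed

text \<open>The kernel equation at u = 1 scaled by rho^n; the factors tau^(-k) undo the tilt in
  \<open>nm\<close>. The ratio rho P(1) differs from 1 because P attains its minimum on the positive
  axis only at tau.\<close>

lemma mtot_singularity:
  assumes "\<tau> > 1"
  obtains G where "G analytic_on lobe"
    "\<And>x. norm x < 1 \<Longrightarrow> (\<lambda>n. of_real (mtot p q n * \<rho> ^ n) * x ^ n) sums G (csqrt (1 - x))"
proof (rule total_singularity[where t = "\<lambda>n. mtot p q n * \<rho> ^ n" and B = "\<rho> * Pr 1" and I = "{0..<c}"
      and r = "\<lambda>k. \<rho> * rem k 1 * \<tau> powi (-k)" and C = "1 / (1 - 1 / \<tau>)"])
  show "mtot p q 0 * \<rho> ^ 0 = 1" by (simp add: mtot_eq[OF p_supp] mcoef_0)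
  show "mtot p q (Suc n) * \<rho> ^ Suc n = \<rho> * Pr 1 * (mtot p q n * \<rho> ^ n) -
      (\<Sum>k\<in>{0..<c}. \<rho> * rem k 1 * \<tau> powi (-k) * nm n k)" for n
  proof -
    define X where "X = (\<Sum>k\<in>{0..<c}. rem k 1 * mc n k)"
    have "\<rho> * rem k 1 * \<tau> powi (-k) * nm n k = rem k 1 * mc n k * (\<rho> * \<rho> ^ n)" for k
      using tau_pos by (simp add: nm_def power_int_minus)
    hence "(\<Sum>k\<in>{0..<c}. \<rho> * rem k 1 * \<tau> powi (-k) * nm n k) = X * (\<rho> * \<rho> ^ n)"
      by (simp only: X_def sum_distrib_right)
    moreover have eq: "mtot p q (Suc n) = Pr 1 * mtot p q n - X"
      using Mu_Suc[of 1 n] by (simp add: Mu_1 X_def)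
    ultimately show ?thesis unfolding eq by (simp add: algebra_simps)
  qed
  show "\<bar>mtot p q n * \<rho> ^ n\<bar> \<le> 1 / (1 - 1 / \<tau>)" for n
    using mtot_rho_le[OF assms, of n] mtot_nonneg[of n] rho_pos by simp
  show "\<rho> * Pr 1 > 0" using rho_pos Pr_pos by simp
  show "\<rho> * Pr 1 \<noteq> 1"
  proof
    assume "\<rho> * Pr 1 = 1"
    hence "Pr 1 = Pr \<tau>" using rho_Pr rho_pos by (metis mult_cancel_left less_irrefl)
    thus False using Pr_gt_tau[of 1] assms by simp
  qed
qed (use that in auto)

section \<open>Coefficients of the catastrophe series Q\<close>

definition Qc :: "nat \<Rightarrow> real" where
  "Qc n = fps_nth (Q_fps p q) n"

lemma negset_subset: "negset p \<subseteq> {1..c}"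
  using jumps_subset[OF p_supp] by (force simp: negset_def)

lemma finite_negset: "finite (negset p)"
  using negset_subset by (rule finite_subset) simp

lemma Qc_0: "Qc 0 = 0"
  by (simp add: Qc_def Q_fps_def mult.assoc)

lemma Qc_Suc: "Qc (Suc n) = q * (mtot p q n - mc n 0 - (\<Sum>j\<in>negset p. mc n j))"
  by (simp add: Qc_def Q_fps_def mult.assoc M_fps_def Mk_fps_def fps_sum_nth)

text \<open>The subtracted series are those of altitude 0 and of the altitudes where a catastrophe
  is forbidden, so a nonnegative sum remains. The bound N >= c puts all of \<open>negset\<close>
  into the range of summation.\<close>

lemma Qc_Suc_sum:
  assumes "N \<ge> int n * d" "N \<ge> c"
  shows "Qc (Suc n) = q * (\<Sum>k\<in>{0..N} - insert 0 (negset p). mc n k)"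
proof -
  have sub: "insert 0 (negset p) \<subseteq> {0..N}" using negset_subset assms c_ge by force
  have "0 \<notin> negset p" using negset_subset by auto
  hence "(\<Sum>k\<in>insert 0 (negset p). mc n k) = mc n 0 + (\<Sum>j\<in>negset p. mc n j)"
    using finite_negset by simp
  thus ?thesis using mtot_eq'[OF p_supp assms(1), of q] sub finite_negset
    by (simp add: Qc_Suc sum_diff)
qed

lemma Qc_nonneg: "Qc n \<ge> 0"
proof (cases n)
  case (Suc n')
  have "0 \<le> (\<Sum>k\<in>{0..max (int n' * d) c} - insert 0 (negset p). mc n' k)"
    by (intro sum_nonneg mc_nonneg)
  thus ?thesis using Qc_Suc_sum[of n' "max (int n' * d) c"] q_pos Suc by simp
qed (simp add: Qc_0)

lemma Qc_ge: "k > c \<Longrightarrow> Qc (Suc n) \<ge> q * mc n k"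
proof -
  assume k: "k > c"
  let ?N = "max k (int n * d)"
  have "k \<notin> negset p" using negset_subset k by auto
  hence "mc n k \<le> (\<Sum>k\<in>{0..?N} - insert 0 (negset p). mc n k)"
    using k c_ge by (intro member_le_sum mc_nonneg) auto
  thus ?thesis using Qc_Suc_sum[of n ?N] q_pos k by (simp add: mult_left_mono)
qed

lemma mc_climb: "k \<ge> 0 \<Longrightarrow> mc (n + l) (k + int l * d) \<ge> p d ^ l * mc n k"
proof (induction l)
  case (Suc l)
  let ?k = "k + int (Suc l) * d"
  have "p d * mc (n + l) (?k - d) \<le> (\<Sum>i\<in>{-c..d}. p i * mc (n + l) (?k - i))"
    using c_ge d_ge mc_nonneg p_nonneg by (intro member_le_sum) auto
  also have "\<dots> = mc (n + Suc l) ?k" using Suc(2) d_ge by (simp add: mc_Suc)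
  finally have "p d * mc (n + l) (k + int l * d) \<le> mc (n + Suc l) ?k" by (simp add: algebra_simps)
  moreover have "p d * (p d ^ l * mc n k) \<le> p d * mc (n + l) (k + int l * d)"
    using Suc p_nonneg by (intro mult_left_mono) auto
  ultimately show ?case by (simp add: mult.assoc)
qed simp

text \<open>This many jumps of size d lead from 0 above c, where a catastrophe is always
  allowed.\<close>

definition lag :: nat where "lag = nat c + 1"

lemma lag_climb: "int (lag + n) * d > c"
proof -
  have 1: "int (lag + n) * 1 \<le> int (lag + n) * d" using d_ge by (intro mult_left_mono) auto
  have "c < int (lag + n)" using c_ge by (simp add: lag_def)
  from this 1[unfolded mult_1_right] show ?thesis by (rule less_le_trans)
qed

text \<open>An excursion followed by \<open>lag\<close> highest jumps and a catastrophe is counted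
  by Q. Thus the coefficients of Q dominate shifted ones of E, which later makes eta
  positive.\<close>

lemma Qc_ge_mc0: "Qc (Suc (n + lag)) \<ge> q * (p d ^ lag * mc n 0)"
proof -
  have "q * (p d ^ lag * mc n 0) \<le> q * mc (n + lag) (int lag * d)"
    using mc_climb[where k = 0 and n = n and l = lag] q_pos by (intro mult_left_mono) auto
  also have "\<dots> \<le> Qc (Suc (n + lag))" using lag_climb[of 0] by (intro Qc_ge) simp
  finally show ?thesis .
qed

text \<open>All later coefficients are positive, in particular two consecutive ones; this makes Q
  aperiodic.\<close>

lemma Qc_pos: "Qc (Suc (lag + n)) > 0"
proof -
  have "p d ^ (lag + n) \<le> mc (lag + n) (int (lag + n) * d)"
    using mc_climb[where k = 0 and n = 0 and l = "lag + n"] by (simp add: mcoef_0)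
  hence "0 < mc (lag + n) (int (lag + n) * d)"
    using p_right_pos by (meson less_le_trans zero_less_power)
  hence "0 < q * mc (lag + n) (int (lag + n) * d)" using q_pos by simp
  also have "\<dots> \<le> Qc (Suc (lag + n))" by (intro Qc_ge lag_climb)
  finally show ?thesis .
qed

lemma mtot_summable_mono:
  assumes "summable (\<lambda>n. mtot p q n * z ^ n)" "0 \<le> y" "y \<le> z"
  shows "summable (\<lambda>n. mtot p q n * y ^ n)"
  by (rule summable_comparison_test'[OF assms(1)])
    (use assms mtot_nonneg in \<open>auto simp: abs_mult intro!: mult_left_mono power_mono\<close>)

lemma mtot_summable_inside:
  assumes bound: "\<And>n. mtot p q n * R ^ n \<le> C" and z: "0 \<le> z" "z < R"
  shows "summable (\<lambda>n. mtot p q n * z ^ n)"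
proof (rule summable_comparison_test')
  show "summable (\<lambda>n. C * (z / R) ^ n)" using z by (intro summable_mult summable_geometric) auto
  fix n
  have "norm (mtot p q n * z ^ n) = (mtot p q n * R ^ n) * (z / R) ^ n"
    using z mtot_nonneg[of n] by (simp add: abs_mult power_divide)
  also have "\<dots> \<le> C * (z / R) ^ n" using z bound by (intro mult_right_mono) auto
  finally show "norm (mtot p q n * z ^ n) \<le> C * (z / R) ^ n" .
qed

lemma mc_summable:
  assumes "z \<ge> 0" "summable (\<lambda>n. mtot p q n * z ^ n)"
  shows "summable (\<lambda>n. mc n k * z ^ n)"
  by (rule summable_comparison_test'[OF assms(2)])
    (use assms mc_nonneg mc_le_mtot in \<open>auto simp: abs_mult intro!: mult_right_mono\<close>)

lemma Q_fun_sums: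
  assumes "z \<ge> 0" "summable (\<lambda>n. mtot p q n * z ^ n)"
  shows "(\<lambda>n. Qc n * z ^ n) sums Q_fun p q z"
proof -
  have "(\<lambda>n. z * q * (mtot p q n * z ^ n - mc n 0 * z ^ n - (\<Sum>j\<in>negset p. mc n j * z ^ n))) sums Q_fun p q z"
    unfolding Q_fun_def M_fun_def E_fun_def Mk_fun_def
    by (intro sums_mult sums_diff sums_sum summable_sums assms mc_summable)
  also have "(\<lambda>n. z * q * (mtot p q n * z ^ n - mc n 0 * z ^ n - (\<Sum>j\<in>negset p. mc n j * z ^ n))) = (\<lambda>n. Qc (Suc n) * z ^ Suc n)"
    by (simp add: Qc_Suc fun_eq_iff algebra_simps sum_distrib_left sum_distrib_right)
  finally have "(\<lambda>n. Qc (Suc n) * z ^ Suc n) sums (Q_fun p q z - Qc 0 * z ^ 0)" by (simp add: Qc_0)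
  hence "(\<lambda>n. Qc n * z ^ n) sums (Q_fun p q z - Qc 0 * z ^ 0 + Qc 0 * z ^ 0)"
    by (rule iffD1[OF sums_Suc_iff])
  thus ?thesis by simp
qed

lemma Q_fun_strict_mono:
  assumes "0 \<le> y" "y < z" "summable (\<lambda>n. mtot p q n * z ^ n)"
  shows "Q_fun p q y < Q_fun p q z"
proof -
  have "summable (\<lambda>n. mtot p q n * y ^ n)" using assms by (intro mtot_summable_mono[OF assms(3)]) auto
  hence 1: "(\<lambda>n. Qc n * y ^ n) sums Q_fun p q y" "(\<lambda>n. Qc n * z ^ n) sums Q_fun p q z"
    using assms by (auto intro: Q_fun_sums)
  have le: "Qc n * y ^ n \<le> Qc n * z ^ n" for n
    using assms Qc_nonneg by (intro mult_left_mono power_mono) auto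
  have "Qc (Suc (lag + 0)) * y ^ Suc (lag + 0) < Qc (Suc (lag + 0)) * z ^ Suc (lag + 0)"
    using assms Qc_pos[of 0] by (intro mult_strict_left_mono power_strict_mono) auto
  hence "(\<Sum>n. Qc n * z ^ n - Qc n * y ^ n) > 0"
    using 1 le by (intro suminf_pos2[of _ "Suc lag"] summable_diff) (auto simp: sums_iff)
  thus ?thesis using 1 sums_diff[OF 1(2) 1(1)] by (simp add: sums_iff)
qed

lemma is_rho0I:
  assumes "0 < r" "r \<le> \<rho>" "summable (\<lambda>n. mtot p q n * r ^ n)" "Q_fun p q r = 1"
  shows "is_rho0 c d p q r"
  unfolding is_rho0_def
proof (intro conjI allI impI)
  show "1 - Q_fun p q s \<noteq> 0" if "0 < s \<and> s < r \<and> summable (\<lambda>n. mtot p q n * s ^ n)" for s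
    using Q_fun_strict_mono[of s r] assms that by simp
qed (use assms in auto)

end

subsection \<open>Asymptotics of coefficients\<close>

lemma sqrt_coeff_limit: "(\<lambda>n. sqrt_coeff n * real n powr (3/2)) \<longlonglongrightarrow> - 1 / (2 * sqrt pi)"
proof -
  have 1: "(\<lambda>n. (rsqrt_coeff n * sqrt (real n)) * (- real n / (2 * real n - 1))) \<longlonglongrightarrow> 1 / sqrt pi * (- 1 / 2)"
    by (intro tendsto_mult rsqrt_coeff_limit) real_asymp
  have 2: "\<forall>\<^sub>F n in at_top. (rsqrt_coeff n * sqrt (real n)) * (- real n / (2 * real n - 1)) = sqrt_coeff n * real n powr (3/2)"
    using eventually_gt_at_top[of 0]
  proof eventually_elim
    case (elim n)
    have "real n powr (3/2) = real n powr (1 + 1/2)" by simp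
    also have "\<dots> = real n * sqrt (real n)"
      unfolding powr_add using elim by (simp add: powr_half_sqrt)
    finally show ?case by (simp add: sqrt_coeff_def)
  qed
  show ?thesis using Lim_transform_eventually[OF 1 2] by (simp add: mult.commute)
qed

lemma sqrt_type_limit:
  assumes "(\<lambda>n. f n - \<alpha> * sqrt_coeff n) \<in> O(\<lambda>n. real n powr (-5/2))"
  shows "(\<lambda>n. f n * real n powr (3/2)) \<longlonglongrightarrow> - \<alpha> / (2 * sqrt pi)"
proof -
  have "(\<lambda>n. (f n - \<alpha> * sqrt_coeff n) * real n powr (3/2)) \<in> O(\<lambda>n. real n powr (-5/2) * real n powr (3/2))"
    by (intro landau_o.big.mult assms) auto
  also have "(\<lambda>n. real n powr (-5/2) * real n powr (3/2)) \<in> o(\<lambda>n. 1)" by real_asymp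
  finally have "(\<lambda>n. (f n - \<alpha> * sqrt_coeff n) * real n powr (3/2)) \<longlonglongrightarrow> 0"
    using smalloD_tendsto by force
  from tendsto_add[OF this tendsto_mult_left[OF sqrt_coeff_limit, of \<alpha>]]
  show ?thesis by (simp add: algebra_simps)
qed

text \<open>The constant -alpha/2 arises from \<open>sqrt_coeff n\<close> = -
  \<open>rsqrt_coeff n\<close> / (2n - 1), where \<open>rsqrt_coeff n\<close> is 1 / sqrt (pi n) up
  to a relative error O(1/n).\<close>

lemma sqrt_type_asymp:
  assumes "(\<lambda>n. f n - \<alpha> * sqrt_coeff n) \<in> O(\<lambda>n. real n powr (-5/2))" "\<alpha> \<noteq> 0"
  shows "\<exists>r. r \<in> O(\<lambda>n. 1 / real n) \<and> (\<forall>\<^sub>F n in at_top. f n = (- \<alpha> / 2) / sqrt (pi * real n ^ 3) * (1 + r n))"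
proof (intro exI conjI)
  define y where "y = (\<lambda>n. rsqrt_coeff n * sqrt (pi * real n))"
  define r where "r = (\<lambda>n. f n / ((- \<alpha> / 2) / sqrt (pi * real n ^ 3)) - 1)"
  have y1: "(\<lambda>n. y n - 1) \<in> O(\<lambda>n. 1 / real n)" unfolding y_def by (rule rsqrt_coeff_asymp)
  have "(\<lambda>n. (f n - \<alpha> * sqrt_coeff n) * ((- 2 / \<alpha>) * sqrt (pi * real n ^ 3))) \<in> O(\<lambda>n. real n powr (-5/2) * sqrt (real n ^ 3))"
    by (intro landau_o.big.mult assms(1) bigoI[of _ "\<bar>2 / \<alpha>\<bar> * sqrt pi"]) (simp add: real_sqrt_mult abs_mult)
  also have "(\<lambda>n. real n powr (-5/2) * sqrt (real n ^ 3)) \<in> O(\<lambda>n. 1 / real n)" by real_asymp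
  finally have 1: "(\<lambda>n. (f n - \<alpha> * sqrt_coeff n) * ((- 2 / \<alpha>) * sqrt (pi * real n ^ 3))) \<in> O(\<lambda>n. 1 / real n)" .
  have "(\<lambda>n. (y n - 1) * (2 * real n / (2 * real n - 1))) \<in> O(\<lambda>n. 1 / real n * 1)"
    by (intro landau_o.big.mult y1) real_asymp
  hence 2: "(\<lambda>n. (y n - 1) * (2 * real n / (2 * real n - 1))) \<in> O(\<lambda>n. 1 / real n)" by simp
  have 3: "(\<lambda>n. 2 * real n / (2 * real n - 1) - 1) \<in> O(\<lambda>n. 1 / real n)" by real_asymp
  have "(\<lambda>n. (f n - \<alpha> * sqrt_coeff n) * ((- 2 / \<alpha>) * sqrt (pi * real n ^ 3)) +
      ((y n - 1) * (2 * real n / (2 * real n - 1)) + (2 * real n / (2 * real n - 1) - 1))) \<in> O(\<lambda>n. 1 / real n)"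
    by (intro sum_in_bigo 1 2 3)
  also have "?this \<longleftrightarrow> r \<in> O(\<lambda>n. 1 / real n)"
  proof (rule landau_o.big.in_cong)
    show "\<forall>\<^sub>F n in sequentially. (f n - \<alpha> * sqrt_coeff n) * ((- 2 / \<alpha>) * sqrt (pi * real n ^ 3)) +
      ((y n - 1) * (2 * real n / (2 * real n - 1)) + (2 * real n / (2 * real n - 1) - 1)) = r n"
      using eventually_gt_at_top[of 0]
    proof eventually_elim
      case (elim n)
      have "real n ^ 3 = (real n)\<^sup>2 * real n" by (simp add: power3_eq_cube power2_eq_square)
      hence s: "sqrt (pi * real n ^ 3) = real n * sqrt (pi * real n)"
        by (simp add: real_sqrt_mult)
      have a: "\<alpha> * sqrt_coeff n * ((- 2 / \<alpha>) * sqrt (pi * real n ^ 3)) = y n * (2 * real n / (2 * real n - 1))"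
        unfolding s y_def sqrt_coeff_def using assms(2) by simp
      have b: "r n = f n * ((- 2 / \<alpha>) * sqrt (pi * real n ^ 3)) - 1"
        unfolding r_def using assms(2) by simp
      show ?case unfolding b left_diff_distrib a by simp
    qed
  qed
  finally show "r \<in> O(\<lambda>n. 1 / real n)" .
  show "\<forall>\<^sub>F n in at_top. f n = (- \<alpha> / 2) / sqrt (pi * real n ^ 3) * (1 + r n)"
    using eventually_gt_at_top[of 0] by eventually_elim (use assms(2) in \<open>simp add: r_def\<close>)
qed

lemma rsqrt_type_asymp:
  assumes "(\<lambda>n. f n - \<alpha> * rsqrt_coeff n) \<in> O(\<lambda>n. real n powr (-3/2))" "\<alpha> \<noteq> 0"
  shows "\<exists>r. r \<in> O(\<lambda>n. 1 / real n) \<and> (\<forall>\<^sub>F n in at_top. f n = \<alpha> / sqrt (pi * real n) * (1 + r n))"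
proof (intro exI conjI)
  define r where "r = (\<lambda>n. f n / (\<alpha> / sqrt (pi * real n)) - 1)"
  have "(\<lambda>n. (f n - \<alpha> * rsqrt_coeff n) * (1 / \<alpha> * sqrt (pi * real n))) \<in> O(\<lambda>n. real n powr (-3/2) * sqrt (real n))"
    by (intro landau_o.big.mult assms(1) bigoI[of _ "\<bar>1 / \<alpha>\<bar> * sqrt pi"]) (simp add: real_sqrt_mult abs_mult)
  also have "(\<lambda>n. real n powr (-3/2) * sqrt (real n)) \<in> O(\<lambda>n. 1 / real n)" by real_asymp
  finally have "(\<lambda>n. (f n - \<alpha> * rsqrt_coeff n) * (1 / \<alpha> * sqrt (pi * real n))) \<in> O(\<lambda>n. 1 / real n)" .
  from sum_in_bigo(1)[OF this rsqrt_coeff_asymp]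
  have "(\<lambda>n. (f n - \<alpha> * rsqrt_coeff n) * (1 / \<alpha> * sqrt (pi * real n)) +
      (rsqrt_coeff n * sqrt (pi * real n) - 1)) \<in> O(\<lambda>n. 1 / real n)" .
  also have "(\<lambda>n. (f n - \<alpha> * rsqrt_coeff n) * (1 / \<alpha> * sqrt (pi * real n)) +
      (rsqrt_coeff n * sqrt (pi * real n) - 1)) = r"
    using assms(2) by (simp add: r_def fun_eq_iff left_diff_distrib diff_divide_distrib)
  finally show "r \<in> O(\<lambda>n. 1 / real n)" .
  show "\<forall>\<^sub>F n in at_top. f n = \<alpha> / sqrt (pi * real n) * (1 + r n)"
    using eventually_gt_at_top[of 0] by eventually_elim (use assms(2) in \<open>simp add: r_def\<close>)
qed

text \<open>The derivative at 0 is real because the coefficients are: the imaginary part of the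
  error is Im H'(0) times \<open>sqrt_coeff n\<close>, which has exact order n^(-3/2) unless Im
  H'(0) = 0, while the error is O(n^(-5/2)).\<close>

lemma lobe_series_coeffs:
  fixes f :: "nat \<Rightarrow> real"
  assumes H: "H analytic_on lobe" and f: "(\<lambda>x. H (csqrt (1 - x))) has_fps_expansion Abs_fps (\<lambda>n. of_real (f n))"
  shows "(\<lambda>n. f n - Re (deriv H 0) * sqrt_coeff n) \<in> O(\<lambda>n. real n powr (-5/2))"
    and "deriv H 0 = of_real (Re (deriv H 0))"
proof -
  have *: "(\<lambda>n. norm (complex_of_real (f n) - deriv H 0 * of_real (sqrt_coeff n))) \<in> O(\<lambda>n. real n powr (-5/2))"
    using sqrt_singularity_transfer[OF H f] by simp
  have "norm (f n - Re (deriv H 0) * sqrt_coeff n) \<le> norm (norm (complex_of_real (f n) - deriv H 0 * of_real (sqrt_coeff n)))" for n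
    using abs_Re_le_cmod[of "complex_of_real (f n) - deriv H 0 * of_real (sqrt_coeff n)"] by simp
  thus "(\<lambda>n. f n - Re (deriv H 0) * sqrt_coeff n) \<in> O(\<lambda>n. real n powr (-5/2))"
    by (intro landau_o.big_trans[OF landau_o.big_mono *] always_eventually allI)
  have "norm (0 - Im (deriv H 0) * sqrt_coeff n) \<le> norm (norm (complex_of_real (f n) - deriv H 0 * of_real (sqrt_coeff n)))" for n
    using abs_Im_le_cmod[of "complex_of_real (f n) - deriv H 0 * of_real (sqrt_coeff n)"] by simp
  hence "(\<lambda>n. 0 - Im (deriv H 0) * sqrt_coeff n) \<in> O(\<lambda>n. real n powr (-5/2))"
    by (intro landau_o.big_trans[OF landau_o.big_mono *] always_eventually allI)
  from sqrt_type_limit[OF this] have "(\<lambda>n. 0) \<longlonglongrightarrow> - Im (deriv H 0) / (2 * sqrt pi)" by simp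
  hence "- Im (deriv H 0) / (2 * sqrt pi) = 0" using LIMSEQ_unique tendsto_const by blast
  hence "Im (deriv H 0) = 0" by simp
  thus "deriv H 0 = of_real (Re (deriv H 0))" by (simp add: complex_eq_iff)
qed

lemma lobe_series_summable:
  fixes f :: "nat \<Rightarrow> real"
  assumes H: "H analytic_on lobe"
    and f: "\<And>x. norm x < 1 \<Longrightarrow> (\<lambda>n. of_real (f n) * x ^ n) sums H (csqrt (1 - x))"
  shows "summable (\<lambda>n. \<bar>f n\<bar>)"
proof -
  have exp: "(\<lambda>x. H (csqrt (1 - x))) has_fps_expansion Abs_fps (\<lambda>n. of_real (f n))"
  proof (rule has_fps_expansionI)
    show "\<forall>\<^sub>F u in nhds 0. (\<lambda>n. fps_nth (Abs_fps (\<lambda>n. complex_of_real (f n))) n * u ^ n) sums H (csqrt (1 - u))"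
      using eventually_norm_less[OF zero_less_one] by eventually_elim (use f in simp)
  qed
  let ?\<alpha> = "Re (deriv H 0)"
  have "(\<lambda>n. f n - ?\<alpha> * sqrt_coeff n) \<in> O(\<lambda>n. real n powr (-3/2))"
    by (rule landau_o.big_trans[OF lobe_series_coeffs(1)[OF H exp]]) real_asymp
  moreover have "(\<lambda>n. ?\<alpha> * sqrt_coeff n) \<in> O(\<lambda>n. real n powr (-3/2))"
    using sqrt_coeff_bigo by simp
  ultimately have "(\<lambda>n. (f n - ?\<alpha> * sqrt_coeff n) + ?\<alpha> * sqrt_coeff n) \<in> O(\<lambda>n. real n powr (-3/2))"
    by (rule sum_in_bigo)
  hence "f \<in> O(\<lambda>n. real n powr (-3/2))" by simp
  hence absO: "(\<lambda>n. \<bar>f n\<bar>) \<in> O(\<lambda>n. real n powr (-3/2))" by simp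
  have "summable (\<lambda>n. norm (real n powr (-3/2)))" by (simp add: summable_real_powr_iff)
  from summable_comparison_test_bigo[OF this absO] show ?thesis .
qed

text \<open>Absolutely summable coefficients make the series continuous on the closed disc, so its
  boundary values are radial limits. The point x = 1 is treated through the modulus, since csqrt is
  not covered by \<open>continuous_at_csqrt\<close> at 0.\<close>

lemma lobe_series_closed_disc:
  fixes f :: "nat \<Rightarrow> real"
  assumes H: "H analytic_on lobe"
    and f: "\<And>x. norm x < 1 \<Longrightarrow> (\<lambda>n. of_real (f n) * x ^ n) sums H (csqrt (1 - x))"
    and x: "norm x \<le> 1"
  shows "(\<lambda>n. of_real (f n) * x ^ n) sums H (csqrt (1 - x))"
proof -
  have sm: "summable (\<lambda>n. \<bar>f n\<bar>)" using H f by (rule lobe_series_summable)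
  define S where "S = (\<lambda>x::complex. \<Sum>n. of_real (f n) * x ^ n)"
  have le: "norm (complex_of_real (f n) * x ^ n) \<le> \<bar>f n\<bar>" if "norm x \<le> 1" for n x
    using that by (simp add: norm_mult norm_power mult_left_le power_le_one)
  have ul: "uniform_limit (cball 0 1) (\<lambda>n x. \<Sum>i<n. complex_of_real (f i) * x ^ i) S sequentially"
    unfolding S_def using le sm by (intro Weierstrass_m_test) auto
  have cS: "continuous_on (cball 0 1) S"
    by (rule uniform_limit_theorem[OF _ ul]) (auto intro!: always_eventually continuous_intros)
  have sums: "(\<lambda>n. of_real (f n) * x ^ n) sums S x"
    unfolding S_def by (intro summable_sums summable_norm_cancel[OF summable_comparison_test'[OF sm]]) (use le[OF x] in auto)
  define t where "t = (\<lambda>k::nat. 1 - 1 / (real k + 2))"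
  have t: "0 \<le> t k" "t k < 1" for k by (auto simp: t_def field_simps)
  have tlim: "(\<lambda>k. complex_of_real (t k) * x) \<longlonglongrightarrow> of_real 1 * x"
    by (intro tendsto_intros tendsto_of_real) (unfold t_def, real_asymp)
  have ntx: "norm (complex_of_real (t k) * x) < 1" for k
  proof -
    have "norm (complex_of_real (t k) * x) = t k * norm x" using t[of k] by (simp add: norm_mult)
    also have "\<dots> \<le> t k * 1" using t x by (intro mult_left_mono) auto
    finally show ?thesis using t[of k] by simp
  qed
  have l1: "(\<lambda>k. S (of_real (t k) * x)) \<longlonglongrightarrow> S x"
  proof -
    have "(\<lambda>k. S (of_real (t k) * x)) \<longlonglongrightarrow> S (of_real 1 * x)"
      using cS tlim x ntx by (intro continuous_on_tendsto_compose[OF cS tlim]) (auto intro!: always_eventually less_imp_le)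
    thus ?thesis by simp
  qed
  have cs: "(\<lambda>k. csqrt (1 - of_real (t k) * x)) \<longlonglongrightarrow> csqrt (1 - x)"
  proof (cases "x = 1")
    case True
    have "(\<lambda>k. sqrt (norm (1 - of_real (t k) * x))) \<longlonglongrightarrow> sqrt (norm (1 - of_real 1 * x))"
      by (intro tendsto_intros tlim)
    hence "(\<lambda>k. norm (csqrt (1 - of_real (t k) * x))) \<longlonglongrightarrow> 0" using True by (simp add: norm_csqrt)
    hence "(\<lambda>k. csqrt (1 - of_real (t k) * x)) \<longlonglongrightarrow> 0" by (rule tendsto_norm_zero_cancel)
    thus ?thesis using True by simp
  next
    case False
    have "1 - x \<notin> \<real>\<^sub>\<le>\<^sub>0"
    proof
      assume "1 - x \<in> \<real>\<^sub>\<le>\<^sub>0"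
      hence "Re x \<ge> 1" "Im x = 0" by (auto simp: complex_nonpos_Reals_iff)
      moreover have "Re x \<le> 1" using complex_Re_le_cmod[of x] x by linarith
      ultimately show False using False by (simp add: complex_eq_iff)
    qed
    hence "isCont csqrt (1 - x)" by (rule continuous_at_csqrt)
    moreover have "(\<lambda>k. 1 - of_real (t k) * x) \<longlonglongrightarrow> 1 - x"
      using tendsto_diff[OF tendsto_const tlim, of 1] by simp
    ultimately show ?thesis by (rule isCont_tendsto_compose)
  qed
  have "isCont H (csqrt (1 - x))"
    using H csqrt_in_lobe[OF x] analytic_on_imp_differentiable_at field_differentiable_imp_continuous_at by blast
  hence l2: "(\<lambda>k. H (csqrt (1 - of_real (t k) * x))) \<longlonglongrightarrow> H (csqrt (1 - x))"
    using cs by (rule isCont_tendsto_compose)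
  have "H (csqrt (1 - of_real (t k) * x)) = S (of_real (t k) * x)" for k
    using sums_unique[OF f[OF ntx]] by (simp only: S_def)
  with l2 have "(\<lambda>k. S (of_real (t k) * x)) \<longlonglongrightarrow> H (csqrt (1 - x))" by (simp only:)
  from LIMSEQ_unique[OF l1 this] sums show ?thesis by (simp only:)
qed

subsection \<open>The supercritical case\<close>

text \<open>Equality in the termwise estimate forces x^n = y^n whenever b n > 0; dividing the
  relations for the consecutive exponents N and N + 1 gives x = y.\<close>

lemma positive_series_eq_imp:
  fixes b :: "nat \<Rightarrow> real" and x :: complex
  assumes b: "\<And>n. 0 \<le> b n" and y: "y > 0" and sm: "summable (\<lambda>n. b n * y ^ n)" and x: "norm x \<le> y"
    and pos: "b N > 0" "b (Suc N) > 0"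
    and eq: "(\<lambda>n. of_real (b n) * x ^ n) sums of_real (\<Sum>n. b n * y ^ n)"
  shows "x = of_real y"
proof -
  have nle: "norm (x ^ n) \<le> y ^ n" for n using x by (simp add: norm_power power_mono)
  have le: "Re (x ^ n) \<le> y ^ n" for n
    using complex_Re_le_cmod[of "x ^ n"] nle[of n] by linarith
  have "(\<lambda>n. b n * y ^ n - b n * Re (x ^ n)) sums 0"
    using sums_diff[OF summable_sums[OF sm] sums_Re[OF eq]] by simp
  moreover have "0 \<le> b n * y ^ n - b n * Re (x ^ n)" for n
    using mult_left_mono[OF le b, of n n] by simp
  ultimately have 0: "b n * y ^ n - b n * Re (x ^ n) = 0" for n
    using suminf_eq_zero_iff[of "\<lambda>n. b n * y ^ n - b n * Re (x ^ n)"] by (simp add: sums_iff)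
  have pw: "x ^ n = of_real (y ^ n)" if "b n > 0" for n
  proof -
    have Re: "Re (x ^ n) = y ^ n" using 0[of n] that by simp
    have "(norm (x ^ n))\<^sup>2 \<le> (y ^ n)\<^sup>2" by (intro power_mono nle) auto
    hence "(Im (x ^ n))\<^sup>2 \<le> 0" using Re by (simp add: cmod_power2)
    hence "Im (x ^ n) = 0" by simp
    with Re show ?thesis by (intro complex_eqI) auto
  qed
  have "x * of_real (y ^ N) = of_real y * of_real (y ^ N)"
    using pw[OF pos(1)] pw[OF pos(2)] by simp
  thus ?thesis using y by simp
qed

definition scaled_fps :: "real \<Rightarrow> real fps \<Rightarrow> complex fps" where
  "scaled_fps r A = Abs_fps (\<lambda>n. of_real (fps_nth A n * r ^ n))"

lemma scaled_fps_mult: "scaled_fps r (A * B) = scaled_fps r A * scaled_fps r B"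
proof (rule fps_ext)
  fix n
  have "fps_nth (A * B) n * r ^ n = (\<Sum>i=0..n. (fps_nth A i * r ^ i) * (fps_nth B (n - i) * r ^ (n - i)))"
    unfolding fps_mult_nth sum_distrib_right
  proof (intro sum.cong refl)
    fix i assume "i \<in> {0..n}"
    hence "r ^ n = r ^ i * r ^ (n - i)" by (simp flip: power_add)
    thus "fps_nth A i * fps_nth B (n - i) * r ^ n = (fps_nth A i * r ^ i) * (fps_nth B (n - i) * r ^ (n - i))"
      by (simp add: mult_ac)
  qed
  thus "fps_nth (scaled_fps r (A * B)) n = fps_nth (scaled_fps r A * scaled_fps r B) n"
    unfolding fps_mult_nth[of "scaled_fps r A"] by (simp add: scaled_fps_def del: of_real_mult) simp
qed

lemma scaled_fps_expansion:
  assumes "\<And>x. norm x < 1 \<Longrightarrow> (\<lambda>n. of_real (fps_nth A n * r ^ n) * x ^ n) sums f x"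
  shows "f has_fps_expansion scaled_fps r A"
proof (rule has_fps_expansionI)
  show "\<forall>\<^sub>F u in nhds 0. (\<lambda>n. fps_nth (scaled_fps r A) n * u ^ n) sums f u"
    using eventually_norm_less[OF zero_less_one]
    by eventually_elim (use assms in \<open>simp add: scaled_fps_def\<close>)
qed

context catastrophe_model
begin

abbreviation ec :: "nat \<Rightarrow> real" where "ec \<equiv> exc_coeff p q"

lemma F0_fps_expansion:
  assumes E: "\<And>x. norm x < 1 \<Longrightarrow> (\<lambda>n. of_real (mc n 0 * r ^ n) * x ^ n) sums Ef x"
    and Q: "\<And>x. norm x < 1 \<Longrightarrow> (\<lambda>n. of_real (Qc n * r ^ n) * x ^ n) sums Qf x"
  shows "(\<lambda>x. Ef x / (1 - Qf x)) has_fps_expansion scaled_fps r (F0_fps p q)"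
proof -
  have Q0: "fps_nth (1 - Q_fps p q) 0 = 1" using Qc_0 by (simp add: Qc_def)
  have E': "Ef has_fps_expansion scaled_fps r (Mk_fps p q 0)"
    by (rule scaled_fps_expansion) (use E in \<open>simp add: Mk_fps_def\<close>)
  have "Qf has_fps_expansion scaled_fps r (Q_fps p q)"
    by (rule scaled_fps_expansion) (use Q in \<open>simp add: Qc_def\<close>)
  hence "(\<lambda>x. 1 - Qf x) has_fps_expansion 1 - scaled_fps r (Q_fps p q)"
    by (intro fps_expansion_intros)
  also have "1 - scaled_fps r (Q_fps p q) = scaled_fps r (1 - Q_fps p q)"
    by (rule fps_ext) (simp add: scaled_fps_def left_diff_distrib)
  finally have Q': "(\<lambda>x. 1 - Qf x) has_fps_expansion scaled_fps r (1 - Q_fps p q)" .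
  have nz: "fps_nth (scaled_fps r (1 - Q_fps p q)) 0 \<noteq> 0" using Q0 by (simp add: scaled_fps_def)
  have "F0_fps p q * (1 - Q_fps p q) = (inverse (1 - Q_fps p q) * (1 - Q_fps p q)) * Mk_fps p q 0"
    by (simp only: F0_fps_def mult_ac)
  also have "inverse (1 - Q_fps p q) * (1 - Q_fps p q) = 1" using Q0 by (intro inverse_mult_eq_1) simp
  finally have "scaled_fps r (F0_fps p q) * scaled_fps r (1 - Q_fps p q) = scaled_fps r (Mk_fps p q 0)"
    by (simp flip: scaled_fps_mult)
  hence "scaled_fps r (F0_fps p q) * (scaled_fps r (1 - Q_fps p q) * inverse (scaled_fps r (1 - Q_fps p q))) =
      scaled_fps r (Mk_fps p q 0) * inverse (scaled_fps r (1 - Q_fps p q))"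
    by (simp only: mult.assoc[symmetric])
  hence eq: "scaled_fps r (F0_fps p q) = scaled_fps r (Mk_fps p q 0) * inverse (scaled_fps r (1 - Q_fps p q))"
    using inverse_mult_eq_1'[OF nz] by simp
  have "(\<lambda>x. Ef x * inverse (1 - Qf x)) has_fps_expansion scaled_fps r (F0_fps p q)"
    unfolding eq by (intro fps_expansion_intros E' Q' nz)
  thus ?thesis by (simp add: divide_inverse)
qed

lemma Qc_le: "Qc (Suc n) \<le> q * mtot p q n"
proof -
  have "0 \<le> mc n 0 + (\<Sum>j\<in>negset p. mc n j)" by (intro add_nonneg_nonneg sum_nonneg mc_nonneg)
  thus ?thesis unfolding Qc_Suc using q_pos by (intro mult_left_mono) auto
qed

text \<open>The pole can be isolated only if the series are controlled beyond it. For tau > 1 the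
  radius rho serves. Otherwise 1/P(1) does: M diverges there, so the point rho_0, where M converges,
  is strictly smaller.\<close>

lemma rho0_radius:
  assumes "is_rho0 c d p q r0" "r0 < \<rho>"
  obtains R C where "r0 < R" "\<And>n. mtot p q n * R ^ n \<le> C"
proof (cases "\<tau> > 1")
  case True
  thus ?thesis using that[of \<rho>] mtot_rho_le assms by blast
next
  case False
  hence ns: "\<not> summable (\<lambda>n. mtot p q n * (1 / Pr 1) ^ n)" by (intro not_summable_mtot) auto
  have r0: "0 < r0" "summable (\<lambda>n. mtot p q n * r0 ^ n)" using assms by (auto simp: is_rho0_def)
  have P1: "Pr 1 > 0" by (intro Pr_pos) auto
  have "r0 < 1 / Pr 1"
  proof (rule ccontr)
    assume "\<not> r0 < 1 / Pr 1"
    hence "summable (\<lambda>n. mtot p q n * (1 / Pr 1) ^ n)"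
      using P1 by (intro mtot_summable_mono[OF r0(2)]) auto
    thus False using ns by simp
  qed
  moreover have "mtot p q n * (1 / Pr 1) ^ n \<le> 1" for n
    using mtot_le[of n] P1 by (simp add: power_divide)
  ultimately show ?thesis using that by blast
qed

text \<open>After scaling the disc by \<open>R\<close>, positivity of the coefficients of Q makes x0
  = r0/R the only zero of 1 - Q in |x| <= x0, and Q' > 0 makes it simple. Subtracting the pole
  leaves a function holomorphic on a slightly larger disc, whose coefficients Cauchy's estimate
  bounds.\<close>

lemma simple_pole_case:
  assumes "is_rho0 c d p q r0" "r0 < \<rho>"
  shows "\<exists>K. 0 < K \<and> K < 1 / r0 \<and>
           (\<lambda>n. ec n - E_fun p q r0 / (r0 * deriv (Q_fun p q) r0) * (1 / r0) ^ n) \<in> o(\<lambda>n. K ^ n)"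
proof -
  have r0: "0 < r0" "summable (\<lambda>n. mtot p q n * r0 ^ n)" "Q_fun p q r0 = 1"
    using assms by (auto simp: is_rho0_def)
  obtain R C where R: "r0 < R" "\<And>n. mtot p q n * R ^ n \<le> C" using rho0_radius[OF assms] by blast
  have R0: "R > 0" using r0 R by simp
  define x0 where "x0 = r0 / R"
  have x0: "0 < x0" "x0 < 1" "R * x0 = r0" using r0 R by (auto simp: x0_def)
  have Cb: "C \<ge> 0" using R(2)[of 0] mtot_nonneg[of 0] by simp
  have bE: "\<bar>mc n 0 * R ^ n\<bar> \<le> C" for n
    using order_trans[OF mult_right_mono[OF mc_le_mtot[of n 0], of "R ^ n"] R(2)[of n]] mc_nonneg[of n 0] R0 by simp
  have bQ: "\<bar>Qc n * R ^ n\<bar> \<le> q * R * C" for n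
  proof (cases n)
    case (Suc k)
    have "Qc (Suc k) * R ^ Suc k \<le> q * mtot p q k * R ^ Suc k"
      using R0 by (intro mult_right_mono Qc_le) auto
    also have "\<dots> = q * R * (mtot p q k * R ^ k)" by simp
    also have "\<dots> \<le> q * R * C" using q_pos R0 R(2) by (intro mult_left_mono) auto
    finally show ?thesis using Qc_nonneg[of n] R0 Suc by (simp add: abs_mult)
  qed (use q_pos R0 Cb in \<open>simp add: Qc_0\<close>)
  define Ex where "Ex = (\<lambda>x. \<Sum>n. complex_of_real (mc n 0 * R ^ n) * x ^ n)"
  define Qx where "Qx = (\<lambda>x. \<Sum>n. complex_of_real (Qc n * R ^ n) * x ^ n)"
  have bE': "norm (complex_of_real (mc n 0 * R ^ n)) \<le> C" for n using bE[of n] by (simp only: norm_of_real)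
  have bQ': "norm (complex_of_real (Qc n * R ^ n)) \<le> q * R * C" for n using bQ[of n] by (simp only: norm_of_real)
  have Es: "(\<lambda>n. of_real (mc n 0 * R ^ n) * x ^ n) sums Ex x" if "norm x < 1" for x
    unfolding Ex_def by (intro summable_sums summable_norm_cancel[OF summable_bounded_coeffs[OF bE' that]])
  have Qs: "(\<lambda>n. of_real (Qc n * R ^ n) * x ^ n) sums Qx x" if "norm x < 1" for x
    unfolding Qx_def by (intro summable_sums summable_norm_cancel[OF summable_bounded_coeffs[OF bQ' that]])
  have holE: "Ex holomorphic_on ball 0 1" unfolding Ex_def by (rule power_series_holomorphic_disc[OF bE'])
  have holQ: "Qx holomorphic_on ball 0 1" unfolding Qx_def by (rule power_series_holomorphic_disc[OF bQ'])
  have nx0: "norm (complex_of_real x0) < 1" using x0 by simp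
  have Qsr: "(\<lambda>n. Qc n * R ^ n * x0 ^ n) sums 1"
    using Q_fun_sums[OF _ r0(2)] r0 by (simp add: mult.assoc flip: power_mult_distrib x0(3))
  have Qx0: "Qx (of_real x0) = 1"
    using sums_of_real[OF Qsr, where ?'a = complex] Qs[OF nx0] by (simp add: sums_iff)
  have Ex0: "Ex (of_real x0) = of_real (E_fun p q r0)"
  proof -
    have "(\<lambda>n. mc n 0 * r0 ^ n) sums E_fun p q r0"
      unfolding E_fun_def Mk_fun_def using r0 by (intro summable_sums mc_summable) auto
    hence "(\<lambda>n. mc n 0 * R ^ n * x0 ^ n) sums E_fun p q r0"
      by (simp add: mult.assoc flip: power_mult_distrib x0(3))
    from sums_of_real[OF this, where ?'a = complex] Es[OF nx0] show ?thesis by (simp add: sums_iff)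
  qed
  have only: "x = of_real x0" if "norm x \<le> x0" "Qx x = 1" for x
  proof (rule positive_series_eq_imp[of "\<lambda>n. Qc n * R ^ n" x0 x "Suc lag"])
    show "(\<lambda>n. complex_of_real (Qc n * R ^ n) * x ^ n) sums complex_of_real (\<Sum>n. Qc n * R ^ n * x0 ^ n)"
      using Qs[of x] that x0 Qsr by (simp add: sums_iff)
    show "0 < Qc (Suc lag) * R ^ Suc lag" "0 < Qc (Suc (Suc lag)) * R ^ Suc (Suc lag)"
      using Qc_pos[of 0] Qc_pos[of 1] R0 by auto
  qed (use x0 that R0 Qc_nonneg Qsr in \<open>auto simp: sums_iff\<close>)
  define D where "D = (\<Sum>n. diffs Qc n * r0 ^ n)"
  have "summable (\<lambda>n. Qc n * y ^ n)" if "norm y < R" for y :: real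
  proof (rule summable_comparison_test')
    show "summable (\<lambda>n. q * R * C * (\<bar>y\<bar> / R) ^ n)"
      using that R0 by (intro summable_mult summable_geometric) auto
    fix n
    have "norm (Qc n * y ^ n) = \<bar>Qc n * R ^ n\<bar> * (\<bar>y\<bar> / R) ^ n"
      using R0 by (simp add: abs_mult power_abs power_divide)
    also have "\<dots> \<le> q * R * C * (\<bar>y\<bar> / R) ^ n" using bQ[of n] R0 by (intro mult_right_mono) auto
    finally show "norm (Qc n * y ^ n) \<le> q * R * C * (\<bar>y\<bar> / R) ^ n" .
  qed
  hence Dr: "((\<lambda>z. \<Sum>n. Qc n * z ^ n) has_real_derivative D) (at r0)"
    unfolding D_def using r0 R by (intro termdiffs_strong'[of R]) auto
  have "(Q_fun p q has_real_derivative D) (at r0)"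
  proof (rule has_field_derivative_transform_within_open[OF Dr])
    show "r0 \<in> {0<..<R}" using r0 R by simp
    show "(\<Sum>n. Qc n * z ^ n) = Q_fun p q z" if z: "z \<in> {0<..<R}" for z
    proof -
      have "summable (\<lambda>n. mtot p q n * z ^ n)" using z by (intro mtot_summable_inside[OF R(2)]) auto
      thus ?thesis using Q_fun_sums[of z] z by (simp add: sums_iff)
    qed
  qed auto
  hence D: "deriv (Q_fun p q) r0 = D" by (rule DERIV_imp_deriv)
  have sD: "summable (\<lambda>n. diffs Qc n * r0 ^ n)"
    using r0 R \<open>\<And>y::real. norm y < R \<Longrightarrow> summable (\<lambda>n. Qc n * y ^ n)\<close>
    by (intro termdiff_converges[of r0 R]) auto
  have Dpos: "D > 0"
    unfolding D_def using sD r0 Qc_nonneg Qc_pos[of 0]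
    by (intro suminf_pos2[of _ lag]) (auto simp: diffs_def intro!: mult_nonneg_nonneg mult_pos_pos)
  have dQ: "(Qx has_field_derivative of_real (R * D)) (at (of_real x0))"
  proof -
    have "(\<lambda>n. R * (diffs Qc n * r0 ^ n)) sums (R * D)"
      unfolding D_def by (intro sums_mult summable_sums sD)
    from sums_of_real[OF this, where ?'a = complex]
    have "(\<lambda>n. of_nat (Suc n) * complex_of_real (Qc (Suc n) * R ^ Suc n) * of_real x0 ^ n) sums of_real (R * D)"
      by (simp add: diffs_def mult_ac power_mult_distrib flip: x0(3))
    hence "(\<Sum>n. of_nat (Suc n) * complex_of_real (Qc (Suc n) * R ^ Suc n) * of_real x0 ^ n) = of_real (R * D)"
      by (rule sums_unique[symmetric])
    moreover have "(Qx has_field_derivative (\<Sum>n. of_nat (Suc n) * complex_of_real (Qc (Suc n) * R ^ Suc n) * of_real x0 ^ n))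
        (at (of_real x0))"
      unfolding Qx_def by (rule power_series_deriv[OF bQ' nx0])
    ultimately show ?thesis by (simp only:)
  qed
  let ?x = "complex_of_real x0"
  \<comment> \<open>With its zero divided out, 1 - Q does not vanish on the closed disc of radius
    x0, hence by compactness not on a somewhat larger one either.\<close>
  define k where "k = (\<lambda>x. if x = ?x then deriv (\<lambda>x. 1 - Qx x) ?x else ((1 - Qx x) - (1 - Qx ?x)) / (x - ?x))"
  have holk: "k holomorphic_on ball 0 1"
    unfolding k_def using nx0 by (intro pole_lemma holomorphic_intros holQ) auto
  have "((\<lambda>x. 1 - Qx x) has_field_derivative - of_real (R * D)) (at ?x)"
    by (auto intro!: derivative_eq_intros dQ)
  hence kx0: "k ?x = - of_real (R * D)" by (simp add: k_def DERIV_imp_deriv)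
  have kmul: "1 - Qx x = k x * (x - ?x)" for x by (simp add: k_def Qx0)
  define U where "U = {x \<in> ball 0 1. k x \<noteq> 0}"
  have "open (ball 0 1 \<inter> k -` (-{0}))"
    using holk by (intro continuous_open_preimage holomorphic_on_imp_continuous_on) auto
  moreover have "ball 0 1 \<inter> k -` (-{0}) = U" by (auto simp: U_def)
  ultimately have "open U" by simp
  have sub: "cball 0 x0 \<subseteq> U"
  proof
    fix x :: complex assume "x \<in> cball 0 x0"
    hence x: "norm x \<le> x0" by simp
    have "k x \<noteq> 0"
    proof (cases "x = ?x")
      case False
      thus ?thesis using only[OF x] kmul[of x] by auto
    qed (use kx0 R0 Dpos in simp)
    thus "x \<in> U" using x x0 by (simp add: U_def)
  qed
  obtain e where e: "e > 0" "(\<Union>x\<in>cball 0 x0. ball x e) \<subseteq> U"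
    using compact_subset_open_imp_ball_epsilon_subset[OF compact_cball \<open>open U\<close> sub] by metis
  define x1 where "x1 = x0 + e / 2"
  have x1: "x0 < x1" using e by (simp add: x1_def)
  have sub1: "cball 0 x1 \<subseteq> U"
  proof
    fix x :: complex assume "x \<in> cball 0 x1"
    hence nx: "norm x \<le> x0 + e / 2" by (simp add: x1_def)
    show "x \<in> U"
    proof (cases "norm x \<le> x0")
      case False
      \<comment> \<open>The radial projection of x to the circle of radius x0, at distance |x| - x0
        < e.\<close>
      define y where "y = of_real (x0 / norm x) * x"
      have n0: "norm x > 0" using False x0 by linarith
      have "norm y = x0" using n0 x0 by (simp add: y_def norm_mult norm_divide)
      moreover have "dist y x < e"
      proof -
        have "y - x = of_real (x0 / norm x - 1) * x" by (simp add: y_def algebra_simps)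
        hence "dist y x = \<bar>x0 / norm x - 1\<bar> * norm x" by (simp only: dist_norm norm_mult norm_of_real)
        also have "\<dots> = norm x - x0" using False n0 by (simp add: abs_if field_simps)
        finally show ?thesis using nx e by simp
      qed
      ultimately have "y \<in> cball 0 x0" "x \<in> ball y e" by auto
      thus ?thesis using e(2) by blast
    qed (use sub in auto)
  qed
  define N where "N = (\<lambda>x. Ex x / k x)"
  have holN: "N holomorphic_on U"
    unfolding N_def using holE holk by (auto intro!: holomorphic_intros elim!: holomorphic_on_subset simp: U_def)
  define g where "g = (\<lambda>x. if x = ?x then deriv N ?x else (N x - N ?x) / (x - ?x))"
  have "?x \<in> U" using sub x0 by auto
  hence holg: "g holomorphic_on U"
    unfolding g_def using \<open>open U\<close> by (intro pole_lemma holN) (auto simp: interior_open)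
  \<comment> \<open>The polar part is N(x0) / (x - x0) = A / (1 - x/x0), whose coefficients, after
    undoing the scaling, are A r0^(-n).\<close>
  define A where "A = E_fun p q r0 / (r0 * D)"
  have NA: "N ?x = - of_real (A * x0)"
    using x0 by (simp add: N_def kx0 Ex0 A_def field_simps flip: x0(3))
  define G where "G = scaled_fps R (F0_fps p q) - Abs_fps (\<lambda>n. of_real (A * (1 / x0) ^ n))"
  have F: "(\<lambda>x. Ex x / (1 - Qx x)) has_fps_expansion scaled_fps R (F0_fps p q)"
    using Es Qs by (rule F0_fps_expansion)
  note near = eventually_norm_less[OF x0(1)]
  have "(\<lambda>x. N ?x / (x - ?x)) has_fps_expansion Abs_fps (\<lambda>n. of_real (A * (1 / x0) ^ n))"
  proof (rule has_fps_expansionI)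
    show "\<forall>\<^sub>F x in nhds 0. (\<lambda>n. fps_nth (Abs_fps (\<lambda>n. complex_of_real (A * (1 / x0) ^ n))) n * x ^ n) sums (N ?x / (x - ?x))"
      using near
    proof eventually_elim
      case (elim x)
      have "norm (x / ?x) < 1" using elim x0 by (simp add: norm_divide)
      hence "(\<lambda>n. of_real A * (x / ?x) ^ n) sums (of_real A * (1 / (1 - x / ?x)))"
        by (intro sums_mult geometric_sums)
      moreover have "of_real A * (1 / (1 - x / ?x)) = N ?x / (x - ?x)"
      proof -
        have "x \<noteq> ?x" using elim x0 by auto
        thus ?thesis using x0 by (simp add: NA divide_simps) (simp add: algebra_simps)
      qed
      ultimately show ?case by (simp add: power_divide mult_ac)
    qed
  qed
  hence "(\<lambda>x. Ex x / (1 - Qx x) - N ?x / (x - ?x)) has_fps_expansion G"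
    unfolding G_def by (intro fps_expansion_intros F)
  also have "?this \<longleftrightarrow> g has_fps_expansion G"
  proof (rule has_fps_expansion_cong)
    show "\<forall>\<^sub>F x in nhds 0. Ex x / (1 - Qx x) - N ?x / (x - ?x) = g x"
      using near
    proof eventually_elim
      case (elim x)
      have "x \<noteq> ?x" using elim x0 by auto
      thus ?case by (simp add: g_def kmul N_def diff_divide_distrib)
    qed
  qed simp
  finally have gG: "g has_fps_expansion G" .
  have x1pos: "x1 > 0" using x0 x1 by simp
  have cg: "continuous_on (cball 0 x1) g"
    using holg sub1 holomorphic_on_imp_continuous_on holomorphic_on_subset by blast
  then obtain B where B: "B > 0" "\<And>x. x \<in> cball 0 x1 \<Longrightarrow> norm (g x) \<le> B"
    using compact_continuous_image[OF cg compact_cball] bounded_pos[of "g ` cball 0 x1"] compact_imp_bounded by auto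
  have coeff: "\<bar>ec n - A * (1 / r0) ^ n\<bar> \<le> B * (1 / (R * x1)) ^ n" for n
  proof -
    have "norm ((deriv ^^ n) g 0) \<le> fact n * B / x1 ^ n"
      using holg sub1 cg x1pos B
      by (intro Cauchy_inequality) (auto elim!: holomorphic_on_subset)
    moreover have "fps_nth G n = (deriv ^^ n) g 0 / fact n" by (rule fps_nth_fps_expansion[OF gG])
    ultimately have "norm (fps_nth G n) \<le> B / x1 ^ n"
      by (simp add: norm_divide pos_divide_le_eq mult.commute)
    also have "fps_nth G n = of_real ((ec n - A * (1 / r0) ^ n) * R ^ n)"
      using R0 by (simp add: G_def scaled_fps_def exc_coeff_def x0_def power_divide left_diff_distrib)
    finally have "\<bar>ec n - A * (1 / r0) ^ n\<bar> * R ^ n \<le> B / x1 ^ n"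
      using R0 by (simp only: norm_of_real abs_mult) simp
    thus ?thesis using R0 x1pos by (simp add: power_divide power_mult_distrib field_simps)
  qed
  \<comment> \<open>Strictly between 1/(R x1) and 1/r0: the error O((1/(R x1))^n) thereby becomes
    o(K^n).\<close>
  define K where "K = 1 / (R * ((x0 + x1) / 2))"
  have Kpos: "K > 0" using R0 x0 x1 by (simp add: K_def)
  have "r0 < R * ((x0 + x1) / 2)" using x1 R0 x0(3) by (simp flip: x0(3))
  hence K1: "K < 1 / r0" unfolding K_def using r0 by (intro divide_strict_left_mono) auto
  have K2: "1 / (R * x1) < K" unfolding K_def using R0 x0 x1 by (intro divide_strict_left_mono) auto
  have "(\<lambda>n. ec n - A * (1 / r0) ^ n) \<in> O(\<lambda>n. (1 / (R * x1)) ^ n)"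
    using coeff R0 x1pos by (intro bigoI[of _ B] always_eventually allI) (simp add: abs_mult power_abs)
  also have "(\<lambda>n. (1 / (R * x1)) ^ n) \<in> o(\<lambda>n. K ^ n)"
  proof (rule smalloI_tendsto)
    have "(\<lambda>n. (1 / (R * x1) / K) ^ n) \<longlonglongrightarrow> 0"
      using K2 Kpos R0 x1pos by (intro LIMSEQ_power_zero) (simp add: field_simps)
    thus "(\<lambda>n. (1 / (R * x1)) ^ n / K ^ n) \<longlonglongrightarrow> 0" by (simp add: power_divide power_mult_distrib)
  qed (use Kpos in auto)
  finally show ?thesis using Kpos K1 by (auto simp: A_def D)
qed

end

subsection \<open>The critical and subcritical cases\<close>

context catastrophe_model
begin

lemma mc_rho: "mc n k * \<rho> ^ n = nm n k * \<tau> powi (-k)"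
  using tau_pos by (simp add: nm_def power_int_minus)

lemma mc_series_singularity:
  obtains G where "\<And>k. k \<ge> 0 \<Longrightarrow> G k analytic_on lobe"
    "\<And>k x. k \<ge> 0 \<Longrightarrow> norm x < 1 \<Longrightarrow> (\<lambda>n. of_real (mc n k * \<rho> ^ n) * x ^ n) sums G k (csqrt (1 - x))"
    "deriv (G 0) 0 = - of_real kappa * G 0 0" "G 0 0 \<noteq> 0"
proof -
  obtain G where G: "\<And>k. k \<ge> 0 \<Longrightarrow> G k analytic_on lobe"
    "\<And>k x. k \<ge> 0 \<Longrightarrow> norm x < 1 \<Longrightarrow> Mf k x = G k (csqrt (1 - x))"
    "deriv (G 0) 0 = - of_real kappa * G 0 0" "G 0 0 \<noteq> 0"
    using meander_singularity by blast
  show ?thesis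
  proof (rule that[of "\<lambda>k s. of_real (\<tau> powi (-k)) * G k s"])
    show "(\<lambda>s. of_real (\<tau> powi (-k)) * G k s) analytic_on lobe" if "k \<ge> 0" for k
      by (intro analytic_intros G that)
    show "(\<lambda>n. of_real (mc n k * \<rho> ^ n) * x ^ n) sums (of_real (\<tau> powi (-k)) * G k (csqrt (1 - x)))"
      if "k \<ge> 0" "norm x < 1" for k x
    proof -
      have "(\<lambda>n. of_real (\<tau> powi (-k)) * (of_real (nm n k) * x ^ n)) sums (of_real (\<tau> powi (-k)) * G k (csqrt (1 - x)))"
        using Mf_sums[OF that(2), of k] G(2)[OF that] by (intro sums_mult) simp
      thus ?thesis unfolding mc_rho by (simp add: mult_ac)
    qed
    have eq: "(\<lambda>s. of_real (\<tau> powi (-0)) * G 0 s) = G 0" by simp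
    show "deriv (\<lambda>s. of_real (\<tau> powi (-0)) * G 0 s) 0 = - of_real kappa * (of_real (\<tau> powi (-0)) * G 0 0)"
      unfolding eq using G(3) by simp
  qed (use G in auto)
qed

lemma mc_summable_rho: "summable (\<lambda>n. mc n k * \<rho> ^ n)"
proof (cases "k \<ge> 0")
  case True
  obtain G where G: "\<And>k. k \<ge> 0 \<Longrightarrow> G k analytic_on lobe"
    "\<And>k x. k \<ge> 0 \<Longrightarrow> norm x < 1 \<Longrightarrow> (\<lambda>n. of_real (mc n k * \<rho> ^ n) * x ^ n) sums G k (csqrt (1 - x))"
    "deriv (G 0) 0 = - of_real kappa * G 0 0" "G 0 0 \<noteq> 0"
    using mc_series_singularity by blast
  have "summable (\<lambda>n. \<bar>mc n k * \<rho> ^ n\<bar>)"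
    using G(1)[OF True] G(2)[OF True] by (rule lobe_series_summable)
  thus ?thesis by (rule summable_rabs_cancel)
qed (simp add: mc_neg)

text \<open>If no rho_0 exists, the intermediate value theorem keeps Q < 1 on (0, R), so the partial
  sums of Q at R are at most 1 and Q converges there. Solving the definition of Q for M, whose
  remaining terms E and M_j converge up to rho, would make M converge at R as well.\<close>

lemma exceeds_one_before:
  assumes ns: "\<not> summable (\<lambda>n. mtot p q n * R ^ n)" and R: "0 < R" "R \<le> \<rho>"
    and bound: "\<And>n. mtot p q n * R ^ n \<le> C"
  shows "\<exists>r. is_rho0 c d p q r"
proof (rule ccontr)
  assume no: "\<not> (\<exists>r. is_rho0 c d p q r)"
  note sm = mtot_summable_inside[OF bound]
  have lt1: "Q_fun p q z < 1" if z: "0 < z" "z < R" for z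
  proof (rule ccontr)
    assume "\<not> Q_fun p q z < 1"
    hence ge: "1 \<le> Q_fun p q z" by simp
    define f where "f = (\<lambda>y. \<Sum>n. Qc n * y ^ n)"
    have fQ: "f y = Q_fun p q y" if "0 \<le> y" "y < R" for y
      using Q_fun_sums[OF that(1) sm[OF that]] by (simp add: f_def sums_iff)
    have sQ: "summable (\<lambda>n. Qc n * y ^ n)" if "norm y < (z + R) / 2" for y :: real
    proof -
      have "summable (\<lambda>n. Qc n * ((z + R) / 2) ^ n)"
        using Q_fun_sums[of "(z + R) / 2"] sm[of "(z + R) / 2"] z by (auto simp: sums_iff)
      thus ?thesis by (rule powser_inside) (use that z in auto)
    qed
    have "continuous_on {0..z} f"
    proof (intro continuous_at_imp_continuous_on ballI)
      fix y assume y: "y \<in> {0..z}"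
      have "(f has_real_derivative (\<Sum>n. diffs Qc n * y ^ n)) (at y)"
        unfolding f_def by (rule termdiffs_strong'[of "(z + R) / 2", OF sQ]) (use y z in auto)
      thus "isCont f y" by (rule DERIV_isCont)
    qed
    moreover have "f 0 = 0" by (simp add: f_def Qc_0)
    moreover have "f z \<ge> 1" using fQ[of z] ge z by simp
    ultimately obtain y where y: "0 \<le> y" "y \<le> z" "f y = 1" using IVT'[of f 0 1 z] z by auto
    have "y \<noteq> 0" using y \<open>f 0 = 0\<close> by auto
    hence "is_rho0 c d p q y"
      using y z R fQ[of y] sm[of y] by (intro is_rho0I) auto
    thus False using no by blast
  qed
  have part: "(\<Sum>n<N. Qc n * R ^ n) \<le> 1" for N
  proof (rule tendsto_upperbound)
    show "((\<lambda>z. \<Sum>n<N. Qc n * z ^ n) \<longlongrightarrow> (\<Sum>n<N. Qc n * R ^ n)) (at_left R)" by (intro tendsto_intros)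
    have "\<forall>\<^sub>F z in at_left R. z \<in> {0<..<R}" using R by (intro eventually_at_left_field[THEN iffD2]) auto
    thus "\<forall>\<^sub>F z in at_left R. (\<Sum>n<N. Qc n * z ^ n) \<le> 1"
    proof eventually_elim
      case (elim z)
      hence s: "(\<lambda>n. Qc n * z ^ n) sums Q_fun p q z" using sm[of z] by (intro Q_fun_sums) auto
      have "(\<Sum>n<N. Qc n * z ^ n) \<le> (\<Sum>n. Qc n * z ^ n)"
        using s elim Qc_nonneg by (intro sum_le_suminf) (auto simp: sums_iff)
      thus ?case using s lt1[of z] elim by (simp add: sums_iff)
    qed
  qed simp
  have sQ: "summable (\<lambda>n. Qc n * R ^ n)"
    by (rule bounded_imp_summable[of _ 1]) (use part Qc_nonneg R in \<open>auto simp: lessThan_Suc_atMost[symmetric] simp del: sum.lessThan_Suc\<close>)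
  have sk: "summable (\<lambda>n. mc n k * R ^ n)" for k
    by (rule summable_comparison_test'[OF mc_summable_rho[of k]])
      (use R mc_nonneg in \<open>auto simp: abs_mult intro!: mult_left_mono power_mono\<close>)
  have "summable (\<lambda>n. Qc (Suc n) * R ^ Suc n)" using sQ by (subst summable_Suc_iff)
  hence "summable (\<lambda>n. Qc (Suc n) * R ^ Suc n * (1 / (q * R)) + mc n 0 * R ^ n + (\<Sum>j\<in>negset p. mc n j * R ^ n))"
    by (intro summable_add summable_sum summable_mult2 sk)
  moreover have "Qc (Suc n) * R ^ Suc n * (1 / (q * R)) + mc n 0 * R ^ n + (\<Sum>j\<in>negset p. mc n j * R ^ n) = mtot p q n * R ^ n" for n
  proof -
    have "Qc (Suc n) * R ^ Suc n * (1 / (q * R)) = (mtot p q n - mc n 0 - (\<Sum>j\<in>negset p. mc n j)) * R ^ n"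
      using q_pos R by (simp add: Qc_Suc)
    thus ?thesis by (simp add: left_diff_distrib sum_distrib_right)
  qed
  ultimately show False using ns by simp
qed

text \<open>For tau > 1 every ingredient of Q is analytic in s. The series are identified on the
  closed disc, including x = 1, because the later cases need the zeros of 1 - Q on the boundary
  circle too.\<close>

lemma critical_functions:
  assumes \<tau>: "\<tau> > 1"
  obtains G0 GQ where "G0 analytic_on lobe" "GQ analytic_on lobe"
    "\<And>x. norm x \<le> 1 \<Longrightarrow> (\<lambda>n. of_real (mc n 0 * \<rho> ^ n) * x ^ n) sums G0 (csqrt (1 - x))"
    "\<And>x. norm x \<le> 1 \<Longrightarrow> (\<lambda>n. of_real (Qc n * \<rho> ^ n) * x ^ n) sums GQ (csqrt (1 - x))"
    "G0 0 = of_real (E_fun p q \<rho>)" "GQ 0 = of_real (Q_fun p q \<rho>)" "E_fun p q \<rho> > 0"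
    "deriv G0 0 = of_real (- kappa * E_fun p q \<rho>)"
    "deriv GQ 0 = of_real (- eta c d p q)" "eta c d p q > 0"
    "summable (\<lambda>n. mtot p q n * \<rho> ^ n)"
proof -
  obtain G where G: "\<And>k. k \<ge> 0 \<Longrightarrow> G k analytic_on lobe"
    "\<And>k x. k \<ge> 0 \<Longrightarrow> norm x < 1 \<Longrightarrow> (\<lambda>n. of_real (mc n k * \<rho> ^ n) * x ^ n) sums G k (csqrt (1 - x))"
    "deriv (G 0) 0 = - of_real kappa * G 0 0" "G 0 0 \<noteq> 0"
    using mc_series_singularity by blast
  obtain GM where GM: "GM analytic_on lobe"
    "\<And>x. norm x < 1 \<Longrightarrow> (\<lambda>n. of_real (mtot p q n * \<rho> ^ n) * x ^ n) sums GM (csqrt (1 - x))"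
    using mtot_singularity[OF \<tau>] by blast
  have "summable (\<lambda>n. \<bar>mtot p q n * \<rho> ^ n\<bar>)" using GM by (rule lobe_series_summable)
  hence sM: "summable (\<lambda>n. mtot p q n * \<rho> ^ n)" by (rule summable_rabs_cancel)
  have neg: "j \<ge> 0" if "j \<in> negset p" for j using that by (simp add: negset_def)
  define GQ where "GQ = (\<lambda>s. of_real (\<rho> * q) * (1 - s\<^sup>2) * (GM s - G 0 s - (\<Sum>j\<in>negset p. G j s)))"
  have anQ: "GQ analytic_on lobe" unfolding GQ_def by (intro analytic_intros GM G) (auto intro: neg)
  have Qs: "(\<lambda>n. of_real (Qc n * \<rho> ^ n) * x ^ n) sums GQ (csqrt (1 - x))" if x: "norm x < 1" for x
  proof -
    let ?s = "csqrt (1 - x)"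
    have "(\<lambda>n. of_real (\<rho> * q) * x * (of_real (mtot p q n * \<rho> ^ n) * x ^ n - of_real (mc n 0 * \<rho> ^ n) * x ^ n
        - (\<Sum>j\<in>negset p. of_real (mc n j * \<rho> ^ n) * x ^ n))) sums
      (of_real (\<rho> * q) * x * (GM ?s - G 0 ?s - (\<Sum>j\<in>negset p. G j ?s)))"
      using neg x by (intro sums_mult sums_diff sums_sum GM G) auto
    also have "(\<lambda>n. of_real (\<rho> * q) * x * (of_real (mtot p q n * \<rho> ^ n) * x ^ n - of_real (mc n 0 * \<rho> ^ n) * x ^ n
        - (\<Sum>j\<in>negset p. of_real (mc n j * \<rho> ^ n) * x ^ n))) = (\<lambda>n. of_real (Qc (Suc n) * \<rho> ^ Suc n) * x ^ Suc n)"
      by (simp add: Qc_Suc fun_eq_iff algebra_simps sum_distrib_left sum_distrib_right)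
    also have "of_real (\<rho> * q) * x * (GM ?s - G 0 ?s - (\<Sum>j\<in>negset p. G j ?s)) = GQ ?s"
      by (simp add: GQ_def)
    finally have "(\<lambda>n. of_real (Qc (Suc n) * \<rho> ^ Suc n) * x ^ Suc n) sums GQ ?s" .
    hence "(\<lambda>n. of_real (Qc n * \<rho> ^ n) * x ^ n) sums (GQ ?s + of_real (Qc 0 * \<rho> ^ 0) * x ^ 0)"
      by (rule iffD1[OF sums_Suc_iff])
    thus ?thesis by (simp add: Qc_0)
  qed
  have E1: "(\<lambda>n. of_real (mc n 0 * \<rho> ^ n) * x ^ n) sums G 0 (csqrt (1 - x))" if "norm x \<le> 1" for x
    using G(1)[OF order_refl] G(2)[OF order_refl] that by (rule lobe_series_closed_disc)
  have Q1: "(\<lambda>n. of_real (Qc n * \<rho> ^ n) * x ^ n) sums GQ (csqrt (1 - x))" if "norm x \<le> 1" for x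
    using anQ Qs that by (rule lobe_series_closed_disc)
  have "(\<lambda>n. complex_of_real (mc n 0 * \<rho> ^ n)) sums G 0 0" using E1[of 1] by simp
  moreover have Es: "(\<lambda>n. mc n 0 * \<rho> ^ n) sums E_fun p q \<rho>"
    unfolding E_fun_def Mk_fun_def by (intro summable_sums mc_summable_rho)
  ultimately have E0: "G 0 0 = of_real (E_fun p q \<rho>)"
    using sums_unique2 sums_of_real by blast
  have "(\<lambda>n. complex_of_real (Qc n * \<rho> ^ n)) sums GQ 0" using Q1[of 1] by simp
  moreover have "(\<lambda>n. Qc n * \<rho> ^ n) sums Q_fun p q \<rho>" using rho_pos sM by (intro Q_fun_sums) auto
  ultimately have Q0: "GQ 0 = of_real (Q_fun p q \<rho>)"
    using sums_unique2 sums_of_real by blast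
  have "E_fun p q \<rho> \<ge> 0"
    using suminf_nonneg[of "\<lambda>n. mc n 0 * \<rho> ^ n"] Es mc_nonneg rho_pos by (simp add: sums_iff)
  hence Epos: "E_fun p q \<rho> > 0" using G(4) E0 by (cases "E_fun p q \<rho> = 0") auto
  have expQ: "(\<lambda>x. GQ (csqrt (1 - x))) has_fps_expansion Abs_fps (\<lambda>n. of_real (Qc n * \<rho> ^ n))"
    using scaled_fps_expansion[of "Q_fps p q" \<rho> "\<lambda>x. GQ (csqrt (1 - x))"] Qs
    by (simp add: scaled_fps_def Qc_def)
  have expE: "(\<lambda>x. G 0 (csqrt (1 - x))) has_fps_expansion Abs_fps (\<lambda>n. of_real (mc n 0 * \<rho> ^ n))"
    using scaled_fps_expansion[of "Mk_fps p q 0" \<rho> "\<lambda>x. G 0 (csqrt (1 - x))"] G(2)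
    by (simp add: scaled_fps_def Mk_fps_def)
  define \<eta> where "\<eta> = - Re (deriv GQ 0)"
  have d\<eta>: "deriv GQ 0 = of_real (- \<eta>)" using lobe_series_coeffs(2)[OF anQ expQ] by (simp add: \<eta>_def)
  have dE: "deriv (G 0) 0 = of_real (- kappa * E_fun p q \<rho>)" using G(3) E0 by simp
  have limQ: "(\<lambda>n. Qc n * \<rho> ^ n * real n powr (3/2)) \<longlonglongrightarrow> \<eta> / (2 * sqrt pi)"
    using sqrt_type_limit[OF lobe_series_coeffs(1)[OF anQ expQ]] by (simp add: \<eta>_def)
  have limE: "(\<lambda>n. mc n 0 * \<rho> ^ n * real n powr (3/2)) \<longlonglongrightarrow> kappa * E_fun p q \<rho> / (2 * sqrt pi)"
    using sqrt_type_limit[OF lobe_series_coeffs(1)[OF G(1) expE]] dE by simp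
  \<comment> \<open>Coefficients of Q and E, multiplied by rho^n n^(3/2), tend to eta / (2 sqrt pi)
    and kappa E(rho) / (2 sqrt pi). By \<open>Qc_ge_mc0\<close> the first limit is at least a
    positive multiple \<open>C\<close> of the second.\<close>
  have \<eta>pos: "\<eta> > 0"
  proof -
    define C where "C = q * p d ^ lag * \<rho> ^ Suc lag"
    have C: "C > 0" using q_pos p_right_pos rho_pos by (simp add: C_def)
    have le: "C * (mc n 0 * \<rho> ^ n * real n powr (3/2)) \<le>
        Qc (n + Suc lag) * \<rho> ^ (n + Suc lag) * real (n + Suc lag) powr (3/2)" for n
    proof -
      have "C * (mc n 0 * \<rho> ^ n) = q * (p d ^ lag * mc n 0) * \<rho> ^ (n + Suc lag)"
        by (simp add: C_def power_add mult_ac)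
      also have "\<dots> \<le> Qc (n + Suc lag) * \<rho> ^ (n + Suc lag)"
        using Qc_ge_mc0[of n] rho_pos by (intro mult_right_mono) auto
      finally have AB: "C * (mc n 0 * \<rho> ^ n) \<le> Qc (n + Suc lag) * \<rho> ^ (n + Suc lag)" .
      have "C * (mc n 0 * \<rho> ^ n) * real n powr (3/2) \<le> Qc (n + Suc lag) * \<rho> ^ (n + Suc lag) * real (n + Suc lag) powr (3/2)"
        by (rule mult_mono[OF AB powr_mono2]) (use Qc_nonneg rho_pos in auto)
      thus ?thesis by (simp add: mult.assoc)
    qed
    have "C * (kappa * E_fun p q \<rho> / (2 * sqrt pi)) \<le> \<eta> / (2 * sqrt pi)"
      by (rule LIMSEQ_le[OF tendsto_mult_left[OF limE] LIMSEQ_ignore_initial_segment[OF limQ, of "Suc lag"]])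
        (use le in blast)
    moreover have "0 < C * (kappa * E_fun p q \<rho> / (2 * sqrt pi))" using C kappa_pos Epos by simp
    ultimately have "0 < \<eta> / (2 * sqrt pi)" by linarith
    thus ?thesis by (simp add: zero_less_divide_iff)
  qed
  \<comment> \<open>Existence is the expansion to order s^2, with s^2 = 1 - z/rho. For uniqueness,
    two admissible values differ by a multiple of s that is O(s^2) as s tends to 0.\<close>
  have eta: "eta c d p q = \<eta>"
    unfolding eta_def
  proof (rule the_equality)
    obtain H1 where H1: "H1 analytic_on lobe" "\<And>s. GQ s = GQ 0 + s * H1 s" "H1 0 = deriv GQ 0"
      using analytic_lobe_peel[OF anQ] by blast
    obtain H2 where H2: "H2 analytic_on lobe" "\<And>s. H1 s = H1 0 + s * H2 s"
      using analytic_lobe_peel[OF H1(1)] by blast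
    obtain B where B: "B > 0" "\<And>s. s \<in> lobe \<Longrightarrow> norm (H2 s) \<le> B"
      using analytic_lobe_bounded[OF H2(1)] by blast
    have ev: "\<forall>\<^sub>F z in at_left \<rho>. z \<in> {0<..<\<rho>}" using rho_pos by (intro eventually_at_left_field[THEN iffD2]) auto
    show "(\<lambda>z. Q_fun p q z - (Q_fun p q \<rho> - \<eta> * sqrt (1 - z / \<rho>))) \<in> O[at_left \<rho>](\<lambda>z. 1 - z / \<rho>)"
    proof (rule bigoI[of _ B])
      show "\<forall>\<^sub>F z in at_left \<rho>. norm (Q_fun p q z - (Q_fun p q \<rho> - \<eta> * sqrt (1 - z / \<rho>))) \<le> B * norm (1 - z / \<rho>)"
        using ev
      proof eventually_elim
        case (elim z)
        define x where "x = z / \<rho>"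
        have x: "0 < x" "x < 1" using elim by (auto simp: x_def)
        define s where "s = sqrt (1 - x)"
        have s: "csqrt (1 - of_real x) = of_real s"
          using x of_real_sqrt[of "1 - x"] by (simp add: s_def)
        have "summable (\<lambda>n. mtot p q n * z ^ n)" using elim by (intro mtot_summable_mono[OF sM]) auto
        hence "(\<lambda>n. Qc n * z ^ n) sums Q_fun p q z" using elim by (intro Q_fun_sums) auto
        hence "(\<lambda>n. Qc n * \<rho> ^ n * x ^ n) sums Q_fun p q z"
          using rho_pos by (simp add: x_def power_divide)
        from sums_of_real[OF this, where ?'a = complex]
        have "(\<lambda>n. of_real (Qc n * \<rho> ^ n) * of_real x ^ n) sums complex_of_real (Q_fun p q z)" by simp
        moreover have "(\<lambda>n. of_real (Qc n * \<rho> ^ n) * complex_of_real x ^ n) sums GQ (of_real s)"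
          using Qs[of "of_real x"] x s by simp
        ultimately have "complex_of_real (Q_fun p q z) = GQ (of_real s)" by (rule sums_unique2)
        also have "\<dots> = GQ 0 + of_real s * (deriv GQ 0 + of_real s * H2 (of_real s))"
          by (subst H1(2), subst H2(2), subst H1(3)) simp
        finally have "complex_of_real (Q_fun p q z - (Q_fun p q \<rho> - \<eta> * s)) = of_real (s\<^sup>2) * H2 (of_real s)"
          by (simp add: Q0 d\<eta> algebra_simps power2_eq_square)
        hence "\<bar>Q_fun p q z - (Q_fun p q \<rho> - \<eta> * s)\<bar> = s\<^sup>2 * norm (H2 (of_real s))"
          by (metis norm_mult norm_of_real abs_power2)
        also have "\<dots> \<le> s\<^sup>2 * B"
          using B(2)[OF csqrt_in_lobe[of "of_real x", unfolded s]] x by (intro mult_left_mono) auto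
        also have "s\<^sup>2 = 1 - x" using x by (simp add: s_def)
        finally show ?case using x by (simp add: s_def x_def mult.commute)
      qed
    qed
    fix \<eta>' assume *: "(\<lambda>z. Q_fun p q z - (Q_fun p q \<rho> - \<eta>' * sqrt (1 - z / \<rho>))) \<in> O[at_left \<rho>](\<lambda>z. 1 - z / \<rho>)"
    have "(\<lambda>z. (Q_fun p q z - (Q_fun p q \<rho> - \<eta>' * sqrt (1 - z / \<rho>))) -
        (Q_fun p q z - (Q_fun p q \<rho> - \<eta> * sqrt (1 - z / \<rho>)))) \<in> O[at_left \<rho>](\<lambda>z. 1 - z / \<rho>)"
      by (intro sum_in_bigo * \<open>(\<lambda>z. Q_fun p q z - (Q_fun p q \<rho> - \<eta> * sqrt (1 - z / \<rho>))) \<in> O[at_left \<rho>](\<lambda>z. 1 - z / \<rho>)\<close>)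
    then obtain C where C: "C > 0" "\<forall>\<^sub>F z in at_left \<rho>. norm ((Q_fun p q z - (Q_fun p q \<rho> - \<eta>' * sqrt (1 - z / \<rho>))) -
        (Q_fun p q z - (Q_fun p q \<rho> - \<eta> * sqrt (1 - z / \<rho>)))) \<le> C * norm (1 - z / \<rho>)"
      by (rule landau_o.bigE)
    have "\<bar>\<eta>' - \<eta>\<bar> \<le> C * sqrt (1 - \<rho> / \<rho>)"
    proof (rule tendsto_lowerbound)
      show "((\<lambda>z. C * sqrt (1 - z / \<rho>)) \<longlongrightarrow> C * sqrt (1 - \<rho> / \<rho>)) (at_left \<rho>)"
        using rho_pos by (intro tendsto_intros) auto
      show "\<forall>\<^sub>F z in at_left \<rho>. \<bar>\<eta>' - \<eta>\<bar> \<le> C * sqrt (1 - z / \<rho>)"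
        using C(2) ev
      proof eventually_elim
        case (elim z)
        define s where "s = sqrt (1 - z / \<rho>)"
        have s: "s > 0" "1 - z / \<rho> = s * s" using elim by (auto simp: s_def)
        have "\<bar>\<eta>' - \<eta>\<bar> * s = \<bar>(\<eta>' - \<eta>) * s\<bar>" using s by (simp add: abs_mult)
        also have "\<dots> \<le> C * (s * s)" using elim(1) s by (simp add: algebra_simps flip: s_def)
        finally show ?case using s by (simp flip: s_def mult.assoc)
      qed
    qed simp
    thus "\<eta>' = \<eta>" using rho_pos by simp
  qed
  show ?thesis
    by (rule that[of "G 0" GQ]) (use G anQ E1 Q1 E0 Q0 Epos dE d\<eta> eta \<eta>pos sM in auto)
qed

text \<open>For tau <= 1 the series M diverges at 1/P(1) <= rho. This contradicts convergence at rho
  in the first case and yields some rho_0 by \<open>exceeds_one_before\<close> in the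
  second.\<close>

lemma critical_tau_gt_1:
  assumes "is_rho0 c d p q \<rho> \<or> (\<nexists>\<rho>0. is_rho0 c d p q \<rho>0)"
  shows "\<tau> > 1"
proof (rule ccontr)
  assume "\<not> \<tau> > 1"
  hence ns: "\<not> summable (\<lambda>n. mtot p q n * (1 / Pr 1) ^ n)" by (intro not_summable_mtot) auto
  have P1: "Pr 1 > 0" by (intro Pr_pos) auto
  from assms show False
  proof
    assume "is_rho0 c d p q \<rho>"
    hence "summable (\<lambda>n. mtot p q n * \<rho> ^ n)" by (simp add: is_rho0_def)
    hence "summable (\<lambda>n. mtot p q n * (1 / Pr 1) ^ n)"
      using P1 inverse_Pr_1_le by (rule_tac mtot_summable_mono) auto
    thus False using ns by simp
  next
    have "mtot p q n * (1 / Pr 1) ^ n \<le> 1" for n using mtot_le[of n] P1 by (simp add: power_divide)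
    moreover assume "\<nexists>\<rho>0. is_rho0 c d p q \<rho>0"
    ultimately show False using exceeds_one_before[OF ns _ inverse_Pr_1_le] P1 by auto
  qed
qed

lemma Q_rho_lt_1:
  assumes no: "\<nexists>\<rho>0. is_rho0 c d p q \<rho>0"
  shows "Q_fun p q \<rho> < 1"
proof -
  have \<tau>: "\<tau> > 1" using no by (intro critical_tau_gt_1) auto
  have sM: "summable (\<lambda>n. mtot p q n * \<rho> ^ n)" using critical_functions[OF \<tau>] by metis
  have s: "(\<lambda>n. Qc n * \<rho> ^ n) sums Q_fun p q \<rho>" using rho_pos sM by (intro Q_fun_sums) auto
  note sz = mtot_summable_mono[OF sM]
  define f where "f = (\<lambda>y. \<Sum>n. Qc n * y ^ n)"
  have fQ: "f y = Q_fun p q y" if "0 \<le> y" "y \<le> \<rho>" for y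
    using Q_fun_sums[OF that(1) sz[OF that]] by (simp add: f_def sums_iff)
  have "uniform_limit {0..\<rho>} (\<lambda>n y. \<Sum>i<n. Qc i * y ^ i) f sequentially"
    unfolding f_def using s Qc_nonneg
    by (intro Weierstrass_m_test[where M = "\<lambda>n. Qc n * \<rho> ^ n"])
      (auto simp: sums_iff abs_mult power_abs intro!: mult_left_mono power_mono)
  hence cont: "continuous_on {0..\<rho>} f"
    by (intro uniform_limit_theorem) (auto intro!: always_eventually continuous_intros)
  show ?thesis
  proof (rule ccontr)
    assume "\<not> ?thesis"
    hence "f \<rho> \<ge> 1" using fQ[of \<rho>] rho_pos by simp
    moreover have "f 0 = 0" by (simp add: f_def Qc_0)
    ultimately obtain y where y: "0 \<le> y" "y \<le> \<rho>" "f y = 1" using IVT'[of f 0 1 \<rho>] cont rho_pos by auto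
    have "y \<noteq> 0" using y \<open>f 0 = 0\<close> by auto
    hence "is_rho0 c d p q y" using y fQ[of y] sz[of y] by (intro is_rho0I) auto
    thus False using no by blast
  qed
qed

lemma scaled_F0: "scaled_fps \<rho> (F0_fps p q) = Abs_fps (\<lambda>n. of_real (ec n * \<rho> ^ n))"
  by (simp add: scaled_fps_def exc_coeff_def)

text \<open>On the closed disc |Q| <= Q(rho) < 1, so E / (1 - Q) is analytic on \<open>lobe\<close>.
  The quotient rule at s = 0, with E' = -kappa E and Q' = -eta as functions of s, yields the
  constant.\<close>

lemma no_rho0_case:
  assumes no: "\<nexists>\<rho>0. is_rho0 c d p q \<rho>0"
  shows "\<exists>r. r \<in> O(\<lambda>n. 1 / real n) \<and>
     (\<forall>\<^sub>F n in at_top. ec n = F0_fun p q \<rho> / 2 * (kappa + eta c d p q * D_fun p q \<rho>)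
        * (1 / \<rho>) ^ n / sqrt (pi * real n ^ 3) * (1 + r n))"
proof -
  have \<tau>: "\<tau> > 1" using no by (intro critical_tau_gt_1) auto
  obtain G0 GQ where G: "G0 analytic_on lobe" "GQ analytic_on lobe"
    and s0: "\<And>x. norm x \<le> 1 \<Longrightarrow> (\<lambda>n. of_real (mc n 0 * \<rho> ^ n) * x ^ n) sums G0 (csqrt (1 - x))"
    and sQ: "\<And>x. norm x \<le> 1 \<Longrightarrow> (\<lambda>n. of_real (Qc n * \<rho> ^ n) * x ^ n) sums GQ (csqrt (1 - x))"
    and v: "G0 0 = of_real (E_fun p q \<rho>)" "GQ 0 = of_real (Q_fun p q \<rho>)" "E_fun p q \<rho> > 0"
    "deriv G0 0 = of_real (- kappa * E_fun p q \<rho>)" "deriv GQ 0 = of_real (- eta c d p q)" "eta c d p q > 0"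
    by (rule critical_functions[OF \<tau>]) blast
  have Q1: "Q_fun p q \<rho> < 1" by (rule Q_rho_lt_1[OF no])
  have sQr: "(\<lambda>n. Qc n * \<rho> ^ n) sums Q_fun p q \<rho>"
    using sQ[of 1] v(2) by (simp add: sums_of_real_iff flip: of_real_power of_real_mult)
  have nz: "1 - GQ s \<noteq> 0" if s: "s \<in> lobe" for s
  proof -
    define x where "x = 1 - s\<^sup>2"
    have x: "norm x \<le> 1" using s by (simp add: lobe_def x_def)
    have "csqrt (1 - x) = s" using csqrt_lobe[OF s] by (simp add: x_def)
    hence GQs: "(\<lambda>n. of_real (Qc n * \<rho> ^ n) * x ^ n) sums GQ s" using sQ[OF x] by simp
    have le: "norm (complex_of_real (Qc n * \<rho> ^ n) * x ^ n) \<le> Qc n * \<rho> ^ n" for n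
      using x Qc_nonneg[of n] rho_pos by (simp add: norm_mult norm_power mult_left_le power_le_one)
    have "norm (\<Sum>n. complex_of_real (Qc n * \<rho> ^ n) * x ^ n) \<le> (\<Sum>n. Qc n * \<rho> ^ n)"
      by (rule norm_suminf_le[OF le]) (use sQr in \<open>simp add: sums_iff\<close>)
    hence "norm (GQ s) \<le> Q_fun p q \<rho>"
      unfolding sums_unique[OF GQs, symmetric] sums_unique[OF sQr, symmetric] .
    thus ?thesis using Q1 by auto
  qed
  define H where "H = (\<lambda>s. G0 s / (1 - GQ s))"
  have anH: "H analytic_on lobe" unfolding H_def using nz by (intro analytic_intros G) auto
  have "(\<lambda>x. G0 (csqrt (1 - x)) / (1 - GQ (csqrt (1 - x)))) has_fps_expansion scaled_fps \<rho> (F0_fps p q)"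
    by (rule F0_fps_expansion) (use s0 sQ in auto)
  hence exp: "(\<lambda>x. H (csqrt (1 - x))) has_fps_expansion Abs_fps (\<lambda>n. of_real (ec n * \<rho> ^ n))"
    by (simp add: H_def scaled_F0)
  have d: "(G0 has_field_derivative deriv G0 0) (at 0)" "(GQ has_field_derivative deriv GQ 0) (at 0)"
    using G by (auto intro: analytic_lobe_has_deriv)
  have "(H has_field_derivative (deriv G0 0 * (1 - GQ 0) - G0 0 * (0 - deriv GQ 0)) / ((1 - GQ 0) * (1 - GQ 0))) (at 0)"
    unfolding H_def using nz[of 0] by (intro derivative_intros d) auto
  hence "deriv H 0 = (deriv G0 0 * (1 - GQ 0) - G0 0 * (0 - deriv GQ 0)) / ((1 - GQ 0) * (1 - GQ 0))"
    by (rule DERIV_imp_deriv)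
  also have "\<dots> = of_real (- (F0_fun p q \<rho> * (kappa + eta c d p q * D_fun p q \<rho>)))"
  proof -
    define w where "w = 1 - Q_fun p q \<rho>"
    have w: "w \<noteq> 0" "1 - complex_of_real (Q_fun p q \<rho>) = of_real w" using Q1 by (auto simp: w_def)
    have "(- kappa * E_fun p q \<rho> * w - E_fun p q \<rho> * eta c d p q) / (w * w) =
        - (F0_fun p q \<rho> * (kappa + eta c d p q * D_fun p q \<rho>))"
      using w(1) by (simp add: F0_fun_def D_fun_def field_simps flip: w_def)
    thus ?thesis unfolding v w(2) by (simp flip: of_real_mult of_real_diff of_real_divide of_real_minus)
  qed
  finally have Hd: "Re (deriv H 0) = - (F0_fun p q \<rho> * (kappa + eta c d p q * D_fun p q \<rho>))" by simp
  have "D_fun p q \<rho> > 0" using Q1 by (simp add: D_fun_def)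
  moreover from this have "F0_fun p q \<rho> > 0" using v by (simp add: F0_fun_def)
  ultimately have pos: "F0_fun p q \<rho> * (kappa + eta c d p q * D_fun p q \<rho>) > 0"
    using v(6) kappa_pos by (intro mult_pos_pos add_pos_pos) auto
  have "\<exists>r. r \<in> O(\<lambda>n. 1 / real n) \<and> (\<forall>\<^sub>F n in at_top. ec n * \<rho> ^ n =
      (- Re (deriv H 0) / 2) / sqrt (pi * real n ^ 3) * (1 + r n))"
    by (rule sqrt_type_asymp[OF lobe_series_coeffs(1)[OF anH exp]]) (use Hd pos in auto)
  then obtain r where r: "r \<in> O(\<lambda>n. 1 / real n)"
    "\<forall>\<^sub>F n in at_top. ec n * \<rho> ^ n = (- Re (deriv H 0) / 2) / sqrt (pi * real n ^ 3) * (1 + r n)" by blast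
  have "\<forall>\<^sub>F n in at_top. ec n = F0_fun p q \<rho> / 2 * (kappa + eta c d p q * D_fun p q \<rho>)
        * (1 / \<rho>) ^ n / sqrt (pi * real n ^ 3) * (1 + r n)"
    using r(2)
  proof eventually_elim
    case (elim n)
    have "ec n = (ec n * \<rho> ^ n) * (1 / \<rho>) ^ n" using rho_pos by (simp add: power_divide)
    thus ?case unfolding elim Hd by simp
  qed
  thus ?thesis using r(1) by blast
qed

text \<open>Now 1 - Q = -s L(s) with L(0) = -eta, and \<open>L\<close> has no zero on
  \<open>lobe\<close> because Q = 1 on the closed disc only at x = 1. Hence E / (1 - Q) =
  (E(rho)/eta) / s + H1(s), where \<open>H1\<close> contributes O(n^(-3/2)), a relative error
  O(1/n).\<close>

lemma rho0_eq_rho_case: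
  assumes crit: "is_rho0 c d p q \<rho>"
  shows "\<exists>r. r \<in> O(\<lambda>n. 1 / real n) \<and>
     (\<forall>\<^sub>F n in at_top. ec n = E_fun p q \<rho> / eta c d p q * (1 / \<rho>) ^ n / sqrt (pi * real n) * (1 + r n))"
proof -
  have \<tau>: "\<tau> > 1" using crit by (intro critical_tau_gt_1) auto
  obtain G0 GQ where G: "G0 analytic_on lobe" "GQ analytic_on lobe"
    and s0: "\<And>x. norm x \<le> 1 \<Longrightarrow> (\<lambda>n. of_real (mc n 0 * \<rho> ^ n) * x ^ n) sums G0 (csqrt (1 - x))"
    and sQ: "\<And>x. norm x \<le> 1 \<Longrightarrow> (\<lambda>n. of_real (Qc n * \<rho> ^ n) * x ^ n) sums GQ (csqrt (1 - x))"
    and v: "G0 0 = of_real (E_fun p q \<rho>)" "GQ 0 = of_real (Q_fun p q \<rho>)" "E_fun p q \<rho> > 0"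
    "deriv G0 0 = of_real (- kappa * E_fun p q \<rho>)" "deriv GQ 0 = of_real (- eta c d p q)" "eta c d p q > 0"
    by (rule critical_functions[OF \<tau>]) blast
  have Q1: "Q_fun p q \<rho> = 1" using crit by (simp add: is_rho0_def)
  have sQr: "(\<lambda>n. Qc n * \<rho> ^ n) sums 1"
    using Q_fun_sums[of \<rho>] crit rho_pos by (simp add: is_rho0_def)
  obtain L where L: "L analytic_on lobe" "\<And>s. GQ s = GQ 0 + s * L s" "L 0 = deriv GQ 0"
    using analytic_lobe_peel[OF G(2)] by blast
  have GQ: "1 - GQ s = s * (- L s)" for s using L(2)[of s] v(2) Q1 by simp
  have nz: "- L s \<noteq> 0" if s: "s \<in> lobe" for s
  proof (cases "s = 0")
    case True
    thus ?thesis using L(3) v by simp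
  next
    case False
    define x where "x = 1 - s\<^sup>2"
    have x: "norm x \<le> 1" "x \<noteq> 1" using s False by (auto simp: lobe_def x_def)
    have "csqrt (1 - x) = s" using csqrt_lobe[OF s] by (simp add: x_def)
    hence sx: "(\<lambda>n. of_real (Qc n * \<rho> ^ n) * x ^ n) sums GQ s" using sQ[OF x(1)] by simp
    have "GQ s \<noteq> 1"
    proof
      assume "GQ s = 1"
      have "x = of_real 1"
      proof (rule positive_series_eq_imp[of "\<lambda>n. Qc n * \<rho> ^ n" 1 x "Suc lag"])
        show "(\<lambda>n. complex_of_real (Qc n * \<rho> ^ n) * x ^ n) sums complex_of_real (\<Sum>n. Qc n * \<rho> ^ n * 1 ^ n)"
          using sx \<open>GQ s = 1\<close> sQr by (simp add: sums_iff)
        show "0 < Qc (Suc lag) * \<rho> ^ Suc lag" "0 < Qc (Suc (Suc lag)) * \<rho> ^ Suc (Suc lag)"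
          using Qc_pos[of 0] Qc_pos[of 1] rho_pos by auto
      qed (use x rho_pos Qc_nonneg sQr in \<open>auto simp: sums_iff\<close>)
      thus False using x by simp
    qed
    thus ?thesis using GQ[of s] by auto
  qed
  define H where "H = (\<lambda>s. G0 s / (- L s))"
  have anH: "H analytic_on lobe" unfolding H_def using nz by (intro analytic_intros G L) auto
  obtain H1 where H1: "H1 analytic_on lobe" "\<And>s. H s = H 0 + s * H1 s"
    using analytic_lobe_peel[OF anH] by blast
  define \<alpha> where "\<alpha> = E_fun p q \<rho> / eta c d p q"
  have H0: "H 0 = of_real \<alpha>" by (simp add: H_def L(3) v \<alpha>_def)
  have F: "(\<lambda>x. G0 (csqrt (1 - x)) / (1 - GQ (csqrt (1 - x)))) has_fps_expansion scaled_fps \<rho> (F0_fps p q)"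
    by (rule F0_fps_expansion) (use s0 sQ in auto)
  have "(\<lambda>x. G0 (csqrt (1 - x)) / (1 - GQ (csqrt (1 - x))) - of_real \<alpha> * (1 / csqrt (1 - x)))
      has_fps_expansion scaled_fps \<rho> (F0_fps p q) - fps_const (of_real \<alpha>) * Abs_fps (\<lambda>n. of_real (rsqrt_coeff n))"
    by (intro fps_expansion_intros F rsqrt_fps_expansion)
  also have "scaled_fps \<rho> (F0_fps p q) - fps_const (of_real \<alpha>) * Abs_fps (\<lambda>n. of_real (rsqrt_coeff n)) =
      Abs_fps (\<lambda>n. complex_of_real (ec n * \<rho> ^ n - \<alpha> * rsqrt_coeff n))"
    by (rule fps_ext) (simp add: scaled_F0)
  also have "(\<lambda>x. G0 (csqrt (1 - x)) / (1 - GQ (csqrt (1 - x))) - of_real \<alpha> * (1 / csqrt (1 - x)))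
      has_fps_expansion Abs_fps (\<lambda>n. complex_of_real (ec n * \<rho> ^ n - \<alpha> * rsqrt_coeff n)) \<longleftrightarrow>
      (\<lambda>x. H1 (csqrt (1 - x))) has_fps_expansion Abs_fps (\<lambda>n. complex_of_real (ec n * \<rho> ^ n - \<alpha> * rsqrt_coeff n))"
  proof (rule has_fps_expansion_cong)
    show "\<forall>\<^sub>F x in nhds 0. G0 (csqrt (1 - x)) / (1 - GQ (csqrt (1 - x))) - of_real \<alpha> * (1 / csqrt (1 - x)) = H1 (csqrt (1 - x))"
      using eventually_norm_less[OF zero_less_one]
    proof eventually_elim
      case (elim x)
      let ?s = "csqrt (1 - x)"
      have s: "?s \<noteq> 0" "?s \<in> lobe" using csqrt_disc(2)[of x] csqrt_in_lobe[of x] elim by auto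
      have "G0 ?s / (1 - GQ ?s) = H ?s / ?s" unfolding GQ using s nz[OF s(2)] by (simp add: H_def)
      also have "\<dots> = of_real \<alpha> / ?s + H1 ?s" by (subst H1(2)) (use s in \<open>simp add: H0 add_divide_distrib\<close>)
      finally show ?case by simp
    qed
  qed simp
  finally have exp: "(\<lambda>x. H1 (csqrt (1 - x))) has_fps_expansion Abs_fps (\<lambda>n. complex_of_real (ec n * \<rho> ^ n - \<alpha> * rsqrt_coeff n))" .
  let ?\<beta> = "Re (deriv H1 0)"
  have "(\<lambda>n. (ec n * \<rho> ^ n - \<alpha> * rsqrt_coeff n) - ?\<beta> * sqrt_coeff n) \<in> O(\<lambda>n. real n powr (-3/2))"
    by (rule landau_o.big_trans[OF lobe_series_coeffs(1)[OF H1(1) exp]]) real_asymp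
  moreover have "(\<lambda>n. ?\<beta> * sqrt_coeff n) \<in> O(\<lambda>n. real n powr (-3/2))"
    using sqrt_coeff_bigo by simp
  ultimately have "(\<lambda>n. ((ec n * \<rho> ^ n - \<alpha> * rsqrt_coeff n) - ?\<beta> * sqrt_coeff n) + ?\<beta> * sqrt_coeff n) \<in> O(\<lambda>n. real n powr (-3/2))"
    by (rule sum_in_bigo)
  hence small: "(\<lambda>n. ec n * \<rho> ^ n - \<alpha> * rsqrt_coeff n) \<in> O(\<lambda>n. real n powr (-3/2))" by simp
  have "\<alpha> \<noteq> 0" using v by (simp add: \<alpha>_def)
  then obtain r where r: "r \<in> O(\<lambda>n. 1 / real n)"
    "\<forall>\<^sub>F n in at_top. ec n * \<rho> ^ n = \<alpha> / sqrt (pi * real n) * (1 + r n)"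
    using rsqrt_type_asymp[OF small] by blast
  have "\<forall>\<^sub>F n in at_top. ec n = E_fun p q \<rho> / eta c d p q * (1 / \<rho>) ^ n / sqrt (pi * real n) * (1 + r n)"
    using r(2)
  proof eventually_elim
    case (elim n)
    have "ec n = (ec n * \<rho> ^ n) * (1 / \<rho>) ^ n" using rho_pos by (simp add: power_divide)
    thus ?case unfolding elim \<alpha>_def by simp
  qed
  thus ?thesis using r(1) by blast
qed

end

theorem theorem4p4:
  fixes c d :: int and p :: "int \<Rightarrow> real" and q :: real
  assumes c_ge: "1 \<le> c" and d_ge: "1 \<le> d"
    and p_nonneg: "\<forall>i. 0 \<le> p i"
    and p_supp: "\<forall>i. i < - c \<or> d < i \<longrightarrow> p i = 0"
    and p_left: "p (- c) \<noteq> 0" and p_right: "p d \<noteq> 0"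
    and q_pos: "0 < q"
    and aper: "aperiodic c d p"
  shows
    "(\<forall>\<rho>0. is_rho0 c d p q \<rho>0 \<and> \<rho>0 < rho c d p \<longrightarrow>
        (\<exists>K. 0 < K \<and> K < 1 / \<rho>0 \<and>
           (\<lambda>n. exc_coeff p q n
                 - E_fun p q \<rho>0 / (\<rho>0 * deriv (Q_fun p q) \<rho>0) * (1 / \<rho>0) ^ n)
             \<in> o(\<lambda>n. K ^ n)))
   \<and> (is_rho0 c d p q (rho c d p) \<longrightarrow>
        (\<exists>r. r \<in> O(\<lambda>n. 1 / real n) \<and>
           (\<forall>\<^sub>F n in at_top. exc_coeff p q n =
              E_fun p q (rho c d p) / eta c d p q
                * (1 / rho c d p) ^ n / sqrt (pi * real n) * (1 + r n))))
   \<and> ((\<nexists>\<rho>0. is_rho0 c d p q \<rho>0) \<longrightarrow>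
        (\<exists>r. r \<in> O(\<lambda>n. 1 / real n) \<and>
           (\<forall>\<^sub>F n in at_top. exc_coeff p q n =
              F0_fun p q (rho c d p) / 2
                * (sqrt (2 * Ppoly c d p (tau c d p) / deriv (deriv (Ppoly c d p)) (tau c d p))
                     * (1 / tau c d p)
                   + eta c d p q * D_fun p q (rho c d p))
                * (1 / rho c d p) ^ n / sqrt (pi * real n ^ 3) * (1 + r n))))"
proof -
  interpret catastrophe_model c d p q
    by unfold_locales (use assms in auto)
  have "\<forall>\<rho>0. is_rho0 c d p q \<rho>0 \<and> \<rho>0 < rho c d p \<longrightarrow>
        (\<exists>K. 0 < K \<and> K < 1 / \<rho>0 \<and>
           (\<lambda>n. exc_coeff p q n
                 - E_fun p q \<rho>0 / (\<rho>0 * deriv (Q_fun p q) \<rho>0) * (1 / \<rho>0) ^ n)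
             \<in> o(\<lambda>n. K ^ n))"
    using simple_pole_case by blast
  then show ?thesis
    using rho0_eq_rho_case no_rho0_case unfolding kappa_eq by blast
qed

end
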